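(* Let $R$ be a commutative unital ring and let $M$ be a finitely generated $R$-module (with the induced Zariski topology) such that $R/\mathfrak{m}$ is infinite for every $\mathfrak{m}\in S_M$, and which satisfies the equality $\sigma_\tau(M,R)=\sigma(M,R)=\min_{\mathfrak{m}\in S_M}|R/\mathfrak{m}|+1$. Let $T=R\setminus\bigcup_{\mathfrak{m}\in S_M}\mathfrak{m}$. Then the $T^{-1}R$-module $T^{-1}M$ (with the induced Zariski topology) also satisfies the equality $$\sigma_\tau(T^{-1}M,T^{-1}R)=\sigma(T^{-1}M,T^{-1}R)=\min_{T^{-1}\mathfrak{m}\in \mathrm{mSpec}(T^{-1}R)}|T^{-1}R/T^{-1}\mathfrak{m}|+1=\min_{\mathfrak{m}\in S_M}|R/\mathfrak{m}|+1.$$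
   Context: $\mathrm{mSpec}(A)$ is the set of maximal ideals of a ring $A$; $S_M=\{\mathfrak{m}\in\mathrm{mSpec}(R):\dim_{R/\mathfrak{m}}(M/\mathfrak{m}M)\ge 2\}$. $T^{-1}R$ and $T^{-1}M$ denote localization at the multiplicative set $T$; the first minimum is over all maximal ideals of $T^{-1}R$, written as $T^{-1}\mathfrak{m}$. Induced Zariski topology on a finite-dimensional vector space $V$ over a field $\mathbf{K}$: identify $V$ with $\mathbf{K}^n$ by a basis; closed sets are the common zero sets of families of polynomials in $\mathbf{K}[X_1,\dots,X_n]$ (independent of the basis). Induced Zariski topology on a finitely generated module $N$ over a commutative unital ring $A$ (used for $(A,N)=(R,M)$ and $(A,N)=(T^{-1}R,T^{-1}M)$): let $S_N=\{\mathfrak{n}\in\mathrm{mSpec}(A):\dim_{A/\mathfrak{n}}(N/\mathfrak{n}N)\ge 2\}$. Topologize each $N/\mathfrak{n}N$ with the induced Zariski topology as an $A/\mathfrak{n}$-vector space if $\mathfrak{n}\in S_N$, and with the topology whose only closed sets are $\emptyset,\{0\},N/\mathfrak{n}N$ if $\mathfrak{n}\notin S_N$; give $\prod_{\mathfrak{n}\in\mathrm{mSpec}(A)}N/\mathfrak{n}N$ the product topology; and give $N$ the coarsest topology making the natural map $N\to\prod_{\mathfrak{n}\in\mathrm{mSpec}(A)}N/\mathfrak{n}N$ continuous. $\sigma(N,A)$ is the minimum cardinal number of proper $A$-submodules of $N$ whose union is $N$; $\sigma_\tau(N,A)$ is the minimum cardinal number of proper closed subsets of $N$ (induced Zariski topology)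 whose union is $N$. *)

theory Defs
  imports
    "HOL-Analysis.Function_Topology"
    "HOL-Algebra.QuotRing"
    "HOL-Algebra.Indexed_Polynomials"
    "Jordan_Normal_Form.Missing_VectorSpace"
begin

unbundle cardinal_syntax

section \<open>Modules and their fibres\<close>

definition finitely_generated :: "('r, 'x) ring_scheme \<Rightarrow> ('r, 'm, 'y) module_scheme \<Rightarrow> bool" where
  "finitely_generated A N \<longleftrightarrow>
     (\<exists>S. finite S \<and> S \<subseteq> carrier N \<and> module.span A N S = carrier N)"

definition mSpec :: "('r, 'x) ring_scheme \<Rightarrow> 'r set set" where
  "mSpec A = {\<nn>. maximalideal \<nn> A}"

definition ideal_smult ::
    "('r, 'x) ring_scheme \<Rightarrow> 'r set \<Rightarrow> ('r, 'm, 'y) module_scheme \<Rightarrow> 'm set" where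
  "ideal_smult A I N = module.span A N {a \<odot>\<^bsub>N\<^esub> x | a x. a \<in> I \<and> x \<in> carrier N}"

text \<open>
  The quotient \<open>N/H\<close>, in the style of \<^const>\<open>FactRing\<close>.  Its scalars are cosets of an ideal
  \<open>I\<close> with \<open>I N \<subseteq> H\<close>; the union in \<^const>\<open>smult\<close> then ranges over equal cosets.
  The library's module record extends the ring record, so the fields \<^const>\<open>monoid.mult\<close> and
  \<^const>\<open>one\<close> have to be filled although a module does not use them.
\<close>

definition quot_module :: "('r, 'm, 'y) module_scheme \<Rightarrow> 'm set \<Rightarrow> ('r set, 'm set) module" where
  "quot_module N H =
    \<lparr>carrier = a_rcosets\<^bsub>N\<^esub> H, monoid.mult = (\<lambda>_ _. undefined), one = undefined,
     zero = H, add = set_add N,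
     smult = (\<lambda>P Q. \<Union>a\<in>P. \<Union>y\<in>Q. H +>\<^bsub>N\<^esub> (a \<odot>\<^bsub>N\<^esub> y))\<rparr>"

definition fibre ::
    "('r, 'x) ring_scheme \<Rightarrow> ('r, 'm, 'y) module_scheme \<Rightarrow> 'r set \<Rightarrow> ('r set, 'm set) module" where
  "fibre A N \<nn> = quot_module N (ideal_smult A \<nn> N)"

definition S_set :: "('r, 'x) ring_scheme \<Rightarrow> ('r, 'm, 'y) module_scheme \<Rightarrow> 'r set set" where
  "S_set A N = {\<nn> \<in> mSpec A. vectorspace.dim (A Quot \<nn>) (fibre A N \<nn>) \<ge> 2}"

section \<open>The induced Zariski topology\<close>

text \<open>
  A polynomial in the variables \<open>X\<^sub>b\<close> is, as in \<^theory>\<open>HOL-Algebra.Indexed_Polynomials\<close>, a function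
  from monomials (multisets of variables) to coefficients.
\<close>

definition poly_eval ::
    "('k, 'x) ring_scheme \<Rightarrow> ('v multiset \<Rightarrow> 'k) \<Rightarrow> ('v \<Rightarrow> 'k) \<Rightarrow> 'k" where
  "poly_eval K P x =
     (\<Oplus>\<^bsub>K\<^esub>\<mu> \<in> {\<mu>. P \<mu> \<noteq> \<zero>\<^bsub>K\<^esub>}.
        P \<mu> \<otimes>\<^bsub>K\<^esub> (\<Otimes>\<^bsub>K\<^esub>b \<in> set_mset \<mu>. x b [^]\<^bsub>K\<^esub> count \<mu> b))"

text \<open>
  The identification \<open>V \<cong> K\<^sup>n\<close> given by a basis \<open>B\<close> with \<open>n\<close> elements is \<^const>\<open>module.lincomb\<close>;
  coordinates and variables are indexed by \<open>B\<close> itself.  The closed sets do not depend on \<open>B\<close>.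
\<close>

definition zariski_closed ::
    "('k, 'x) ring_scheme \<Rightarrow> ('k, 'v, 'y) module_scheme \<Rightarrow> 'v set \<Rightarrow> bool" where
  "zariski_closed K V C \<longleftrightarrow>
     (\<exists>B F. finite B \<and> vectorspace.basis K V B \<and> F \<subseteq> ring.indexed_pset K B (carrier K) \<and>
        C = {module.lincomb V x B | x.
               x \<in> B \<rightarrow>\<^sub>E carrier K \<and> (\<forall>P\<in>F. poly_eval K P x = \<zero>\<^bsub>K\<^esub>)})"

definition zariski_topology ::
    "('k, 'x) ring_scheme \<Rightarrow> ('k, 'v, 'y) module_scheme \<Rightarrow> 'v topology" where
  "zariski_topology K V =
     topology (\<lambda>U. U \<subseteq> carrier V \<and> zariski_closed K V (carrier V - U))"

definition three_closed_topology :: "('k, 'v, 'y) module_scheme \<Rightarrow> 'v topology" where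
  "three_closed_topology V =
     topology (\<lambda>U. U \<subseteq> carrier V \<and> carrier V - U \<in> {{}, {\<zero>\<^bsub>V\<^esub>}, carrier V})"

definition fibre_topology ::
    "('r, 'x) ring_scheme \<Rightarrow> ('r, 'm, 'y) module_scheme \<Rightarrow> 'r set \<Rightarrow> 'm set topology" where
  "fibre_topology A N \<nn> =
     (if \<nn> \<in> S_set A N then zariski_topology (A Quot \<nn>) (fibre A N \<nn>)
      else three_closed_topology (fibre A N \<nn>))"

definition induced_zariski ::
    "('r, 'x) ring_scheme \<Rightarrow> ('r, 'm, 'y) module_scheme \<Rightarrow> 'm topology" where
  "induced_zariski A N =
     pullback_topology (carrier N)
       (\<lambda>x. \<lambda>\<nn>\<in>mSpec A. ideal_smult A \<nn> N +>\<^bsub>N\<^esub> x)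
       (product_topology (fibre_topology A N) (mSpec A))"

section \<open>Covering numbers\<close>

text \<open>
  \<open>is_min_card \<A> \<kappa>\<close> says that the minimum of the cardinals of the members of \<open>\<A>\<close> exists and
  is \<open>\<kappa>\<close>.  A relation is used because a covering number need not exist (a cyclic module is not a
  union of proper submodules), and because cardinals from different types have to be compared.
\<close>

definition is_min_card :: "'a set set \<Rightarrow> 'k rel \<Rightarrow> bool" where
  "is_min_card \<A> \<kappa> \<longleftrightarrow> (\<exists>A\<in>\<A>. |A| =o \<kappa>) \<and> (\<forall>A\<in>\<A>. \<kappa> \<le>o |A| )"

definition is_sigma ::
    "('r, 'x) ring_scheme \<Rightarrow> ('r, 'm, 'y) module_scheme \<Rightarrow> 'k rel \<Rightarrow> bool" where
  "is_sigma A N \<kappa> \<longleftrightarrow>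
     is_min_card {\<F>. (\<forall>H\<in>\<F>. Module.submodule H A N \<and> H \<noteq> carrier N) \<and> \<Union>\<F> = carrier N} \<kappa>"

definition is_sigma_tau ::
    "('r, 'x) ring_scheme \<Rightarrow> ('r, 'm, 'y) module_scheme \<Rightarrow> 'k rel \<Rightarrow> bool" where
  "is_sigma_tau A N \<kappa> \<longleftrightarrow>
     is_min_card {\<F>. (\<forall>C\<in>\<F>. closedin (induced_zariski A N) C \<and> C \<noteq> carrier N) \<and>
                     \<Union>\<F> = carrier N} \<kappa>"

definition is_min_residue_card :: "('r, 'x) ring_scheme \<Rightarrow> 'r set set \<Rightarrow> 'k rel \<Rightarrow> bool" where
  "is_min_residue_card A \<S> \<kappa> \<longleftrightarrow> is_min_card {carrier (A Quot \<nn>) | \<nn>. \<nn> \<in> \<S>} \<kappa>"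

section \<open>Localization\<close>

text \<open>
  \<open>rfrac A T a s\<close> and \<open>mfrac N T x s\<close> are the fractions \<open>a/s\<close> and \<open>x/s\<close>, that is, the classes of
  \<open>(a, s)\<close> and \<open>(x, s)\<close> for the usual equivalence relation on pairs.  The operations are
  unions over representatives, as in \<^const>\<open>rcoset_mult\<close>; for a multiplicative set \<open>T\<close> all
  sets in such a union are equal.
\<close>

definition rfrac :: "('r, 'x) ring_scheme \<Rightarrow> 'r set \<Rightarrow> 'r \<Rightarrow> 'r \<Rightarrow> ('r \<times> 'r) set" where
  "rfrac A T a s = {(b, t). b \<in> carrier A \<and> t \<in> T \<and>
     (\<exists>u\<in>T. u \<otimes>\<^bsub>A\<^esub> (s \<otimes>\<^bsub>A\<^esub> b) = u \<otimes>\<^bsub>A\<^esub> (t \<otimes>\<^bsub>A\<^esub> a))}"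

definition loc_ring :: "('r, 'x) ring_scheme \<Rightarrow> 'r set \<Rightarrow> ('r \<times> 'r) set ring" where
  "loc_ring A T =
    \<lparr>carrier = {rfrac A T a s | a s. a \<in> carrier A \<and> s \<in> T},
     monoid.mult = (\<lambda>P Q. \<Union>(a, s)\<in>P. \<Union>(b, t)\<in>Q. rfrac A T (a \<otimes>\<^bsub>A\<^esub> b) (s \<otimes>\<^bsub>A\<^esub> t)),
     one = rfrac A T \<one>\<^bsub>A\<^esub> \<one>\<^bsub>A\<^esub>,
     zero = rfrac A T \<zero>\<^bsub>A\<^esub> \<one>\<^bsub>A\<^esub>,
     add = (\<lambda>P Q. \<Union>(a, s)\<in>P. \<Union>(b, t)\<in>Q.
              rfrac A T (t \<otimes>\<^bsub>A\<^esub> a \<oplus>\<^bsub>A\<^esub> s \<otimes>\<^bsub>A\<^esub> b) (s \<otimes>\<^bsub>A\<^esub> t))\<rparr>"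

definition mfrac :: "('r, 'm, 'y) module_scheme \<Rightarrow> 'r set \<Rightarrow> 'm \<Rightarrow> 'r \<Rightarrow> ('m \<times> 'r) set" where
  "mfrac N T x s = {(y, t). y \<in> carrier N \<and> t \<in> T \<and>
     (\<exists>u\<in>T. u \<odot>\<^bsub>N\<^esub> (s \<odot>\<^bsub>N\<^esub> y) = u \<odot>\<^bsub>N\<^esub> (t \<odot>\<^bsub>N\<^esub> x))}"

definition loc_module ::
    "('r, 'x) ring_scheme \<Rightarrow> ('r, 'm, 'y) module_scheme \<Rightarrow> 'r set \<Rightarrow>
     (('r \<times> 'r) set, ('m \<times> 'r) set) module" where
  "loc_module A N T =
    \<lparr>carrier = {mfrac N T x s | x s. x \<in> carrier N \<and> s \<in> T},
     monoid.mult = (\<lambda>_ _. undefined), one = undefined,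
     zero = mfrac N T \<zero>\<^bsub>N\<^esub> \<one>\<^bsub>A\<^esub>,
     add = (\<lambda>P Q. \<Union>(x, s)\<in>P. \<Union>(y, t)\<in>Q.
              mfrac N T (t \<odot>\<^bsub>N\<^esub> x \<oplus>\<^bsub>N\<^esub> s \<odot>\<^bsub>N\<^esub> y) (s \<otimes>\<^bsub>A\<^esub> t)),
     smult = (\<lambda>P Q. \<Union>(a, s)\<in>P. \<Union>(y, t)\<in>Q. mfrac N T (a \<odot>\<^bsub>N\<^esub> y) (s \<otimes>\<^bsub>A\<^esub> t))\<rparr>"

end

theory Submission
  imports Defs
begin

text \<open>
  Write \<open>S\<close> for \<^term>\<open>S_set R M\<close>, \<open>A = T\<^sup>-\<^sup>1R\<close> and \<open>N = T\<^sup>-\<^sup>1M\<close>.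

  \<^bold>\<open>The maximal ideals of \<open>A\<close>.\<close>  The set \<open>S\<close> may be infinite, but it is closed, and this yields
  prime avoidance for it: by Nakayama's lemma, a maximal
  ideal lies in \<open>S\<close> exactly if it contains every \<open>a\<close> for which \<open>a M\<close> lies in a cyclic submodule.
  If an ideal \<open>J\<close> is covered by the members of \<open>S\<close>, and \<open>I\<close> is the ideal generated by these \<open>a\<close>,
  then \<open>J + I\<close> is proper, because \<open>1 = x + y\<close> with \<open>x \<in> J\<close> and \<open>y \<in> I\<close> would put \<open>1\<close> into a
  member of \<open>S\<close> that contains \<open>x\<close>.  A maximal ideal over \<open>J + I\<close> belongs to \<open>S\<close>
  (\<open>ideal_avoiding_imp_subset_S_set_member\<close>).  Hence contraction is a surjection from the maximal
  ideals of \<open>A\<close> onto \<open>S\<close>.  It preserves residue fields and fibres, so the minimum of the residue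
  cardinals stays the same and all maximal ideals of \<open>A\<close> lie in \<^term>\<open>S_set A N\<close>.

  \<^bold>\<open>Lower bounds.\<close>  The bounds for \<open>M\<close> are hypotheses, and covers of \<open>N\<close> pull back to covers
  of \<open>M\<close> along \<open>\<psi> : M \<rightarrow> N\<close>.  The preimage of a proper submodule is proper since
  the image of \<open>\<psi>\<close> generates \<open>N\<close>.  The preimage of a closed set is closed since polynomial functions
  on a fibre of \<open>N\<close> pull back to polynomial functions on the corresponding fibre of \<open>M\<close>
  (\<open>\<psi>_continuous\<close>).  It is proper since \<open>\<psi>\<close> has dense image (\<open>\<psi>_dense\<close>): a neighbourhood of \<open>x/s\<close>
  restricts only finitely many fibres, and one \<open>b\<close> in \<open>R\<close> can serve as the inverse of \<open>s\<close> modulo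
  finitely many maximal ideals, so that \<open>b x\<close> lies in the neighbourhood.

  \<^bold>\<open>Upper bounds.\<close>  A vector space of dimension at least two over \<open>K\<close> is the union of the hyperplanes
  \<open>f + c g = 0\<close> and \<open>g = 0\<close> for two independent functionals \<open>f\<close> and \<open>g\<close>.  Their preimages in \<open>N\<close> are
  submodules and closed sets at once, so that a single cover with at most \<open>|K| + 1\<close> members bounds
  both covering numbers (\<open>hyperplane_cover\<close>).

  The Zariski topology is defined through bases.  That it is a topology, and that the fibres
  of \<open>M\<close> and \<open>N\<close> can be compared, is proved through a description without bases: the closed sets are the
  zero sets of functions that arise from constants and linear functionals by addition and multiplication.
\<close>

section \<open>Quotients and fibres of modules\<close>

lemma carrier_FactRing: "carrier (R Quot I) = {I +>\<^bsub>R\<^esub> a | a. a \<in> carrier R}"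
  by (auto simp: FactRing_def A_RCOSETS_def')

lemma (in cring) ideal_criterion:
  assumes sub: "I \<subseteq> carrier R" and zero: "\<zero> \<in> I"
    and add: "\<And>a b. a \<in> I \<Longrightarrow> b \<in> I \<Longrightarrow> a \<oplus> b \<in> I"
    and mult: "\<And>a x. a \<in> I \<Longrightarrow> x \<in> carrier R \<Longrightarrow> x \<otimes> a \<in> I"
  shows "ideal I R"
proof (rule idealI[OF ring_axioms])
  show "subgroup I (add_monoid R)"
  proof (rule add.subgroupI)
    show "I \<noteq> {}" using zero by blast
    show "\<ominus> a \<in> I" if "a \<in> I" for a
      using mult[OF that, of "\<ominus> \<one>"] that sub by (simp add: l_minus subset_iff)
  qed (use sub add in auto)
  show "a \<otimes> x \<in> I" if "a \<in> I" "x \<in> carrier R" for a x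
    using mult[OF that] that sub by (simp add: m_comm subset_iff)
qed (rule mult)

lemma (in module) submodule_criterion:
  assumes sub: "H \<subseteq> carrier M" and zero: "\<zero>\<^bsub>M\<^esub> \<in> H"
    and add: "\<And>a b. a \<in> H \<Longrightarrow> b \<in> H \<Longrightarrow> a \<oplus>\<^bsub>M\<^esub> b \<in> H"
    and smult: "\<And>a x. a \<in> carrier R \<Longrightarrow> x \<in> H \<Longrightarrow> a \<odot>\<^bsub>M\<^esub> x \<in> H"
  shows "Module.submodule H R M"
proof (rule submoduleI[OF sub zero _ add smult])
  show "\<ominus>\<^bsub>M\<^esub> x \<in> H" if "x \<in> H" for x
    using smult[of "\<ominus> \<one>", OF _ that] that sub by (simp add: smult_l_minus subset_iff)
qed

lemma (in module) minus_add_cancel: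
  "x \<in> carrier M \<Longrightarrow> y \<in> carrier M \<Longrightarrow> (x \<ominus>\<^bsub>M\<^esub> y) \<oplus>\<^bsub>M\<^esub> y = x"
  by (simp add: a_minus_def M.a_assoc M.l_neg)

lemma (in module) eq_if_minus_zero:
  assumes "x \<in> carrier M" "y \<in> carrier M" "x \<ominus>\<^bsub>M\<^esub> y = \<zero>\<^bsub>M\<^esub>"
  shows "x = y"
  using minus_add_cancel[OF assms(1,2)] assms by simp


context module
begin

lemma span_submodule:
  assumes "G \<subseteq> carrier M" shows "Module.submodule (span G) R M"
proof -
  interpret s: LinearCombinations.submodule R "span G" M
    by (rule span_is_submodule[OF assms])
  show ?thesis
  proof (rule submoduleI)
    fix x assume x: "x \<in> span G"
    then have "(\<ominus> \<one>) \<odot>\<^bsub>M\<^esub> x \<in> span G" by (intro s.smult_closed) auto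
    moreover have "x \<in> carrier M" using x s.subset by blast
    ultimately show "\<ominus>\<^bsub>M\<^esub> x \<in> span G" by (simp add: smult_l_minus)
  qed (use s.subset in auto)
qed

lemma span_least:
  assumes "G \<subseteq> H" "Module.submodule H R M" shows "span G \<subseteq> H"
proof (rule span_is_subset[OF assms(1)])
  show "LinearCombinations.submodule R H M"
    by unfold_locales
      (use submoduleE[OF assms(2)] Module.submodule.axioms(1)[OF assms(2), THEN subgroup.one_closed] in auto)
qed

lemma submodule_zero: "Module.submodule H R M \<Longrightarrow> \<zero>\<^bsub>M\<^esub> \<in> H"
  using subgroup.one_closed[OF submodule.axioms(1)] by fastforce

lemma submodule_abelian_subgroup: "Module.submodule H R M \<Longrightarrow> abelian_subgroup H M"
  by (intro abelian_subgroupI3 additive_subgroupI M.abelian_group_axioms) (simp add: submodule.axioms(1))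

lemma submodule_coset_eq_iff:
  assumes H: "Module.submodule H R M" and x: "x \<in> carrier M" and y: "y \<in> carrier M"
  shows "H +>\<^bsub>M\<^esub> x = H +>\<^bsub>M\<^esub> y \<longleftrightarrow> x \<ominus>\<^bsub>M\<^esub> y \<in> H"
proof -
  interpret abelian_subgroup H M by (rule submodule_abelian_subgroup[OF H])
  have "H +>\<^bsub>M\<^esub> x = H +>\<^bsub>M\<^esub> y \<longleftrightarrow> x \<in> H +>\<^bsub>M\<^esub> y"
    using a_rcos_self[OF x] M.a_repr_independence[OF _ y a_subgroup] by metis
  also have "\<dots> \<longleftrightarrow> x \<ominus>\<^bsub>M\<^esub> y \<in> H"
    unfolding a_minus_def by (rule a_rcos_module[OF y x])
  finally show ?thesis .
qed

lemma ideal_smult_gens_subset: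
  assumes "ideal I R"
  shows "{a \<odot>\<^bsub>M\<^esub> x | a x. a \<in> I \<and> x \<in> carrier M} \<subseteq> carrier M"
  using ideal.Icarr[OF assms] by auto

lemma ideal_smult_submodule: "ideal I R \<Longrightarrow> Module.submodule (ideal_smult R I M) R M"
  unfolding ideal_smult_def by (intro span_submodule ideal_smult_gens_subset)

lemma ideal_smultI: "\<lbrakk>ideal I R; a \<in> I; x \<in> carrier M\<rbrakk> \<Longrightarrow> a \<odot>\<^bsub>M\<^esub> x \<in> ideal_smult R I M"
  unfolding ideal_smult_def using in_own_span[OF ideal_smult_gens_subset] by blast

lemma ideal_smult_least:
  assumes "Module.submodule W R M" "\<And>a x. a \<in> I \<Longrightarrow> x \<in> carrier M \<Longrightarrow> a \<odot>\<^bsub>M\<^esub> x \<in> W"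
  shows "ideal_smult R I M \<subseteq> W"
  unfolding ideal_smult_def by (rule span_least) (use assms in auto)

lemma fibre_carrier:
  "carrier (fibre R M I) = {ideal_smult R I M +>\<^bsub>M\<^esub> x | x. x \<in> carrier M}"
  by (auto simp: fibre_def quot_module_def A_RCOSETS_def')

lemma fibre_carrierI [intro, simp]:
  "x \<in> carrier M \<Longrightarrow> ideal_smult R I M +>\<^bsub>M\<^esub> x \<in> carrier (fibre R M I)"
  by (auto simp: fibre_carrier)

lemma fibre_zero: "\<zero>\<^bsub>fibre R M I\<^esub> = ideal_smult R I M"
  by (simp add: fibre_def quot_module_def)

lemma fibre_zero_coset:
  "ideal I R \<Longrightarrow> ideal_smult R I M +>\<^bsub>M\<^esub> \<zero>\<^bsub>M\<^esub> = \<zero>\<^bsub>fibre R M I\<^esub>"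
  using submoduleE(1)[OF ideal_smult_submodule] by (simp add: fibre_zero)

lemma fibre_add:
  assumes "ideal I R" "x \<in> carrier M" "y \<in> carrier M"
  shows "(ideal_smult R I M +>\<^bsub>M\<^esub> x) \<oplus>\<^bsub>fibre R M I\<^esub> (ideal_smult R I M +>\<^bsub>M\<^esub> y)
    = ideal_smult R I M +>\<^bsub>M\<^esub> (x \<oplus>\<^bsub>M\<^esub> y)"
  using abelian_subgroup.a_rcos_sum[OF submodule_abelian_subgroup[OF ideal_smult_submodule]] assms
  by (simp add: fibre_def quot_module_def)

lemma fibre_coset_eq_iff:
  assumes "ideal I R" "x \<in> carrier M" "y \<in> carrier M"
  shows "ideal_smult R I M +>\<^bsub>M\<^esub> x = ideal_smult R I M +>\<^bsub>M\<^esub> y \<longleftrightarrow> x \<ominus>\<^bsub>M\<^esub> y \<in> ideal_smult R I M"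
  by (rule submodule_coset_eq_iff[OF ideal_smult_submodule assms(2,3)]) fact

lemma smult_minus_distr:
  "\<lbrakk>a \<in> carrier R; x \<in> carrier M; y \<in> carrier M\<rbrakk> \<Longrightarrow> a \<odot>\<^bsub>M\<^esub> (x \<ominus>\<^bsub>M\<^esub> y) = a \<odot>\<^bsub>M\<^esub> x \<ominus>\<^bsub>M\<^esub> a \<odot>\<^bsub>M\<^esub> y"
  by (simp add: a_minus_def smult_r_distr smult_r_minus)

lemma minus_smult_distr:
  "\<lbrakk>a \<in> carrier R; b \<in> carrier R; x \<in> carrier M\<rbrakk> \<Longrightarrow> (a \<ominus> b) \<odot>\<^bsub>M\<^esub> x = a \<odot>\<^bsub>M\<^esub> x \<ominus>\<^bsub>M\<^esub> b \<odot>\<^bsub>M\<^esub> x"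
  by (simp add: a_minus_def smult_l_distr smult_l_minus)

lemma minus_add_minus:
  "\<lbrakk>x \<in> carrier M; y \<in> carrier M; z \<in> carrier M\<rbrakk> \<Longrightarrow> (x \<ominus>\<^bsub>M\<^esub> y) \<oplus>\<^bsub>M\<^esub> (y \<ominus>\<^bsub>M\<^esub> z) = x \<ominus>\<^bsub>M\<^esub> z"
  by (simp add: a_minus_def M.a_assoc M.r_neg1 M.r_neg2)

text \<open>
  The union in the scalar multiplication of a quotient ranges over all representatives of both
  cosets; all the cosets in it agree because \<open>a' x' - a x = (a' - a) x' + a (x' - x)\<close>.
\<close>

lemma fibre_smult:
  assumes I: "ideal I R" and a: "a \<in> carrier R" and x: "x \<in> carrier M"
  shows "(I +> a) \<odot>\<^bsub>fibre R M I\<^esub> (ideal_smult R I M +>\<^bsub>M\<^esub> x) = ideal_smult R I M +>\<^bsub>M\<^esub> (a \<odot>\<^bsub>M\<^esub> x)"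
proof -
  interpret I: ideal I R by fact
  let ?H = "ideal_smult R I M"
  note H = ideal_smult_submodule[OF I]
  interpret H: abelian_subgroup ?H M by (rule submodule_abelian_subgroup[OF H])
  have eq: "?H +>\<^bsub>M\<^esub> (a' \<odot>\<^bsub>M\<^esub> x') = ?H +>\<^bsub>M\<^esub> (a \<odot>\<^bsub>M\<^esub> x)"
    if a': "a' \<in> I +> a" and x': "x' \<in> ?H +>\<^bsub>M\<^esub> x" for a' x'
  proof -
    have a'c: "a' \<in> carrier R"
      using a' a I.a_subset R.a_r_coset_subset_G by blast
    have x'c: "x' \<in> carrier M"
      using x' x H.a_subset M.a_r_coset_subset_G by blast
    have "a' \<ominus> a \<in> I" "x' \<ominus>\<^bsub>M\<^esub> x \<in> ?H"
      using a' x' I.a_rcos_module_minus[OF R.ring_axioms a a'c] H.a_rcos_module[OF x x'c] by (auto simp: a_minus_def)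
    then have "(a' \<ominus> a) \<odot>\<^bsub>M\<^esub> x' \<oplus>\<^bsub>M\<^esub> a \<odot>\<^bsub>M\<^esub> (x' \<ominus>\<^bsub>M\<^esub> x) \<in> ?H"
      using submoduleE(4,5)[OF H] ideal_smultI[OF I] a x'c by blast
    then have "a' \<odot>\<^bsub>M\<^esub> x' \<ominus>\<^bsub>M\<^esub> a \<odot>\<^bsub>M\<^esub> x \<in> ?H"
      using a a'c x x'c by (simp add: smult_minus_distr minus_smult_distr minus_add_minus)
    then show ?thesis
      using a a'c x x'c by (simp add: fibre_coset_eq_iff[OF I])
  qed
  have "(I +> a) \<odot>\<^bsub>fibre R M I\<^esub> (?H +>\<^bsub>M\<^esub> x)
      = (\<Union>a'\<in>I +> a. \<Union>x'\<in>?H +>\<^bsub>M\<^esub> x. ?H +>\<^bsub>M\<^esub> (a' \<odot>\<^bsub>M\<^esub> x'))"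
    by (simp add: fibre_def quot_module_def)
  also have "\<dots> = ?H +>\<^bsub>M\<^esub> (a \<odot>\<^bsub>M\<^esub> x)"
    using I.a_rcos_self[OF a] H.a_rcos_self[OF x] eq by blast
  finally show ?thesis .
qed

lemma fibre_module:
  assumes I: "ideal I R" shows "module (R Quot I) (fibre R M I)"
proof -
  interpret I: ideal I R by fact
  interpret q: ring_hom_ring R "R Quot I" "(+>) I" by (rule I.rcos_ring_hom_ring)
  interpret H: abelian_subgroup "ideal_smult R I M" M
    by (rule submodule_abelian_subgroup[OF ideal_smult_submodule[OF I]])
  show ?thesis
  proof (rule moduleI)
    show "cring (R Quot I)" by (rule I.quotient_is_cring[OF R.is_cring])
    show "abelian_group (fibre R M I)"
    proof (rule abelian_groupI)
      fix x assume "x \<in> carrier (fibre R M I)"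
      then obtain x' where x: "x = ideal_smult R I M +>\<^bsub>M\<^esub> x'" "x' \<in> carrier M"
        by (auto simp: fibre_carrier)
      have "(ideal_smult R I M +>\<^bsub>M\<^esub> (\<ominus>\<^bsub>M\<^esub> x')) \<oplus>\<^bsub>fibre R M I\<^esub> x = \<zero>\<^bsub>fibre R M I\<^esub>"
        using x by (simp add: fibre_add[OF I] fibre_zero_coset[OF I, symmetric] M.l_neg)
      then show "\<exists>y\<in>carrier (fibre R M I). y \<oplus>\<^bsub>fibre R M I\<^esub> x = \<zero>\<^bsub>fibre R M I\<^esub>"
        using x(2) by blast
    qed (auto simp: fibre_carrier fibre_add[OF I] fibre_zero_coset[OF I, symmetric] M.a_ac)
  next
    fix x assume "x \<in> carrier (fibre R M I)"
    then obtain x' where x: "x = ideal_smult R I M +>\<^bsub>M\<^esub> x'" "x' \<in> carrier M"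
      by (auto simp: fibre_carrier)
    show "\<one>\<^bsub>R Quot I\<^esub> \<odot>\<^bsub>fibre R M I\<^esub> x = x"
      using x by (simp add: q.hom_one[symmetric] fibre_smult[OF I] del: q.hom_one)
    fix a assume "a \<in> carrier (R Quot I)"
    then obtain a' where a: "a = I +> a'" "a' \<in> carrier R" by (auto simp: carrier_FactRing)
    show "a \<odot>\<^bsub>fibre R M I\<^esub> x \<in> carrier (fibre R M I)"
      using a x by (simp add: fibre_smult[OF I])
  next
    fix a b x assume "a \<in> carrier (R Quot I)" "b \<in> carrier (R Quot I)" "x \<in> carrier (fibre R M I)"
    then obtain a' b' x' where x: "x = ideal_smult R I M +>\<^bsub>M\<^esub> x'" "x' \<in> carrier M"
      and a: "a = I +> a'" "a' \<in> carrier R" and b: "b = I +> b'" "b' \<in> carrier R"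
      by (auto simp: fibre_carrier carrier_FactRing)
    show "(a \<oplus>\<^bsub>R Quot I\<^esub> b) \<odot>\<^bsub>fibre R M I\<^esub> x
        = a \<odot>\<^bsub>fibre R M I\<^esub> x \<oplus>\<^bsub>fibre R M I\<^esub> b \<odot>\<^bsub>fibre R M I\<^esub> x"
      using a b x by (simp add: q.hom_add[symmetric] fibre_smult[OF I] fibre_add[OF I] smult_l_distr del: q.hom_add)
    show "(a \<otimes>\<^bsub>R Quot I\<^esub> b) \<odot>\<^bsub>fibre R M I\<^esub> x = a \<odot>\<^bsub>fibre R M I\<^esub> (b \<odot>\<^bsub>fibre R M I\<^esub> x)"
      using a b x by (simp add: q.hom_mult[symmetric] fibre_smult[OF I] smult_assoc1 del: q.hom_mult)
  next
    fix a x y assume "a \<in> carrier (R Quot I)" "x \<in> carrier (fibre R M I)" "y \<in> carrier (fibre R M I)"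
    then obtain a' x' y' where x: "x = ideal_smult R I M +>\<^bsub>M\<^esub> x'" "x' \<in> carrier M"
      and y: "y = ideal_smult R I M +>\<^bsub>M\<^esub> y'" "y' \<in> carrier M" and a: "a = I +> a'" "a' \<in> carrier R"
      by (auto simp: fibre_carrier carrier_FactRing)
    show "a \<odot>\<^bsub>fibre R M I\<^esub> (x \<oplus>\<^bsub>fibre R M I\<^esub> y)
        = a \<odot>\<^bsub>fibre R M I\<^esub> x \<oplus>\<^bsub>fibre R M I\<^esub> a \<odot>\<^bsub>fibre R M I\<^esub> y"
      using a x y by (simp add: fibre_smult[OF I] fibre_add[OF I] smult_r_distr)
  qed
qed

lemma fibre_vectorspace:
  "maximalideal I R \<Longrightarrow> vectorspace (R Quot I) (fibre R M I)"
  by (intro vectorspace.intro fibre_module maximalideal.axioms(1))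
    (auto intro: maximalideal.quotient_is_field R.is_cring)

text \<open>
  The images of generators span the fibre, since the elements of \<open>M\<close> that map into their span
  form a submodule.
\<close>

lemma fibre_fin_dim:
  assumes fg: "finitely_generated R M" and I: "maximalideal I R"
  shows "vectorspace.fin_dim (R Quot I) (fibre R M I)"
proof -
  note I' = maximalideal.axioms(1)[OF I]
  interpret V: vectorspace "R Quot I" "fibre R M I" by (rule fibre_vectorspace[OF I])
  obtain G where G: "finite G" "G \<subseteq> carrier M" "span G = carrier M"
    using fg by (auto simp: finitely_generated_def)
  let ?p = "\<lambda>x. ideal_smult R I M +>\<^bsub>M\<^esub> x"
  have sub: "?p ` G \<subseteq> carrier (fibre R M I)" using G by auto
  note W = V.submoduleE[OF V.span_submodule[OF sub]]
  let ?W = "{x \<in> carrier M. ?p x \<in> V.span (?p ` G)}"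
  have "Module.submodule ?W R M"
  proof (rule submodule_criterion)
    show "\<zero>\<^bsub>M\<^esub> \<in> ?W"
      using V.submodule_zero[OF V.span_submodule[OF sub]] by (simp add: fibre_zero_coset[OF I'])
    show "a \<odot>\<^bsub>M\<^esub> x \<in> ?W"
      if "a \<in> carrier R" "x \<in> ?W" for a x
      using that W(4)[of "I +> a" "?p x"] by (auto simp: fibre_smult[OF I'] carrier_FactRing)
    show "x \<oplus>\<^bsub>M\<^esub> y \<in> ?W"
      if "x \<in> ?W" "y \<in> ?W" for x y
      using that W(5)[of "?p x" "?p y"] by (auto simp: fibre_add[OF I'])
  qed auto
  then have "carrier M \<subseteq> ?W"
    unfolding G(3)[symmetric] by (rule span_least[rotated]) (use G V.in_own_span[OF sub] in auto)
  then have "V.span (?p ` G) = carrier (fibre R M I)"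
    using W(1) by (auto simp: fibre_carrier)
  then show ?thesis
    unfolding V.fin_dim_def using G(1) sub by blast
qed

end

lemma (in vectorspace) dim_ge_2_iff_not_cyclic:
  assumes "fin_dim"
  shows "dim \<ge> 2 \<longleftrightarrow> \<not> (\<exists>y\<in>carrier V. \<forall>v\<in>carrier V. \<exists>k\<in>carrier K. v = k \<odot>\<^bsub>V\<^esub> y)"
proof
  assume dim: "dim \<ge> 2"
  show "\<not> (\<exists>y\<in>carrier V. \<forall>v\<in>carrier V. \<exists>k\<in>carrier K. v = k \<odot>\<^bsub>V\<^esub> y)"
  proof
    assume "\<exists>y\<in>carrier V. \<forall>v\<in>carrier V. \<exists>k\<in>carrier K. v = k \<odot>\<^bsub>V\<^esub> y"
    then obtain y where y: "y \<in> carrier V" and gen: "\<forall>v\<in>carrier V. \<exists>k\<in>carrier K. v = k \<odot>\<^bsub>V\<^esub> y"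
      by blast
    have "v \<in> span {y}" if "v \<in> carrier V" for v
    proof -
      obtain k where k: "k \<in> carrier K" "v = k \<odot>\<^bsub>V\<^esub> y" using gen \<open>v \<in> carrier V\<close> by blast
      then show ?thesis
        using submoduleE(4)[OF span_submodule] in_own_span[of "{y}"] y by blast
    qed
    then have "gen_set {y}" using span_is_subset2[of "{y}"] y by blast
    then have "dim \<le> 1" using gen_ge_dim[of "{y}"] y by simp
    with dim show False by simp
  qed
next
  assume not: "\<not> (\<exists>y\<in>carrier V. \<forall>v\<in>carrier V. \<exists>k\<in>carrier K. v = k \<odot>\<^bsub>V\<^esub> y)"
  obtain B where B: "finite B" "basis B" using finite_basis_exists[OF assms] by blast
  then have B': "B \<subseteq> carrier V" "span B = carrier V" "dim = card B"
    by (auto simp: basis_def dim_basis)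
  show "dim \<ge> 2"
  proof (rule ccontr)
    assume "\<not> dim \<ge> 2"
    then have "card B \<le> 1" using B' by simp
    have "\<exists>y\<in>carrier V. B \<subseteq> {y}"
    proof (cases "B = {}")
      case False
      then obtain y where "y \<in> B" by blast
      then show ?thesis using \<open>card B \<le> 1\<close> B(1) B'(1) card_le_Suc0_iff_eq[OF B(1)] by auto
    qed auto
    then obtain y where y: "B \<subseteq> {y}" "y \<in> carrier V" by blast
    let ?W = "{k \<odot>\<^bsub>V\<^esub> y | k. k \<in> carrier K}"
    have sub: "Module.submodule ?W K V"
    proof (rule submodule_criterion)
      show "?W \<subseteq> carrier V" using y by auto
      show "\<zero>\<^bsub>V\<^esub> \<in> ?W"
        using y smult_l_null[of y] by (metis (mono_tags, lifting) R.zero_closed mem_Collect_eq)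
      show "a \<oplus>\<^bsub>V\<^esub> b \<in> ?W"
        if "a \<in> ?W" "b \<in> ?W" for a b
        using that y smult_l_distr[symmetric] R.a_closed by blast
      show "a \<odot>\<^bsub>V\<^esub> b \<in> ?W"
        if "a \<in> carrier K" "b \<in> ?W" for a b
        using that y smult_assoc1[symmetric] R.m_closed by blast
    qed
    have "y \<in> ?W"
      using y smult_one[of y] R.one_closed by (metis (mono_tags, lifting) mem_Collect_eq)
    then have "carrier V \<subseteq> ?W"
      using span_least[OF _ sub, of B] y B'(2) by blast
    then show False using not y by blast
  qed
qed

context module
begin

text \<open>
  This form speaks of elements of \<open>M\<close> only.  It makes the dimension accessible
  to Nakayama's lemma and to a comparison along a semilinear map.
\<close>

lemma mem_S_set_iff:
  assumes fg: "finitely_generated R M" and I: "maximalideal I R"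
  shows "I \<in> S_set R M \<longleftrightarrow>
    \<not> (\<exists>y\<in>carrier M. \<forall>x\<in>carrier M. \<exists>r\<in>carrier R. x \<ominus>\<^bsub>M\<^esub> r \<odot>\<^bsub>M\<^esub> y \<in> ideal_smult R I M)"
proof -
  note I' = maximalideal.axioms(1)[OF I]
  interpret V: vectorspace "R Quot I" "fibre R M I" by (rule fibre_vectorspace[OF I])
  have "I \<in> S_set R M \<longleftrightarrow> V.dim \<ge> 2" using I by (simp add: S_set_def mSpec_def)
  also have "\<dots> \<longleftrightarrow> \<not> (\<exists>y\<in>carrier (fibre R M I). \<forall>v\<in>carrier (fibre R M I).
      \<exists>k\<in>carrier (R Quot I). v = k \<odot>\<^bsub>fibre R M I\<^esub> y)"
    by (rule V.dim_ge_2_iff_not_cyclic[OF fibre_fin_dim[OF fg I]])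
  also have "(\<exists>y\<in>carrier (fibre R M I). \<forall>v\<in>carrier (fibre R M I).
      \<exists>k\<in>carrier (R Quot I). v = k \<odot>\<^bsub>fibre R M I\<^esub> y) \<longleftrightarrow>
      (\<exists>y\<in>carrier M. \<forall>x\<in>carrier M. \<exists>r\<in>carrier R.
        ideal_smult R I M +>\<^bsub>M\<^esub> x = (I +> r) \<odot>\<^bsub>fibre R M I\<^esub> (ideal_smult R I M +>\<^bsub>M\<^esub> y))"
  proof -
    have "carrier (fibre R M I) = (\<lambda>x. ideal_smult R I M +>\<^bsub>M\<^esub> x) ` carrier M"
      and "carrier (R Quot I) = (\<lambda>r. I +> r) ` carrier R"
      by (auto simp: fibre_carrier carrier_FactRing)
    then show ?thesis by (simp only: bex_simps ball_simps)
  qed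
  also have "\<dots> \<longleftrightarrow> (\<exists>y\<in>carrier M. \<forall>x\<in>carrier M. \<exists>r\<in>carrier R. x \<ominus>\<^bsub>M\<^esub> r \<odot>\<^bsub>M\<^esub> y \<in> ideal_smult R I M)"
    by (simp add: fibre_smult[OF I'] fibre_coset_eq_iff[OF I'])
  finally show ?thesis .
qed

end

section \<open>The maximal ideals with fibre dimension at least two\<close>

text \<open>
  An inverse in the residue field, expressed in the ring.
\<close>

lemma (in cring) maximalideal_inverse:
  assumes n: "maximalideal n R" and a: "a \<in> carrier R" "a \<notin> n"
  shows "\<exists>b\<in>carrier R. \<one> \<ominus> b \<otimes> a \<in> n"
proof -
  interpret n: maximalideal n R by fact
  interpret q: ring_hom_ring R "R Quot n" "(+>) n" by (rule n.rcos_ring_hom_ring)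
  interpret F: field "R Quot n" by (rule n.quotient_is_field[OF is_cring])
  have "n +> a \<noteq> \<zero>\<^bsub>R Quot n\<^esub>"
    using a(2) n.a_rcos_self[OF a(1)] by (metis FactRing_def ring_record_simps(11))
  then have u: "n +> a \<in> Units (R Quot n)"
    unfolding F.field_Units using q.hom_closed[OF a(1)] by simp
  obtain b' where b': "b' \<in> carrier (R Quot n)" "b' \<otimes>\<^bsub>R Quot n\<^esub> (n +> a) = \<one>\<^bsub>R Quot n\<^esub>"
    by (rule bexE[OF q.S.Units_l_inv_ex[OF u]])
  from b'(1) obtain b where b: "b \<in> carrier R" "b' = n +> b"
    unfolding carrier_FactRing by (elim CollectE exE conjE)
  have "n +> \<one> = n +> (b \<otimes> a)"
    using b'(2) unfolding b(2) q.hom_mult[OF b(1) a(1)] q.hom_one by (rule sym)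
  then have "\<one> \<ominus> b \<otimes> a \<in> n"
    by (rule iffD2[OF quotient_eq_iff_same_a_r_cos[OF n.ideal_axioms one_closed m_closed[OF b(1) a(1)]]])
  with b(1) show ?thesis by (rule bexI[rotated])
qed

lemma (in cring) proper_ideal_imp_maximalideal:
  assumes J: "ideal J R" "\<one> \<notin> J"
  shows "\<exists>n. maximalideal n R \<and> J \<subseteq> n"
proof -
  define \<I> where "\<I> = {I. ideal I R \<and> J \<subseteq> I \<and> \<one> \<notin> I}"
  have "\<exists>n\<in>\<I>. \<forall>Y\<in>\<I>. n \<subseteq> Y \<longrightarrow> Y = n"
  proof (rule subset_Zorn_nonempty)
    show "\<I> \<noteq> {}" using J by (auto simp: \<I>_def)
    fix C assume C: "C \<noteq> {}" "subset.chain \<I> C"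
    then have "subset.chain {I. ideal I R} C" by (auto simp: \<I>_def subset_chain_def)
    from chain_Union_is_ideal[OF this] C show "\<Union>C \<in> \<I>"
      by (auto simp: \<I>_def subset_chain_def)
  qed
  then obtain n where n: "ideal n R" "J \<subseteq> n" "\<one> \<notin> n"
    and max: "\<And>Y. ideal Y R \<Longrightarrow> J \<subseteq> Y \<Longrightarrow> \<one> \<notin> Y \<Longrightarrow> n \<subseteq> Y \<Longrightarrow> Y = n" by (auto simp: \<I>_def)
  have "maximalideal n R"
  proof (rule maximalidealI[OF n(1)])
    show "carrier R \<noteq> n" using n(3) by auto
    fix Y assume Y: "ideal Y R" "n \<subseteq> Y" "Y \<subseteq> carrier R"
    then show "Y = n \<or> Y = carrier R"
      using max[of Y] n(2) ideal.one_imp_carrier[OF Y(1)] by blast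
  qed
  with n show ?thesis by blast
qed

context module
begin

lemma submodule_smult_preimage:
  assumes L: "Module.submodule L R M" and a: "a \<in> carrier R"
  shows "Module.submodule {x \<in> carrier M. a \<odot>\<^bsub>M\<^esub> x \<in> L} R M"
proof (rule submodule_criterion)
  show "b \<odot>\<^bsub>M\<^esub> x \<in> {x \<in> carrier M. a \<odot>\<^bsub>M\<^esub> x \<in> L}"
    if "b \<in> carrier R" "x \<in> {x \<in> carrier M. a \<odot>\<^bsub>M\<^esub> x \<in> L}" for b x
  proof -
    have "a \<odot>\<^bsub>M\<^esub> (b \<odot>\<^bsub>M\<^esub> x) = b \<odot>\<^bsub>M\<^esub> (a \<odot>\<^bsub>M\<^esub> x)"
      using a that by (simp add: smult_assoc1[symmetric] m_comm)
    then show ?thesis using that submoduleE(4)[OF L] by simp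
  qed
qed (use a submoduleE(5)[OF L] submodule_zero[OF L] in \<open>auto simp: smult_r_distr\<close>)

text \<open>
  Nakayama's lemma without determinants, by elimination of one generator at a time.  The hypothesis
  reads \<open>b G \<subseteq> L + n G\<close>.  The relation for the generator \<open>t\<close> becomes \<open>d t \<in> L + n (G - {t})\<close> with
  \<open>d = b - c\<^sub>t\<close> outside the prime \<open>n\<close>; after multiplication by \<open>d\<close> it removes \<open>t\<close> from the other
  relations, and \<open>d b\<close> takes the place of \<open>b\<close>.
\<close>

lemma nakayama_elimination:
  assumes n: "primeideal n R" and L: "Module.submodule L R M" and "finite G"
  shows "\<lbrakk>G \<subseteq> carrier M; b \<in> carrier R; b \<notin> n;
      \<And>s. s \<in> G \<Longrightarrow> \<exists>c\<in>G \<rightarrow> n. \<exists>l\<in>L. b \<odot>\<^bsub>M\<^esub> s = l \<oplus>\<^bsub>M\<^esub> lincomb c G\<rbrakk>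
    \<Longrightarrow> \<exists>a\<in>carrier R. a \<notin> n \<and> (\<forall>s\<in>G. a \<odot>\<^bsub>M\<^esub> s \<in> L)"
  using \<open>finite G\<close>
proof (induction G arbitrary: b)
  case empty
  then show ?case by blast
next
  case (insert t G)
  interpret n: primeideal n R by fact
  note Lc = submoduleE[OF L]
  have t: "t \<in> carrier M" and G: "G \<subseteq> carrier M" using insert.prems(1) by auto
  have lin: "lincomb c (insert t G) = c t \<odot>\<^bsub>M\<^esub> t \<oplus>\<^bsub>M\<^esub> lincomb c G"
    and cG: "c \<in> G \<rightarrow> carrier R" "c t \<in> carrier R" "lincomb c G \<in> carrier M"
    if "c \<in> insert t G \<rightarrow> n" for c
  proof -
    have c: "c \<in> G \<union> {t} \<rightarrow> carrier R" using that by (auto intro: n.Icarr)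
    then show "c \<in> G \<rightarrow> carrier R" "c t \<in> carrier R" "lincomb c G \<in> carrier M"
      using lincomb_closed[OF G] by auto
    show "lincomb c (insert t G) = c t \<odot>\<^bsub>M\<^esub> t \<oplus>\<^bsub>M\<^esub> lincomb c G"
      using lincomb_insert[OF insert.hyps(1) G c insert.hyps(2) t] by simp
  qed
  obtain c l where c: "c \<in> insert t G \<rightarrow> n" and l: "l \<in> L"
    and "b \<odot>\<^bsub>M\<^esub> t = l \<oplus>\<^bsub>M\<^esub> lincomb c (insert t G)"
    using insert.prems(4)[OF insertI1] by blast
  then have bt: "b \<odot>\<^bsub>M\<^esub> t = l \<oplus>\<^bsub>M\<^esub> (c t \<odot>\<^bsub>M\<^esub> t \<oplus>\<^bsub>M\<^esub> lincomb c G)"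
    and l: "l \<in> L" "l \<in> carrier M"
    using lin Lc(1) by auto
  note cc = cG[OF c]
  \<comment> \<open>The coefficient of \<open>t\<close> after both sides of its relation are collected.\<close>
  define d where "d = b \<ominus> c t"
  have d: "d \<in> carrier R" using insert.prems(2) cc by (simp add: d_def)
  have "d \<notin> n"
  proof
    assume "d \<in> n"
    then have "d \<oplus> c t \<in> n" using c by auto
    also have "d \<oplus> c t = b" using insert.prems(2) cc by (simp add: d_def a_minus_def R.a_assoc R.l_neg)
    finally show False using insert.prems(3) by blast
  qed
  have dt: "d \<odot>\<^bsub>M\<^esub> t = l \<oplus>\<^bsub>M\<^esub> lincomb c G"
  proof -
    have "d \<odot>\<^bsub>M\<^esub> t = b \<odot>\<^bsub>M\<^esub> t \<ominus>\<^bsub>M\<^esub> c t \<odot>\<^bsub>M\<^esub> t"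
      using insert.prems(2) cc t by (simp add: d_def minus_smult_distr)
    also have "\<dots> = l \<oplus>\<^bsub>M\<^esub> lincomb c G"
      unfolding bt a_minus_def using l cc t
      by (simp add: M.a_ac M.r_neg M.r_neg2)
    finally show ?thesis .
  qed
  have "\<exists>c'\<in>G \<rightarrow> n. \<exists>l'\<in>L. (d \<otimes> b) \<odot>\<^bsub>M\<^esub> s = l' \<oplus>\<^bsub>M\<^esub> lincomb c' G" if s: "s \<in> G" for s
  proof -
    obtain e k where e: "e \<in> insert t G \<rightarrow> n" and k: "k \<in> L"
      and "b \<odot>\<^bsub>M\<^esub> s = k \<oplus>\<^bsub>M\<^esub> lincomb e (insert t G)"
      using insert.prems(4)[OF insertI2[OF s]] by blast
    then have bs: "b \<odot>\<^bsub>M\<^esub> s = k \<oplus>\<^bsub>M\<^esub> (e t \<odot>\<^bsub>M\<^esub> t \<oplus>\<^bsub>M\<^esub> lincomb e G)"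
      and k: "k \<in> L" "k \<in> carrier M"
      using lin Lc(1) by auto
    note ec = cG[OF e]
    have sM: "s \<in> carrier M" using s G by auto
    have "(d \<otimes> b) \<odot>\<^bsub>M\<^esub> s = d \<odot>\<^bsub>M\<^esub> k \<oplus>\<^bsub>M\<^esub> (e t \<odot>\<^bsub>M\<^esub> (d \<odot>\<^bsub>M\<^esub> t) \<oplus>\<^bsub>M\<^esub> d \<odot>\<^bsub>M\<^esub> lincomb e G)"
      using d insert.prems(2) sM k ec t
      by (simp add: smult_assoc1 bs smult_r_distr) (simp add: smult_assoc1[symmetric] m_ac)
    also have "\<dots> = (d \<odot>\<^bsub>M\<^esub> k \<oplus>\<^bsub>M\<^esub> e t \<odot>\<^bsub>M\<^esub> l) \<oplus>\<^bsub>M\<^esub> (d \<odot>\<^bsub>M\<^esub> lincomb e G \<oplus>\<^bsub>M\<^esub> e t \<odot>\<^bsub>M\<^esub> lincomb c G)"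
      unfolding dt using d k ec cc l by (simp add: smult_r_distr M.a_ac)
    also have "d \<odot>\<^bsub>M\<^esub> lincomb e G \<oplus>\<^bsub>M\<^esub> e t \<odot>\<^bsub>M\<^esub> lincomb c G
        = lincomb (\<lambda>w. d \<otimes> e w \<oplus> e t \<otimes> c w) G"
      using d ec cc G by (subst lincomb_sum[OF insert.hyps(1) G]) (auto simp: lincomb_smult)
    finally have "(d \<otimes> b) \<odot>\<^bsub>M\<^esub> s
        = (d \<odot>\<^bsub>M\<^esub> k \<oplus>\<^bsub>M\<^esub> e t \<odot>\<^bsub>M\<^esub> l) \<oplus>\<^bsub>M\<^esub> lincomb (\<lambda>w. d \<otimes> e w \<oplus> e t \<otimes> c w) G" .
    moreover have "(\<lambda>w. d \<otimes> e w \<oplus> e t \<otimes> c w) \<in> G \<rightarrow> n"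
      using d ec(2) e c by (auto intro!: n.I_l_closed n.a_closed)
    moreover have "d \<odot>\<^bsub>M\<^esub> k \<oplus>\<^bsub>M\<^esub> e t \<odot>\<^bsub>M\<^esub> l \<in> L"
      using Lc(4,5) d ec(2) k l by blast
    ultimately show ?thesis by blast
  qed
  moreover have "d \<otimes> b \<notin> n" using n.I_prime d insert.prems(2,3) \<open>d \<notin> n\<close> by blast
  ultimately obtain a where a: "a \<in> carrier R" "a \<notin> n" and aG: "\<And>s. s \<in> G \<Longrightarrow> a \<odot>\<^bsub>M\<^esub> s \<in> L"
    using insert.IH[of "d \<otimes> b"] G d insert.prems(2) by blast
  have "(a \<otimes> d) \<odot>\<^bsub>M\<^esub> s \<in> L" if "s \<in> G" for s
  proof -
    have "(a \<otimes> d) \<odot>\<^bsub>M\<^esub> s = d \<odot>\<^bsub>M\<^esub> (a \<odot>\<^bsub>M\<^esub> s)"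
      using a d G that by (auto simp: smult_assoc1[symmetric] m_comm)
    then show ?thesis using Lc(4) aG[OF that] d by simp
  qed
  moreover have "(a \<otimes> d) \<odot>\<^bsub>M\<^esub> t \<in> L"
  proof -
    have "span G \<subseteq> {x \<in> carrier M. a \<odot>\<^bsub>M\<^esub> x \<in> L}"
      by (rule span_least[OF _ submodule_smult_preimage[OF L a(1)]]) (use G aG in auto)
    moreover have "lincomb c G \<in> span G" using cc insert.hyps(1) by (auto simp: span_def)
    ultimately have "a \<odot>\<^bsub>M\<^esub> l \<oplus>\<^bsub>M\<^esub> a \<odot>\<^bsub>M\<^esub> lincomb c G \<in> L" using Lc(4,5) a l by blast
    then show ?thesis using a d t l cc by (simp add: smult_assoc1 dt smult_r_distr)
  qed
  moreover have "a \<otimes> d \<notin> n" using n.I_prime a d \<open>d \<notin> n\<close> by blast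
  ultimately show ?case using a d by (intro bexI[of _ "a \<otimes> d"]) auto
qed

text \<open>
  These elements need not form an ideal.  The ideal that they generate plays the role of the first
  Fitting ideal of \<open>M\<close>: for finitely generated \<open>M\<close>, its zero set in the maximal spectrum is
  \<^term>\<open>S_set R M\<close>.
\<close>

definition cyclic_multipliers :: "'a set" where
  "cyclic_multipliers = {a \<in> carrier R. \<exists>y\<in>carrier M. \<forall>x\<in>carrier M. \<exists>r\<in>carrier R. a \<odot>\<^bsub>M\<^esub> x = r \<odot>\<^bsub>M\<^esub> y}"

text \<open>
  Once generators are fixed, elements of \<open>I M\<close> need coefficients from \<open>I\<close> only at these
  generators, which brings them into the form required by elimination.
\<close>

lemma ideal_smult_lincomb:
  assumes G: "finite G" "G \<subseteq> carrier M" "span G = carrier M" and I: "ideal I R"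
    and x: "x \<in> ideal_smult R I M"
  shows "\<exists>c\<in>G \<rightarrow> I. x = lincomb c G"
proof -
  interpret I: ideal I R by fact
  have cc: "c \<in> G \<rightarrow> carrier R" if "c \<in> G \<rightarrow> I" for c using that by (auto intro: I.Icarr)
  have smult: "a \<odot>\<^bsub>M\<^esub> lincomb c G = lincomb (\<lambda>w. a \<otimes> c w) G"
    if "a \<in> carrier R" "c \<in> G \<rightarrow> carrier R" for a c
    using that lincomb_smult[OF G(2)] by simp
  let ?W = "{lincomb c G | c. c \<in> G \<rightarrow> I}"
  have "Module.submodule ?W R M"
  proof (rule submodule_criterion)
    show "?W \<subseteq> carrier M" using G(2) cc by auto
    show "a \<odot>\<^bsub>M\<^esub> x \<in> ?W"
      if a: "a \<in> carrier R" and x: "x \<in> ?W" for a x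
    proof -
      obtain c where c: "x = lincomb c G" "c \<in> G \<rightarrow> I" using x by auto
      then have "a \<odot>\<^bsub>M\<^esub> x = lincomb (\<lambda>w. a \<otimes> c w) G" using smult[OF a cc] by simp
      moreover have "(\<lambda>w. a \<otimes> c w) \<in> G \<rightarrow> I" using c(2) a I.I_l_closed by auto
      ultimately show ?thesis by blast
    qed
    have "lincomb (\<lambda>_. \<zero>) G = \<zero> \<odot>\<^bsub>M\<^esub> lincomb (\<lambda>_. \<zero>) G"
      by (subst smult) auto
    also have "\<dots> = \<zero>\<^bsub>M\<^esub>" by (rule smult_l_null) (use G(2) in auto)
    finally show "\<zero>\<^bsub>M\<^esub> \<in> ?W"
      by (auto intro!: exI[of _ "\<lambda>_. \<zero>"])
    show "x \<oplus>\<^bsub>M\<^esub> y \<in> ?W"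
      if x: "x \<in> ?W" and y: "y \<in> ?W" for x y
    proof -
      obtain c c' where c: "x = lincomb c G" "c \<in> G \<rightarrow> I" "y = lincomb c' G" "c' \<in> G \<rightarrow> I"
        using x y by auto
      then have "x \<oplus>\<^bsub>M\<^esub> y = lincomb (\<lambda>w. c w \<oplus> c' w) G"
        using lincomb_sum[OF G(1,2) cc cc] by simp
      then show ?thesis using c by auto
    qed
  qed
  moreover have "a \<odot>\<^bsub>M\<^esub> x \<in> ?W" if a: "a \<in> I" and x: "x \<in> carrier M" for a x
  proof -
    obtain c where c: "c \<in> G \<rightarrow> carrier R" "lincomb c G = x"
      using finite_in_span[OF G(1,2)] x G(3) by blast
    then have "a \<odot>\<^bsub>M\<^esub> x = lincomb (\<lambda>w. a \<otimes> c w) G" using smult I.Icarr a by auto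
    moreover have "(\<lambda>w. a \<otimes> c w) \<in> G \<rightarrow> I" using c a I.I_r_closed by auto
    ultimately show ?thesis by blast
  qed
  ultimately have "ideal_smult R I M \<subseteq> ?W"
    by (rule ideal_smult_least)
  with x show ?thesis by blast
qed

text \<open>
  If the fibre at \<open>n\<close> is generated by the class of \<open>y\<close>, then \<open>M = R y + n M\<close>, and elimination
  applies to the submodule generated by \<open>y\<close>.
\<close>

lemma not_in_S_set_imp_cyclic_multiplier:
  assumes fg: "finitely_generated R M" and n: "maximalideal n R" and nS: "n \<notin> S_set R M"
  shows "\<exists>a\<in>cyclic_multipliers. a \<notin> n"
proof -
  interpret n: maximalideal n R by fact
  have prime: "primeideal n R" by (rule R.maximalideal_prime[OF n])
  obtain G where G: "finite G" "G \<subseteq> carrier M" "span G = carrier M"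
    using fg by (auto simp: finitely_generated_def)
  obtain y where y: "y \<in> carrier M"
    and gen: "\<And>x. x \<in> carrier M \<Longrightarrow> \<exists>r\<in>carrier R. x \<ominus>\<^bsub>M\<^esub> r \<odot>\<^bsub>M\<^esub> y \<in> ideal_smult R n M"
    using nS mem_S_set_iff[OF fg n] by blast
  note L = span_submodule[of "{y}"]
  have ry: "r \<odot>\<^bsub>M\<^esub> y \<in> span {y}" if "r \<in> carrier R" for r
    using submoduleE(4)[OF L] in_own_span[of "{y}"] y that by auto
  have Ly: "\<exists>r\<in>carrier R. x = r \<odot>\<^bsub>M\<^esub> y" if x: "x \<in> span {y}" for x
  proof -
    obtain c where c: "c \<in> {y} \<rightarrow> carrier R" "lincomb c {y} = x"
      using finite_in_span[of "{y}" x] x y by auto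
    then show ?thesis using y by (auto simp: lincomb_def)
  qed
  have "\<exists>a\<in>carrier R. a \<notin> n \<and> (\<forall>s\<in>G. a \<odot>\<^bsub>M\<^esub> s \<in> span {y})"
  proof (rule nakayama_elimination[OF prime L G(1,2) R.one_closed])
    show "\<one> \<notin> n" using n.I_notcarr n.one_imp_carrier by blast
    fix s assume "s \<in> G"
    then have s: "s \<in> carrier M" using G by auto
    then obtain r where r: "r \<in> carrier R" "s \<ominus>\<^bsub>M\<^esub> r \<odot>\<^bsub>M\<^esub> y \<in> ideal_smult R n M" using gen by blast
    obtain c where c: "c \<in> G \<rightarrow> n" "s \<ominus>\<^bsub>M\<^esub> r \<odot>\<^bsub>M\<^esub> y = lincomb c G"
      using ideal_smult_lincomb[OF G n.ideal_axioms r(2)] by blast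
    have "\<one> \<odot>\<^bsub>M\<^esub> s = r \<odot>\<^bsub>M\<^esub> y \<oplus>\<^bsub>M\<^esub> (s \<ominus>\<^bsub>M\<^esub> r \<odot>\<^bsub>M\<^esub> y)"
      using s r y by (simp add: a_minus_def M.a_ac M.r_neg M.r_neg2 M.r_neg1)
    then show "\<exists>c\<in>G \<rightarrow> n. \<exists>l\<in>span {y}. \<one> \<odot>\<^bsub>M\<^esub> s = l \<oplus>\<^bsub>M\<^esub> lincomb c G"
      using c ry[OF r(1)] by metis
  qed (use y in auto)
  then obtain a where a: "a \<in> carrier R" "a \<notin> n" and aG: "\<And>s. s \<in> G \<Longrightarrow> a \<odot>\<^bsub>M\<^esub> s \<in> span {y}" by blast
  have "Module.submodule (span {y}) R M" using L y by simp
  then have "span G \<subseteq> {x \<in> carrier M. a \<odot>\<^bsub>M\<^esub> x \<in> span {y}}"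
    by (intro span_least submodule_smult_preimage a(1)) (use G aG in auto)
  then have "a \<in> cyclic_multipliers"
    unfolding cyclic_multipliers_def G(3) using a y Ly by blast
  with a show ?thesis by blast
qed

text \<open>
  A multiplier \<open>a\<close> outside \<open>n\<close> would be invertible modulo \<open>n\<close>, and \<open>a M \<subseteq> R y\<close> would make the
  class of \<open>y\<close> generate the fibre.
\<close>

lemma cyclic_multiplier_in_S_set:
  assumes fg: "finitely_generated R M" and n: "n \<in> S_set R M" and a: "a \<in> cyclic_multipliers"
  shows "a \<in> n"
proof (rule ccontr)
  assume "a \<notin> n"
  have max: "maximalideal n R" using n by (simp add: S_set_def mSpec_def)
  then interpret n: maximalideal n R .
  obtain y where ac: "a \<in> carrier R" and y: "y \<in> carrier M"
    and gen: "\<And>x. x \<in> carrier M \<Longrightarrow> \<exists>r\<in>carrier R. a \<odot>\<^bsub>M\<^esub> x = r \<odot>\<^bsub>M\<^esub> y"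
    using a by (auto simp: cyclic_multipliers_def)
  obtain b where b: "b \<in> carrier R" "\<one> \<ominus> b \<otimes> a \<in> n"
    using R.maximalideal_inverse[OF max ac \<open>a \<notin> n\<close>] by blast
  have "\<exists>r\<in>carrier R. x \<ominus>\<^bsub>M\<^esub> r \<odot>\<^bsub>M\<^esub> y \<in> ideal_smult R n M" if x: "x \<in> carrier M" for x
  proof -
    obtain r where r: "r \<in> carrier R" "a \<odot>\<^bsub>M\<^esub> x = r \<odot>\<^bsub>M\<^esub> y" using gen[OF x] by blast
    have "(\<one> \<ominus> b \<otimes> a) \<odot>\<^bsub>M\<^esub> x = x \<ominus>\<^bsub>M\<^esub> (b \<otimes> r) \<odot>\<^bsub>M\<^esub> y"
      using b ac x y r by (simp add: minus_smult_distr smult_assoc1)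
    then show ?thesis using ideal_smultI[OF n.ideal_axioms b(2) x] b r by auto
  qed
  then have "\<exists>y\<in>carrier M. \<forall>x\<in>carrier M. \<exists>r\<in>carrier R. x \<ominus>\<^bsub>M\<^esub> r \<odot>\<^bsub>M\<^esub> y \<in> ideal_smult R n M"
    by (intro bexI[OF _ y] ballI)
  with iffD1[OF mem_S_set_iff[OF fg max] n] show False by (rule notE)
qed

text \<open>
  Prime avoidance for a family that may be infinite; it rests on the family being closed in the maximal
  spectrum.
\<close>

lemma ideal_avoiding_imp_subset_S_set_member:
  assumes fg: "finitely_generated R M" and J: "ideal J R" "J \<subseteq> \<Union>(S_set R M)"
  shows "\<exists>m\<in>S_set R M. J \<subseteq> m"
proof -
  have sub: "cyclic_multipliers \<subseteq> carrier R" by (auto simp: cyclic_multipliers_def)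
  define I where "I = genideal R cyclic_multipliers"
  have I: "ideal I R" "cyclic_multipliers \<subseteq> I"
    using R.genideal_ideal[OF sub] R.genideal_self[OF sub] by (auto simp: I_def)
  have I_sub: "I \<subseteq> m" if m: "m \<in> S_set R M" for m
  proof -
    have "ideal m R" using m by (auto simp: S_set_def mSpec_def maximalideal_def)
    then show ?thesis
      unfolding I_def using cyclic_multiplier_in_S_set[OF fg m] by (intro R.genideal_minimal) auto
  qed
  have JI: "ideal (J <+>\<^bsub>R\<^esub> I) R" by (rule R.add_ideals[OF J(1) I(1)])
  have "\<one> \<notin> J <+>\<^bsub>R\<^esub> I"
  proof
    assume "\<one> \<in> J <+>\<^bsub>R\<^esub> I"
    then obtain x y where xy: "x \<in> J" "y \<in> I" "\<one> = x \<oplus> y" by (auto simp: set_add_def')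
    then obtain m where m: "m \<in> S_set R M" "x \<in> m" using J(2) by blast
    then interpret m: maximalideal m R by (simp add: S_set_def mSpec_def)
    have "\<one> \<in> m" using xy m I_sub[OF m(1)] by auto
    then show False using m.I_notcarr m.one_imp_carrier by blast
  qed
  then obtain n where n: "maximalideal n R" "J <+>\<^bsub>R\<^esub> I \<subseteq> n"
    using R.proper_ideal_imp_maximalideal[OF JI] by blast
  interpret J: ideal J R by fact
  interpret I: ideal I R by fact
  have "x \<oplus> y \<in> J <+>\<^bsub>R\<^esub> I" if "x \<in> J" "y \<in> I" for x y
    using that unfolding set_add_def' by blast
  then have "x \<in> J <+>\<^bsub>R\<^esub> I" if "x \<in> J \<union> I" for x
    using that I.zero_closed J.zero_closed I.Icarr J.Icarr by (metis UnE R.l_zero R.r_zero)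
  then have "J \<subseteq> n" "I \<subseteq> n" using n(2) by auto
  have "n \<in> S_set R M"
  proof (rule ccontr)
    assume "n \<notin> S_set R M"
    from not_in_S_set_imp_cyclic_multiplier[OF fg n(1) this] obtain a
      where "a \<in> cyclic_multipliers" "a \<notin> n" by (elim bexE)
    with I(2) \<open>I \<subseteq> n\<close> show False by (meson subsetD)
  qed
  with \<open>J \<subseteq> n\<close> show ?thesis by (rule bexI)
qed

end

section \<open>The Zariski topology without coordinates\<close>

context cring
begin

definition monomial_eval :: "('v \<Rightarrow> 'a) \<Rightarrow> 'v multiset \<Rightarrow> 'a" where
  "monomial_eval x \<mu> = (\<Otimes>b \<in> set_mset \<mu>. x b [^] count \<mu> b)"

lemma monomial_eval_closed [simp]:
  "x \<in> B \<rightarrow> carrier R \<Longrightarrow> set_mset \<mu> \<subseteq> B \<Longrightarrow> monomial_eval x \<mu> \<in> carrier R"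
  unfolding monomial_eval_def by (rule finprod_closed) auto

lemma monomial_eval_add_mset:
  assumes x: "x \<in> B \<rightarrow> carrier R" and \<mu>: "set_mset \<mu> \<subseteq> B" and i: "i \<in> B"
  shows "monomial_eval x (add_mset i \<mu>) = monomial_eval x \<mu> \<otimes> x i"
proof -
  let ?S = "set_mset \<mu> - {i}"
  let ?p = "\<Otimes>b \<in> ?S. x b [^] count \<mu> b"
  have xi: "x i \<in> carrier R" using x i by auto
  have p: "(\<lambda>b. x b [^] count \<mu> b) \<in> ?S \<rightarrow> carrier R" "?p \<in> carrier R"
    using x \<mu> by (auto intro!: finprod_closed)
  have 1: "monomial_eval x (add_mset i \<mu>) = x i [^] Suc (count \<mu> i) \<otimes> ?p"
  proof -
    have "monomial_eval x (add_mset i \<mu>) = (\<Otimes>b \<in> insert i ?S. x b [^] count (add_mset i \<mu>) b)"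
      by (simp add: monomial_eval_def)
    also have "\<dots> = x i [^] count (add_mset i \<mu>) i \<otimes> (\<Otimes>b \<in> ?S. x b [^] count (add_mset i \<mu>) b)"
      by (rule finprod_insert) (use x \<mu> xi in auto)
    also have "(\<Otimes>b \<in> ?S. x b [^] count (add_mset i \<mu>) b) = ?p"
      by (rule finprod_cong') (use p in auto)
    finally show ?thesis by simp
  qed
  have 2: "monomial_eval x \<mu> = x i [^] count \<mu> i \<otimes> ?p"
  proof (cases "i \<in># \<mu>")
    case True
    then have "monomial_eval x \<mu> = (\<Otimes>b \<in> insert i ?S. x b [^] count \<mu> b)"
      by (simp add: monomial_eval_def insert_absorb)
    also have "\<dots> = x i [^] count \<mu> i \<otimes> ?p"
      by (rule finprod_insert) (use p xi in auto)
    finally show ?thesis .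
  next
    case False
    then have "count \<mu> i = 0" "?S = set_mset \<mu>" by (auto simp: not_in_iff)
    then show ?thesis using p(2) by (simp add: monomial_eval_def)
  qed
  show ?thesis unfolding 1 2 using xi p(2) by (simp add: m_ac)
qed

text \<open>
  Polynomials are represented by arbitrary functions on monomials.  These bounds on their support make
  the sums in \<^const>\<open>poly_eval\<close> finite and keep the evaluation within the variables \<open>B\<close>.
\<close>

lemma indexed_pset_support:
  assumes "P \<in> indexed_pset B (carrier R)"
  shows "carrier_coeff P \<and> finite {\<mu>. P \<mu> \<noteq> \<zero>} \<and> (\<forall>\<mu>. P \<mu> \<noteq> \<zero> \<longrightarrow> set_mset \<mu> \<subseteq> B)"
  using assms
proof induction
  case (indexed_const k)
  have "{\<mu>. indexed_const k \<mu> \<noteq> \<zero>} \<subseteq> {{#}}" by (auto simp: indexed_const_def)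
  then show ?case
    using indexed_const finite_subset[OF \<open>_ \<subseteq> {{#}}\<close>] by (auto simp: indexed_const_def carrier_coeff_def)
next
  case (indexed_padd P Q)
  then have sub: "indexed_padd P Q \<mu> \<noteq> \<zero> \<Longrightarrow> P \<mu> \<noteq> \<zero> \<or> Q \<mu> \<noteq> \<zero>" for \<mu>
    by (auto simp: indexed_padd_def)
  have "finite {\<mu>. indexed_padd P Q \<mu> \<noteq> \<zero>}"
    by (rule finite_subset[of _ "{\<mu>. P \<mu> \<noteq> \<zero>} \<union> {\<mu>. Q \<mu> \<noteq> \<zero>}"]) (use sub indexed_padd in auto)
  moreover have "\<forall>\<mu>. indexed_padd P Q \<mu> \<noteq> \<zero> \<longrightarrow> set_mset \<mu> \<subseteq> B"
    using sub indexed_padd by metis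
  ultimately show ?case
    using indexed_padd by (simp add: indexed_padd_in_carrier)
next
  case (indexed_pmult P i)
  have sub: "{\<mu>. indexed_pmult P i \<mu> \<noteq> \<zero>} \<subseteq> add_mset i ` {\<mu>. P \<mu> \<noteq> \<zero>}"
  proof
    fix \<mu> assume "\<mu> \<in> {\<mu>. indexed_pmult P i \<mu> \<noteq> \<zero>}"
    then have "i \<in># \<mu>" "P (\<mu> - {#i#}) \<noteq> \<zero>" by (auto simp: indexed_pmult_def split: if_splits)
    then show "\<mu> \<in> add_mset i ` {\<mu>. P \<mu> \<noteq> \<zero>}" by (intro image_eqI[of _ _ "\<mu> - {#i#}"]) auto
  qed
  have "set_mset \<mu> \<subseteq> B" if \<mu>: "indexed_pmult P i \<mu> \<noteq> \<zero>" for \<mu>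
  proof -
    obtain \<nu> where "\<mu> = add_mset i \<nu>" "P \<nu> \<noteq> \<zero>" using sub \<mu> by blast
    then show ?thesis using indexed_pmult by auto
  qed
  then show ?case
    using indexed_pmult finite_subset[OF sub] by (auto simp: indexed_pmult_in_carrier)
qed

text \<open>
  Sums and products change the support, so evaluations are compared over a common finite set of
  monomials.
\<close>

lemma poly_eval_superset:
  assumes P: "P \<in> indexed_pset B (carrier R)" and x: "x \<in> B \<rightarrow> carrier R"
    and S: "finite S" "{\<mu>. P \<mu> \<noteq> \<zero>} \<subseteq> S" "\<And>\<mu>. \<mu> \<in> S \<Longrightarrow> set_mset \<mu> \<subseteq> B"
  shows "poly_eval R P x = (\<Oplus>\<mu> \<in> S. P \<mu> \<otimes> monomial_eval x \<mu>)"
proof -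
  note supp = indexed_pset_support[OF P]
  show ?thesis
    unfolding poly_eval_def monomial_eval_def[symmetric]
    by (rule add.finprod_mono_neutral_cong_left)
      (use S supp x in \<open>auto simp: carrier_coeff_def intro!: m_closed monomial_eval_closed\<close>)
qed

lemma poly_eval_closed:
  assumes P: "P \<in> indexed_pset B (carrier R)" and x: "x \<in> B \<rightarrow> carrier R"
  shows "poly_eval R P x \<in> carrier R"
  unfolding poly_eval_def monomial_eval_def[symmetric]
  by (rule finsum_closed)
    (use indexed_pset_support[OF P] x in \<open>auto simp: carrier_coeff_def intro!: m_closed monomial_eval_closed\<close>)

lemma poly_eval_const:
  assumes k: "k \<in> carrier R" and x: "x \<in> B \<rightarrow> carrier R"
  shows "poly_eval R (indexed_const k) x = k"
proof -
  have "poly_eval R (indexed_const k) x = (\<Oplus>\<mu> \<in> {{#}}. indexed_const k \<mu> \<otimes> monomial_eval x \<mu>)"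
    by (rule poly_eval_superset[OF indexed_pset.indexed_const[OF k] x]) (auto simp: indexed_const_def)
  also have "\<dots> = k" using k by (simp add: indexed_const_def monomial_eval_def)
  finally show ?thesis .
qed

lemma poly_eval_add:
  assumes P: "P \<in> indexed_pset B (carrier R)" and Q: "Q \<in> indexed_pset B (carrier R)"
    and x: "x \<in> B \<rightarrow> carrier R"
  shows "poly_eval R (indexed_padd P Q) x = poly_eval R P x \<oplus> poly_eval R Q x"
proof -
  let ?S = "{\<mu>. P \<mu> \<noteq> \<zero>} \<union> {\<mu>. Q \<mu> \<noteq> \<zero>}"
  note sP = indexed_pset_support[OF P] and sQ = indexed_pset_support[OF Q]
  have S: "finite ?S" "\<And>\<mu>. \<mu> \<in> ?S \<Longrightarrow> set_mset \<mu> \<subseteq> B" using sP sQ by auto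
  have c: "P \<mu> \<in> carrier R" "Q \<mu> \<in> carrier R" for \<mu> using sP sQ by (auto simp: carrier_coeff_def)
  have m: "monomial_eval x \<mu> \<in> carrier R" if "\<mu> \<in> ?S" for \<mu>
    using monomial_eval_closed[OF x S(2)[OF that]] .
  have "poly_eval R (indexed_padd P Q) x = (\<Oplus>\<mu> \<in> ?S. indexed_padd P Q \<mu> \<otimes> monomial_eval x \<mu>)"
    by (rule poly_eval_superset[OF indexed_pset.indexed_padd[OF P Q] x S(1) _ S(2)])
      (auto simp: indexed_padd_def)
  also have "\<dots> = (\<Oplus>\<mu> \<in> ?S. P \<mu> \<otimes> monomial_eval x \<mu> \<oplus> Q \<mu> \<otimes> monomial_eval x \<mu>)"
    by (rule finsum_cong') (use c m in \<open>auto simp: indexed_padd_def l_distr\<close>)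
  also have "\<dots> = (\<Oplus>\<mu> \<in> ?S. P \<mu> \<otimes> monomial_eval x \<mu>) \<oplus> (\<Oplus>\<mu> \<in> ?S. Q \<mu> \<otimes> monomial_eval x \<mu>)"
    by (rule finsum_addf) (use c m in auto)
  also have "(\<Oplus>\<mu> \<in> ?S. P \<mu> \<otimes> monomial_eval x \<mu>) = poly_eval R P x"
    by (rule poly_eval_superset[OF P x S(1) _ S(2), symmetric]) auto
  also have "(\<Oplus>\<mu> \<in> ?S. Q \<mu> \<otimes> monomial_eval x \<mu>) = poly_eval R Q x"
    by (rule poly_eval_superset[OF Q x S(1) _ S(2), symmetric]) auto
  finally show ?thesis .
qed

lemma poly_eval_pmult:
  assumes P: "P \<in> indexed_pset B (carrier R)" and i: "i \<in> B" and x: "x \<in> B \<rightarrow> carrier R"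
  shows "poly_eval R (indexed_pmult P i) x = poly_eval R P x \<otimes> x i"
proof -
  let ?S = "{\<mu>. P \<mu> \<noteq> \<zero>}"
  note sP = indexed_pset_support[OF P]
  have S: "finite ?S" "\<And>\<mu>. \<mu> \<in> ?S \<Longrightarrow> set_mset \<mu> \<subseteq> B" using sP by auto
  have c: "P \<mu> \<in> carrier R" for \<mu> using sP by (auto simp: carrier_coeff_def)
  have m: "monomial_eval x \<mu> \<in> carrier R" if "\<mu> \<in> ?S" for \<mu>
    using monomial_eval_closed[OF x S(2)[OF that]] .
  have xi: "x i \<in> carrier R" using x i by auto
  have "poly_eval R (indexed_pmult P i) x
      = (\<Oplus>\<mu> \<in> add_mset i ` ?S. indexed_pmult P i \<mu> \<otimes> monomial_eval x \<mu>)"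
  proof (rule poly_eval_superset[OF indexed_pset.indexed_pmult[OF P i] x])
    show "{\<mu>. indexed_pmult P i \<mu> \<noteq> \<zero>} \<subseteq> add_mset i ` ?S"
    proof
      fix \<mu> assume "\<mu> \<in> {\<mu>. indexed_pmult P i \<mu> \<noteq> \<zero>}"
      then have "i \<in># \<mu>" "P (\<mu> - {#i#}) \<noteq> \<zero>" by (auto simp: indexed_pmult_def split: if_splits)
      then show "\<mu> \<in> add_mset i ` ?S" by (intro image_eqI[of _ _ "\<mu> - {#i#}"]) auto
    qed
  next
    fix \<mu> assume "\<mu> \<in> add_mset i ` ?S"
    then obtain \<nu> where "\<mu> = add_mset i \<nu>" "\<nu> \<in> ?S" by blast
    then show "set_mset \<mu> \<subseteq> B" using S(2)[of \<nu>] i by simp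
  qed (use S(1) in simp)
  also have "\<dots> = (\<Oplus>\<mu> \<in> ?S. indexed_pmult P i (add_mset i \<mu>) \<otimes> monomial_eval x (add_mset i \<mu>))"
    by (rule finsum_reindex)
      (use c m xi S in \<open>auto simp: indexed_pmult_def inj_on_def monomial_eval_add_mset[OF x _ i]\<close>)
  also have "\<dots> = (\<Oplus>\<mu> \<in> ?S. P \<mu> \<otimes> monomial_eval x \<mu> \<otimes> x i)"
    by (rule finsum_cong')
      (use c m xi S in \<open>auto simp: indexed_pmult_def m_assoc monomial_eval_add_mset[OF x _ i]\<close>)
  also have "\<dots> = (\<Oplus>\<mu> \<in> ?S. P \<mu> \<otimes> monomial_eval x \<mu>) \<otimes> x i"
    by (rule finsum_ldistr[symmetric]) (use c m xi S in auto)
  also have "(\<Oplus>\<mu> \<in> ?S. P \<mu> \<otimes> monomial_eval x \<mu>) = poly_eval R P x"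
    by (rule poly_eval_superset[OF P x S(1) _ S(2), symmetric]) auto
  finally show ?thesis .
qed

lemma poly_eval_scale:
  assumes k: "k \<in> carrier R" and P: "P \<in> indexed_pset B (carrier R)"
  shows "\<exists>S\<in>indexed_pset B (carrier R). \<forall>x\<in>B \<rightarrow> carrier R. poly_eval R S x = poly_eval R P x \<otimes> k"
  using P
proof induction
  case (indexed_const c)
  have "\<forall>x\<in>B \<rightarrow> carrier R. poly_eval R (indexed_const (c \<otimes> k)) x = poly_eval R (indexed_const c) x \<otimes> k"
    using k indexed_const by (auto simp: poly_eval_const[of _ _ B])
  then show ?case
    using k indexed_const by (intro bexI[OF _ indexed_pset.indexed_const]) (assumption, simp)
next
  case (indexed_padd P Q)
  then obtain P' Q' where PQ: "P' \<in> indexed_pset B (carrier R)" "Q' \<in> indexed_pset B (carrier R)"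
    "\<forall>x\<in>B \<rightarrow> carrier R. poly_eval R P' x = poly_eval R P x \<otimes> k"
    "\<forall>x\<in>B \<rightarrow> carrier R. poly_eval R Q' x = poly_eval R Q x \<otimes> k" by blast
  show ?case
    by (rule bexI[OF _ indexed_pset.indexed_padd[OF PQ(1,2)]])
      (use PQ(3,4) k indexed_padd.hyps in
        \<open>simp add: poly_eval_add[OF PQ(1,2)] poly_eval_add[OF indexed_padd.hyps] poly_eval_closed l_distr\<close>)
next
  case (indexed_pmult P i)
  then obtain P' where P': "P' \<in> indexed_pset B (carrier R)"
    "\<forall>x\<in>B \<rightarrow> carrier R. poly_eval R P' x = poly_eval R P x \<otimes> k" by blast
  have "x i \<in> carrier R" if "x \<in> B \<rightarrow> carrier R" for x using that indexed_pmult.hyps(2) by auto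
  then show ?case
    by (intro bexI[OF _ indexed_pset.indexed_pmult[OF P'(1) indexed_pmult.hyps(2)]])
      (use P'(2) k indexed_pmult.hyps in
        \<open>simp add: poly_eval_pmult[OF P'(1)] poly_eval_pmult[OF indexed_pmult.hyps(1)] poly_eval_closed m_ac\<close>)
qed

text \<open>
  Polynomials are built with multiplication by variables only.  Closure of their
  values under products follows by induction on the second factor.
\<close>

lemma poly_eval_mult:
  assumes P: "P \<in> indexed_pset B (carrier R)" and Q: "Q \<in> indexed_pset B (carrier R)"
  shows "\<exists>S\<in>indexed_pset B (carrier R). \<forall>x\<in>B \<rightarrow> carrier R.
    poly_eval R S x = poly_eval R P x \<otimes> poly_eval R Q x"
  using Q
proof induction
  case (indexed_const k)
  then show ?case using poly_eval_scale[OF indexed_const P] by (simp add: poly_eval_const[of _ _ B])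
next
  case (indexed_padd Q Q')
  then obtain S S' where S: "S \<in> indexed_pset B (carrier R)" "S' \<in> indexed_pset B (carrier R)"
    "\<forall>x\<in>B \<rightarrow> carrier R. poly_eval R S x = poly_eval R P x \<otimes> poly_eval R Q x"
    "\<forall>x\<in>B \<rightarrow> carrier R. poly_eval R S' x = poly_eval R P x \<otimes> poly_eval R Q' x" by blast
  show ?case
    by (rule bexI[OF _ indexed_pset.indexed_padd[OF S(1,2)]])
      (use S(3,4) P indexed_padd.hyps in
        \<open>simp add: poly_eval_add[OF S(1,2)] poly_eval_add[OF indexed_padd.hyps] poly_eval_closed r_distr\<close>)
next
  case (indexed_pmult Q i)
  then obtain S where S: "S \<in> indexed_pset B (carrier R)"
    "\<forall>x\<in>B \<rightarrow> carrier R. poly_eval R S x = poly_eval R P x \<otimes> poly_eval R Q x" by blast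
  have "x i \<in> carrier R" if "x \<in> B \<rightarrow> carrier R" for x using that indexed_pmult.hyps(2) by auto
  then show ?case
    by (intro bexI[OF _ indexed_pset.indexed_pmult[OF S(1) indexed_pmult.hyps(2)]])
      (use S(2) P indexed_pmult.hyps in
        \<open>simp add: poly_eval_pmult[OF S(1)] poly_eval_pmult[OF indexed_pmult.hyps(1)] poly_eval_closed m_assoc\<close>)
qed

end

definition linear_functional :: "('k, 'x) ring_scheme \<Rightarrow> ('k, 'v, 'y) module_scheme \<Rightarrow> ('v \<Rightarrow> 'k) \<Rightarrow> bool" where
  "linear_functional K V f \<longleftrightarrow> f \<in> carrier V \<rightarrow> carrier K \<and>
     (\<forall>v\<in>carrier V. \<forall>w\<in>carrier V. f (v \<oplus>\<^bsub>V\<^esub> w) = f v \<oplus>\<^bsub>K\<^esub> f w) \<and>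
     (\<forall>a\<in>carrier K. \<forall>v\<in>carrier V. f (a \<odot>\<^bsub>V\<^esub> v) = a \<otimes>\<^bsub>K\<^esub> f v)"

text \<open>
  The polynomial functions on \<open>V\<close>, described without a basis.  Only the values on the carrier of \<open>V\<close>
  matter.
\<close>

inductive_set regular_functions ::
    "('k, 'x) ring_scheme \<Rightarrow> ('k, 'v, 'y) module_scheme \<Rightarrow> ('v \<Rightarrow> 'k) set"
  for K V where
  const: "c \<in> carrier K \<Longrightarrow> (\<lambda>_. c) \<in> regular_functions K V"
| linear: "linear_functional K V f \<Longrightarrow> f \<in> regular_functions K V"
| add: "\<lbrakk>f \<in> regular_functions K V; g \<in> regular_functions K V\<rbrakk> \<Longrightarrow>
    (\<lambda>v. f v \<oplus>\<^bsub>K\<^esub> g v) \<in> regular_functions K V"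
| mult: "\<lbrakk>f \<in> regular_functions K V; g \<in> regular_functions K V\<rbrakk> \<Longrightarrow>
    (\<lambda>v. f v \<otimes>\<^bsub>K\<^esub> g v) \<in> regular_functions K V"

context vectorspace
begin

abbreviation zeros :: "('c \<Rightarrow> 'a) set \<Rightarrow> 'c set" where
  "zeros F \<equiv> {v \<in> carrier V. \<forall>f\<in>F. f v = \<zero>\<^bsub>K\<^esub>}"

lemma regular_function_closed:
  "f \<in> regular_functions K V \<Longrightarrow> v \<in> carrier V \<Longrightarrow> f v \<in> carrier K"
  by (induction rule: regular_functions.induct) (auto simp: linear_functional_def)

lemma linear_functional_zero: "linear_functional K V f \<Longrightarrow> f \<zero>\<^bsub>V\<^esub> = \<zero>\<^bsub>K\<^esub>"
proof -
  assume f: "linear_functional K V f"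
  have "f (\<zero>\<^bsub>K\<^esub> \<odot>\<^bsub>V\<^esub> \<zero>\<^bsub>V\<^esub>) = \<zero>\<^bsub>K\<^esub> \<otimes>\<^bsub>K\<^esub> f \<zero>\<^bsub>V\<^esub>" "f \<zero>\<^bsub>V\<^esub> \<in> carrier K"
    using f M.zero_closed R.zero_closed unfolding linear_functional_def by blast+
  then show ?thesis by simp
qed

lemma basis_coordinates:
  assumes B: "finite B" "basis B"
  shows "\<exists>c. (\<forall>v\<in>carrier V. c v \<in> B \<rightarrow>\<^sub>E carrier K \<and> lincomb (c v) B = v) \<and>
    (\<forall>x\<in>B \<rightarrow>\<^sub>E carrier K. c (lincomb x B) = x) \<and> (\<forall>b\<in>B. linear_functional K V (\<lambda>v. c v b))"
proof -
  have BV: "B \<subseteq> carrier V" using B(2) by (simp add: basis_def)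
  have ex1: "\<exists>!a. a \<in> B \<rightarrow>\<^sub>E carrier K \<and> lincomb a B = v" if "v \<in> carrier V" for v
    using basis_criterion[OF B(1) BV] B(2) that by blast
  define c where "c v = (THE a. a \<in> B \<rightarrow>\<^sub>E carrier K \<and> lincomb a B = v)" for v
  have c: "c v \<in> B \<rightarrow>\<^sub>E carrier K" "lincomb (c v) B = v" if "v \<in> carrier V" for v
    using theI'[OF ex1[OF that]] by (simp_all add: c_def)
  have cu: "c v = a" if "a \<in> B \<rightarrow>\<^sub>E carrier K" "lincomb a B = v" "v \<in> carrier V" for a v
    using ex1[OF that(3)] c[OF that(3)] that(1,2) by blast
  have cp: "c v \<in> B \<rightarrow> carrier K" if "v \<in> carrier V" for v using c(1)[OF that] by auto
  have "linear_functional K V (\<lambda>v. c v b)" if b: "b \<in> B" for b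
    unfolding linear_functional_def
  proof (intro conjI ballI)
    show "(\<lambda>v. c v b) \<in> carrier V \<rightarrow> carrier K" using cp b by auto
  next
    fix v w assume vw: "v \<in> carrier V" "w \<in> carrier V"
    have "lincomb (restrict (\<lambda>b. c v b \<oplus>\<^bsub>K\<^esub> c w b) B) B = lincomb (\<lambda>b. c v b \<oplus>\<^bsub>K\<^esub> c w b) B"
      by (rule lincomb_cong) (use BV cp[OF vw(1)] cp[OF vw(2)] in auto)
    also have "\<dots> = v \<oplus>\<^bsub>V\<^esub> w"
      using lincomb_sum[OF B(1) BV cp[OF vw(1)] cp[OF vw(2)]] c(2)[OF vw(1)] c(2)[OF vw(2)] by simp
    finally have "c (v \<oplus>\<^bsub>V\<^esub> w) = restrict (\<lambda>b. c v b \<oplus>\<^bsub>K\<^esub> c w b) B"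
      using vw cp[OF vw(1)] cp[OF vw(2)] by (intro cu) auto
    then show "c (v \<oplus>\<^bsub>V\<^esub> w) b = c v b \<oplus>\<^bsub>K\<^esub> c w b" using b by simp
  next
    fix a v assume av: "a \<in> carrier K" "v \<in> carrier V"
    have "lincomb (restrict (\<lambda>b. a \<otimes>\<^bsub>K\<^esub> c v b) B) B = lincomb (\<lambda>b. a \<otimes>\<^bsub>K\<^esub> c v b) B"
      by (rule lincomb_cong) (use BV av cp[OF av(2)] in auto)
    also have "\<dots> = a \<odot>\<^bsub>V\<^esub> v"
      using lincomb_smult[OF BV cp[OF av(2)] av(1)] c(2)[OF av(2)] by simp
    finally have "c (a \<odot>\<^bsub>V\<^esub> v) = restrict (\<lambda>b. a \<otimes>\<^bsub>K\<^esub> c v b) B"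
      using av cp[OF av(2)] by (intro cu) auto
    then show "c (a \<odot>\<^bsub>V\<^esub> v) b = a \<otimes>\<^bsub>K\<^esub> c v b" using b by simp
  qed
  moreover have "c (lincomb x B) = x" if "x \<in> B \<rightarrow>\<^sub>E carrier K" for x
    using that BV by (intro cu) auto
  ultimately show ?thesis using c by (intro exI[of _ c] conjI ballI)
qed

lemma linear_functional_polynomial:
  assumes f: "linear_functional K V f" and B: "B \<subseteq> carrier V" and "finite A" "A \<subseteq> B"
  shows "\<exists>P\<in>ring.indexed_pset K B (carrier K).
    \<forall>x\<in>B \<rightarrow> carrier K. poly_eval K P x = f (lincomb x A)"
  using \<open>finite A\<close> \<open>A \<subseteq> B\<close>
proof induction
  case empty
  have "indexed_const \<zero>\<^bsub>K\<^esub> \<in> indexed_pset B (carrier K)" by (rule indexed_pset.indexed_const) simp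
  then show ?case
    using linear_functional_zero[OF f]
    by (intro bexI[of _ "indexed_const \<zero>\<^bsub>K\<^esub>"]) (auto simp: poly_eval_const[of _ _ B] lincomb_def)
next
  case (insert b A)
  then obtain P where P: "P \<in> indexed_pset B (carrier K)"
    "\<forall>x\<in>B \<rightarrow> carrier K. poly_eval K P x = f (lincomb x A)" by auto
  have b: "b \<in> B" "b \<in> carrier V" and A: "A \<subseteq> carrier V" using insert.prems B by auto
  have fb: "f b \<in> carrier K" using f b by (auto simp: linear_functional_def)
  let ?X = "indexed_pmult (indexed_const (f b)) b"
  have X: "?X \<in> indexed_pset B (carrier K)"
    by (intro indexed_pset.indexed_pmult indexed_pset.indexed_const fb b)
  have "poly_eval K (indexed_padd ?X P) x = f (lincomb x (insert b A))"
    if x: "x \<in> B \<rightarrow> carrier K" for x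
  proof -
    have xb: "x b \<in> carrier K" and xA: "x \<in> A \<rightarrow> carrier K" using x b insert.prems by auto
    have "lincomb x (insert b A) = x b \<odot>\<^bsub>V\<^esub> b \<oplus>\<^bsub>V\<^esub> lincomb x A"
      using lincomb_insert[OF insert.hyps(1) A _ insert.hyps(2) b(2), of x] xb xA by auto
    then have "f (lincomb x (insert b A)) = x b \<otimes>\<^bsub>K\<^esub> f b \<oplus>\<^bsub>K\<^esub> f (lincomb x A)"
      using f xb b lincomb_closed[OF A xA] by (simp add: linear_functional_def)
    also have "\<dots> = poly_eval K (indexed_padd ?X P) x"
      using P(2) x fb xb
      by (simp add: poly_eval_add[OF X P(1) x] poly_eval_pmult[OF indexed_pset.indexed_const[OF fb] b(1) x]
          poly_eval_const[OF fb x] m_comm)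
    finally show ?thesis ..
  qed
  then show ?case by (intro bexI[OF _ indexed_pset.indexed_padd[OF X P(1)]]) auto
qed

text \<open>
  Coordinates with respect to any basis are linear functionals, so polynomials in them are
  regular; conversely a linear functional is a linear form in the coordinates of one fixed basis.
  Hence the closed sets do not depend on the basis, which is what their closure under unions and
  intersections requires.
\<close>

lemma zariski_closed_iff_regular:
  assumes fd: fin_dim
  shows "zariski_closed K V C \<longleftrightarrow>
    (\<exists>F\<subseteq>regular_functions K V. C = zeros F)"
proof
  assume "zariski_closed K V C"
  then obtain B F where B: "finite B" "basis B" and F: "F \<subseteq> indexed_pset B (carrier K)"
    and C: "C = {lincomb x B | x. x \<in> B \<rightarrow>\<^sub>E carrier K \<and> (\<forall>P\<in>F. poly_eval K P x = \<zero>\<^bsub>K\<^esub>)}"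
    unfolding zariski_closed_def by blast
  have BV: "B \<subseteq> carrier V" using B(2) by (simp add: basis_def)
  obtain c where "(\<forall>v\<in>carrier V. c v \<in> B \<rightarrow>\<^sub>E carrier K \<and> lincomb (c v) B = v) \<and>
    (\<forall>x\<in>B \<rightarrow>\<^sub>E carrier K. c (lincomb x B) = x) \<and> (\<forall>b\<in>B. linear_functional K V (\<lambda>v. c v b))"
    by (rule exE[OF basis_coordinates[OF B]])
  then have c: "\<And>v. v \<in> carrier V \<Longrightarrow> c v \<in> B \<rightarrow>\<^sub>E carrier K"
      "\<And>v. v \<in> carrier V \<Longrightarrow> lincomb (c v) B = v"
      "\<And>x. x \<in> B \<rightarrow>\<^sub>E carrier K \<Longrightarrow> c (lincomb x B) = x"
      "\<And>b. b \<in> B \<Longrightarrow> linear_functional K V (\<lambda>v. c v b)"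
    by simp_all
  have cB: "c v \<in> B \<rightarrow> carrier K" if "v \<in> carrier V" for v using c(1)[OF that] by auto
  have reg: "\<exists>f\<in>regular_functions K V. \<forall>v\<in>carrier V. f v = poly_eval K P (c v)"
    if "P \<in> indexed_pset B (carrier K)" for P
    using that
  proof induction
    case (indexed_const k)
    then show ?case
      using cB by (intro bexI[OF _ regular_functions.const[OF indexed_const]]) (auto simp: poly_eval_const[of _ _ B])
  next
    case (indexed_padd P Q)
    then obtain f g where fg: "f \<in> regular_functions K V" "g \<in> regular_functions K V"
      "\<forall>v\<in>carrier V. f v = poly_eval K P (c v)" "\<forall>v\<in>carrier V. g v = poly_eval K Q (c v)" by blast
    then show ?case
      using cB by (intro bexI[OF _ regular_functions.add[OF fg(1,2)]]) (auto simp: poly_eval_add[OF indexed_padd.hyps])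
  next
    case (indexed_pmult P i)
    then obtain f where f: "f \<in> regular_functions K V" "\<forall>v\<in>carrier V. f v = poly_eval K P (c v)" by blast
    then show ?case
      using cB by (intro bexI[OF _ regular_functions.mult[OF f(1) regular_functions.linear[OF c(4)[OF indexed_pmult.hyps(2)]]]])
        (auto simp: poly_eval_pmult[OF indexed_pmult.hyps])
  qed
  define F' where "F' = {f \<in> regular_functions K V. \<exists>P\<in>F. \<forall>v\<in>carrier V. f v = poly_eval K P (c v)}"
  have "C = {v \<in> carrier V. \<forall>P\<in>F. poly_eval K P (c v) = \<zero>\<^bsub>K\<^esub>}"
  proof (intro equalityI subsetI)
    fix v assume "v \<in> C"
    then obtain x where x: "x \<in> B \<rightarrow>\<^sub>E carrier K" "v = lincomb x B" "\<forall>P\<in>F. poly_eval K P x = \<zero>\<^bsub>K\<^esub>"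
      using C by blast
    then have "v \<in> carrier V" using BV by (auto intro!: lincomb_closed)
    then show "v \<in> {v \<in> carrier V. \<forall>P\<in>F. poly_eval K P (c v) = \<zero>\<^bsub>K\<^esub>}"
      using x(3) c(3)[OF x(1)] x(2) by simp
  next
    fix v assume v: "v \<in> {v \<in> carrier V. \<forall>P\<in>F. poly_eval K P (c v) = \<zero>\<^bsub>K\<^esub>}"
    then have vV: "v \<in> carrier V" by simp
    show "v \<in> C"
      unfolding C using v c(1)[OF vV] c(2)[OF vV] by (intro CollectI exI[of _ "c v"]) simp
  qed
  also have "\<dots> = zeros F'"
  proof (intro Collect_cong conj_cong refl iffI ballI)
    fix v f assume v: "v \<in> carrier V" "\<forall>P\<in>F. poly_eval K P (c v) = \<zero>\<^bsub>K\<^esub>" "f \<in> F'"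
    then show "f v = \<zero>\<^bsub>K\<^esub>" by (auto simp: F'_def)
  next
    fix v P assume v: "v \<in> carrier V" "\<forall>f\<in>F'. f v = \<zero>\<^bsub>K\<^esub>" and P: "P \<in> F"
    then obtain f where f: "f \<in> regular_functions K V" "\<forall>v\<in>carrier V. f v = poly_eval K P (c v)"
      using reg F by blast
    then have "f \<in> F'" using P by (auto simp: F'_def)
    then show "poly_eval K P (c v) = \<zero>\<^bsub>K\<^esub>" using v f(2) by auto
  qed
  finally show "\<exists>F\<subseteq>regular_functions K V. C = zeros F"
    by (intro exI[of _ F']) (auto simp: F'_def)
next
  assume "\<exists>F\<subseteq>regular_functions K V. C = zeros F"
  then obtain F where F: "F \<subseteq> regular_functions K V"
    and C: "C = zeros F" by blast
  obtain B where B: "finite B" "basis B" using finite_basis_exists[OF fd] by blast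
  have BV: "B \<subseteq> carrier V" "span B = carrier V" using B(2) by (auto simp: basis_def)
  have pol: "\<exists>P\<in>indexed_pset B (carrier K). \<forall>x\<in>B \<rightarrow> carrier K. poly_eval K P x = f (lincomb x B)"
    if "f \<in> regular_functions K V" for f
    using that
  proof induction
    case (const k)
    then show ?case
      by (intro bexI[OF _ indexed_pset.indexed_const[OF const]]) (auto simp: poly_eval_const[of _ _ B])
  next
    case (linear f)
    then show ?case by (rule linear_functional_polynomial[OF _ BV(1) B(1) subset_refl])
  next
    case (add f g)
    then obtain P Q where PQ: "P \<in> indexed_pset B (carrier K)" "Q \<in> indexed_pset B (carrier K)"
      "\<forall>x\<in>B \<rightarrow> carrier K. poly_eval K P x = f (lincomb x B)"
      "\<forall>x\<in>B \<rightarrow> carrier K. poly_eval K Q x = g (lincomb x B)" by blast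
    then show ?case
      by (intro bexI[OF _ indexed_pset.indexed_padd[OF PQ(1,2)]]) (simp add: poly_eval_add[OF PQ(1,2)])
  next
    case (mult f g)
    then obtain P Q where PQ: "P \<in> indexed_pset B (carrier K)" "Q \<in> indexed_pset B (carrier K)"
      "\<forall>x\<in>B \<rightarrow> carrier K. poly_eval K P x = f (lincomb x B)"
      "\<forall>x\<in>B \<rightarrow> carrier K. poly_eval K Q x = g (lincomb x B)" by blast
    then show ?case using poly_eval_mult[OF PQ(1,2)] by simp
  qed
  define F' where "F' = {P \<in> indexed_pset B (carrier K).
    \<exists>f\<in>F. \<forall>x\<in>B \<rightarrow> carrier K. poly_eval K P x = f (lincomb x B)}"
  have eq: "(\<forall>P\<in>F'. poly_eval K P x = \<zero>\<^bsub>K\<^esub>) \<longleftrightarrow> (\<forall>f\<in>F. f (lincomb x B) = \<zero>\<^bsub>K\<^esub>)"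
    if x: "x \<in> B \<rightarrow> carrier K" for x
  proof (intro iffI ballI)
    fix f assume F': "\<forall>P\<in>F'. poly_eval K P x = \<zero>\<^bsub>K\<^esub>" and f: "f \<in> F"
    then obtain P where P: "P \<in> indexed_pset B (carrier K)"
      "\<forall>x\<in>B \<rightarrow> carrier K. poly_eval K P x = f (lincomb x B)" using pol F by blast
    then have "P \<in> F'" using f by (auto simp: F'_def)
    then show "f (lincomb x B) = \<zero>\<^bsub>K\<^esub>" using F' P(2) x by metis
  next
    fix P assume "\<forall>f\<in>F. f (lincomb x B) = \<zero>\<^bsub>K\<^esub>" "P \<in> F'"
    then show "poly_eval K P x = \<zero>\<^bsub>K\<^esub>" using x by (auto simp: F'_def)
  qed
  have "C = {lincomb x B | x. x \<in> B \<rightarrow>\<^sub>E carrier K \<and> (\<forall>P\<in>F'. poly_eval K P x = \<zero>\<^bsub>K\<^esub>)}"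
  proof (intro equalityI subsetI)
    fix v assume v: "v \<in> C"
    then have vV: "v \<in> carrier V" by (simp add: C)
    have "\<exists>!a. a \<in> B \<rightarrow>\<^sub>E carrier K \<and> lincomb a B = v"
      using basis_criterion[OF B(1) BV(1)] B(2) vV by blast
    then obtain x where x: "x \<in> B \<rightarrow>\<^sub>E carrier K" "lincomb x B = v" by blast
    moreover have "\<forall>P\<in>F'. poly_eval K P x = \<zero>\<^bsub>K\<^esub>"
      using v eq[of x] x by (auto simp: C PiE_def)
    ultimately show "v \<in> {lincomb x B | x. x \<in> B \<rightarrow>\<^sub>E carrier K \<and> (\<forall>P\<in>F'. poly_eval K P x = \<zero>\<^bsub>K\<^esub>)}"
      by blast
  next
    fix v assume "v \<in> {lincomb x B | x. x \<in> B \<rightarrow>\<^sub>E carrier K \<and> (\<forall>P\<in>F'. poly_eval K P x = \<zero>\<^bsub>K\<^esub>)}"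
    then obtain x where x: "v = lincomb x B" "x \<in> B \<rightarrow> carrier K" "\<forall>P\<in>F'. poly_eval K P x = \<zero>\<^bsub>K\<^esub>"
      by (auto simp: PiE_def)
    then show "v \<in> C" using eq[OF x(2)] lincomb_closed[OF BV(1) x(2)] by (simp add: C)
  qed
  then show "zariski_closed K V C"
    unfolding zariski_closed_def
    by (intro exI[of _ B] exI[of _ F'] conjI B) (auto simp: F'_def)
qed

lemma zariski_closedI:
  assumes fd: fin_dim and C: "C = zeros F"
    and F: "F \<subseteq> regular_functions K V"
  shows "zariski_closed K V C"
  unfolding zariski_closed_iff_regular[OF fd] by (rule exI[of _ F], rule conjI[OF F C])

text \<open>
  Over a field, the products of the equations of two sets define their union.
\<close>

lemma zariski_closed_Un:
  assumes fd: fin_dim and C: "zariski_closed K V C" "zariski_closed K V D"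
  shows "zariski_closed K V (C \<union> D)"
proof -
  obtain F G where F: "F \<subseteq> regular_functions K V" "C = zeros F"
    and G: "G \<subseteq> regular_functions K V" "D = zeros G"
    using C unfolding zariski_closed_iff_regular[OF fd] by blast
  define H where "H = {\<lambda>v. f v \<otimes>\<^bsub>K\<^esub> g v | f g. f \<in> F \<and> g \<in> G}"
  have H: "(\<forall>h\<in>H. h v = \<zero>\<^bsub>K\<^esub>) \<longleftrightarrow> (\<forall>f\<in>F. f v = \<zero>\<^bsub>K\<^esub>) \<or> (\<forall>g\<in>G. g v = \<zero>\<^bsub>K\<^esub>)"
    if v: "v \<in> carrier V" for v
  proof -
    have "(\<forall>h\<in>H. h v = \<zero>\<^bsub>K\<^esub>) \<longleftrightarrow> (\<forall>f\<in>F. \<forall>g\<in>G. f v \<otimes>\<^bsub>K\<^esub> g v = \<zero>\<^bsub>K\<^esub>)"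
      by (force simp: H_def)
    also have "\<dots> \<longleftrightarrow> (\<forall>f\<in>F. \<forall>g\<in>G. f v = \<zero>\<^bsub>K\<^esub> \<or> g v = \<zero>\<^bsub>K\<^esub>)"
      using regular_function_closed[OF _ v] F(1) G(1)
      by (intro ball_cong refl integral_iff) auto
    also have "\<dots> \<longleftrightarrow> (\<forall>f\<in>F. f v = \<zero>\<^bsub>K\<^esub>) \<or> (\<forall>g\<in>G. g v = \<zero>\<^bsub>K\<^esub>)" by blast
    finally show ?thesis .
  qed
  have "C \<union> D = zeros H"
  proof (rule Set.set_eqI)
    fix v show "v \<in> C \<union> D \<longleftrightarrow> v \<in> zeros H"
      by (cases "v \<in> carrier V") (simp_all add: H F(2) G(2))
  qed
  moreover have "H \<subseteq> regular_functions K V"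
    using F(1) G(1) by (auto simp: H_def intro!: regular_functions.mult)
  ultimately show ?thesis by (rule zariski_closedI[OF fd])
qed

lemma zariski_closed_Inter:
  assumes fd: fin_dim and C: "\<And>C. C \<in> \<C> \<Longrightarrow> zariski_closed K V C"
  shows "zariski_closed K V (carrier V \<inter> \<Inter>\<C>)"
proof -
  have "\<forall>C\<in>\<C>. \<exists>F. F \<subseteq> regular_functions K V \<and> C = zeros F"
    using C unfolding zariski_closed_iff_regular[OF fd] by (rule ballI)
  from bchoice[OF this] obtain F where
    F: "\<forall>C\<in>\<C>. F C \<subseteq> regular_functions K V \<and> C = zeros (F C)"
    by (elim exE)
  have mem: "v \<in> C \<longleftrightarrow> v \<in> carrier V \<and> (\<forall>f\<in>F C. f v = \<zero>\<^bsub>K\<^esub>)" if "C \<in> \<C>" for v C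
    by (subst F[rule_format, OF that, THEN conjunct2]) simp
  have "carrier V \<inter> \<Inter>\<C> = zeros (\<Union>C\<in>\<C>. F C)"
  proof (rule Set.set_eqI)
    fix v
    have "v \<in> carrier V \<inter> \<Inter>\<C> \<longleftrightarrow> v \<in> carrier V \<and> (\<forall>C\<in>\<C>. v \<in> C)" by simp
    also have "\<dots> \<longleftrightarrow> v \<in> carrier V \<and> (\<forall>C\<in>\<C>. \<forall>f\<in>F C. f v = \<zero>\<^bsub>K\<^esub>)"
      using mem by (intro conj_cong refl ball_cong) simp
    also have "\<dots> \<longleftrightarrow> v \<in> zeros (\<Union>C\<in>\<C>. F C)" by simp
    finally show "v \<in> carrier V \<inter> \<Inter>\<C> \<longleftrightarrow> v \<in> zeros (\<Union>C\<in>\<C>. F C)" .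
  qed
  moreover have "(\<Union>C\<in>\<C>. F C) \<subseteq> regular_functions K V"
  proof (rule UN_least)
    fix C assume "C \<in> \<C>"
    with F have "F C \<subseteq> regular_functions K V \<and> C = zeros (F C)"
      by (rule bspec)
    then show "F C \<subseteq> regular_functions K V" by (rule conjunct1)
  qed
  ultimately show ?thesis by (rule zariski_closedI[OF fd])
qed

lemma istopology_zariski:
  assumes fd: fin_dim
  shows "istopology (\<lambda>U. U \<subseteq> carrier V \<and> zariski_closed K V (carrier V - U))"
  unfolding istopology_def
proof (intro conjI allI impI)
  fix S T assume S: "S \<subseteq> carrier V \<and> zariski_closed K V (carrier V - S)"
    and T: "T \<subseteq> carrier V \<and> zariski_closed K V (carrier V - T)"
  have "carrier V - (S \<inter> T) = (carrier V - S) \<union> (carrier V - T)" by blast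
  then show "zariski_closed K V (carrier V - S \<inter> T)" using zariski_closed_Un[OF fd] S T by simp
  show "S \<inter> T \<subseteq> carrier V" using S by blast
next
  fix \<K> assume K: "\<forall>U\<in>\<K>. U \<subseteq> carrier V \<and> zariski_closed K V (carrier V - U)"
  then show "\<Union>\<K> \<subseteq> carrier V" by blast
  have eq: "carrier V - \<Union>\<K> = carrier V \<inter> \<Inter>((\<lambda>U. carrier V - U) ` \<K>)" by auto
  show "zariski_closed K V (carrier V - \<Union>\<K>)"
    unfolding eq by (rule zariski_closed_Inter[OF fd]) (use K in auto)
qed

lemma openin_zariski:
  assumes fd: fin_dim
  shows "openin (zariski_topology K V) U \<longleftrightarrow> U \<subseteq> carrier V \<and> zariski_closed K V (carrier V - U)"
  unfolding zariski_topology_def topology_inverse'[OF istopology_zariski[OF fd]] ..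

lemma topspace_zariski:
  assumes fd: fin_dim
  shows "topspace (zariski_topology K V) = carrier V"
proof -
  have "zariski_closed K V {}"
    by (rule zariski_closedI[OF fd, of _ "{\<lambda>_. \<one>\<^bsub>K\<^esub>}"]) (auto intro: regular_functions.const)
  then have "openin (zariski_topology K V) (carrier V)" by (simp add: openin_zariski[OF fd])
  then show ?thesis
    using openin_zariski[OF fd] openin_topspace openin_subset by (metis subset_antisym)
qed

lemma closedin_zariski:
  assumes fd: fin_dim
  shows "closedin (zariski_topology K V) C \<longleftrightarrow>
    (\<exists>F\<subseteq>regular_functions K V. C = zeros F)"
proof -
  have "closedin (zariski_topology K V) C \<longleftrightarrow> C \<subseteq> carrier V \<and> zariski_closed K V C"
    by (auto simp: closedin_def topspace_zariski[OF fd] openin_zariski[OF fd] double_diff)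
  moreover have "C \<subseteq> carrier V" if "zariski_closed K V C"
  proof -
    obtain F where "C = zeros F"
      using \<open>zariski_closed K V C\<close> unfolding zariski_closed_iff_regular[OF fd] by (elim exE conjE)
    then show ?thesis by simp
  qed
  ultimately have "closedin (zariski_topology K V) C \<longleftrightarrow> zariski_closed K V C" by fast
  then show ?thesis unfolding zariski_closed_iff_regular[OF fd] .
qed

end

lemma (in vectorspace) closedin_zeros:
  assumes fd: fin_dim and F: "F \<subseteq> regular_functions K V"
  shows "closedin (zariski_topology K V) (zeros F)"
  unfolding closedin_zariski[OF fd] by (rule exI[of _ F], rule conjI[OF F refl])

lemma topspace_three_closed:
  assumes "\<zero>\<^bsub>V\<^esub> \<in> carrier V"
  shows "topspace (three_closed_topology V) = carrier V"
proof -
  let ?P = "\<lambda>U. U \<subseteq> carrier V \<and> carrier V - U \<in> {{}, {\<zero>\<^bsub>V\<^esub>}, carrier V}"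
  have P: "?P U \<longleftrightarrow> U = carrier V \<or> U = carrier V - {\<zero>\<^bsub>V\<^esub>} \<or> U = {}" for U
    using assms by auto
  have "istopology ?P"
    unfolding istopology_def P
  proof (intro conjI allI impI)
    fix \<K> assume K: "\<forall>U\<in>\<K>. U = carrier V \<or> U = carrier V - {\<zero>\<^bsub>V\<^esub>} \<or> U = {}"
    show "\<Union>\<K> = carrier V \<or> \<Union>\<K> = carrier V - {\<zero>\<^bsub>V\<^esub>} \<or> \<Union>\<K> = {}"
    proof (cases "carrier V \<in> \<K>")
      case True
      then have "\<Union>\<K> = carrier V" using K by fastforce
      then show ?thesis by simp
    next
      case F: False
      show ?thesis
      proof (cases "carrier V - {\<zero>\<^bsub>V\<^esub>} \<in> \<K>")
        case True
        then have "\<Union>\<K> = carrier V - {\<zero>\<^bsub>V\<^esub>}" using K F by fastforce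
        then show ?thesis by simp
      next
        case False
        then have "\<Union>\<K> = {}" using K F by fastforce
        then show ?thesis by simp
      qed
    qed
  qed auto
  then have "openin (three_closed_topology V) U \<longleftrightarrow> ?P U" for U
    unfolding three_closed_topology_def by (simp only: topology_inverse')
  then have "openin (three_closed_topology V) U \<longleftrightarrow> U = carrier V \<or> U = carrier V - {\<zero>\<^bsub>V\<^esub>} \<or> U = {}" for U
    by (simp only: P)
  then show ?thesis by (auto simp: topspace_def)
qed

section \<open>The induced topology and covers by hyperplanes\<close>

lemma (in vectorspace) linear_functional_add_scale:
  assumes f: "linear_functional K V f" and g: "linear_functional K V g" and c: "c \<in> carrier K"
  shows "linear_functional K V (\<lambda>v. f v \<oplus>\<^bsub>K\<^esub> c \<otimes>\<^bsub>K\<^esub> g v)"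
proof -
  have cl: "f v \<in> carrier K" "g v \<in> carrier K" if "v \<in> carrier V" for v
    using f g that by (auto simp: linear_functional_def)
  have fg: "f (v \<oplus>\<^bsub>V\<^esub> w) = f v \<oplus>\<^bsub>K\<^esub> f w" "g (v \<oplus>\<^bsub>V\<^esub> w) = g v \<oplus>\<^bsub>K\<^esub> g w"
    if "v \<in> carrier V" "w \<in> carrier V" for v w
    using f g that by (auto simp: linear_functional_def)
  have fg': "f (a \<odot>\<^bsub>V\<^esub> v) = a \<otimes>\<^bsub>K\<^esub> f v" "g (a \<odot>\<^bsub>V\<^esub> v) = a \<otimes>\<^bsub>K\<^esub> g v"
    if "v \<in> carrier V" "a \<in> carrier K" for v a
    using f g that by (auto simp: linear_functional_def)
  show ?thesis
    unfolding linear_functional_def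
  proof (intro conjI ballI)
    show "(\<lambda>v. f v \<oplus>\<^bsub>K\<^esub> c \<otimes>\<^bsub>K\<^esub> g v) \<in> carrier V \<rightarrow> carrier K" using cl c by auto
  next
    fix v w assume "v \<in> carrier V" "w \<in> carrier V"
    then show "f (v \<oplus>\<^bsub>V\<^esub> w) \<oplus>\<^bsub>K\<^esub> c \<otimes>\<^bsub>K\<^esub> g (v \<oplus>\<^bsub>V\<^esub> w)
        = f v \<oplus>\<^bsub>K\<^esub> c \<otimes>\<^bsub>K\<^esub> g v \<oplus>\<^bsub>K\<^esub> (f w \<oplus>\<^bsub>K\<^esub> c \<otimes>\<^bsub>K\<^esub> g w)"
      using cl c by (simp add: fg R.r_distr R.a_ac)
  next
    fix a v assume "a \<in> carrier K" "v \<in> carrier V"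
    then show "f (a \<odot>\<^bsub>V\<^esub> v) \<oplus>\<^bsub>K\<^esub> c \<otimes>\<^bsub>K\<^esub> g (a \<odot>\<^bsub>V\<^esub> v) = a \<otimes>\<^bsub>K\<^esub> (f v \<oplus>\<^bsub>K\<^esub> c \<otimes>\<^bsub>K\<^esub> g v)"
      using cl c by (simp add: fg' r_distr m_ac)
  qed
qed

lemma mSpecD: "n \<in> mSpec R \<Longrightarrow> maximalideal n R" by (simp add: mSpec_def)

lemma S_set_subset_mSpec: "S_set R M \<subseteq> mSpec R" by (auto simp: S_set_def)

context module
begin

lemma topspace_fibre_topology:
  assumes fg: "finitely_generated R M" and n: "n \<in> mSpec R"
  shows "topspace (fibre_topology R M n) = carrier (fibre R M n)"
proof -
  interpret V: vectorspace "R Quot n" "fibre R M n" by (rule fibre_vectorspace[OF mSpecD[OF n]])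
  show ?thesis
    unfolding fibre_topology_def
    using V.topspace_zariski[OF fibre_fin_dim[OF fg mSpecD[OF n]]] topspace_three_closed[of "fibre R M n"]
    by simp
qed

lemma topspace_induced_zariski:
  assumes fg: "finitely_generated R M"
  shows "topspace (induced_zariski R M) = carrier M"
  unfolding induced_zariski_def topspace_pullback_topology topspace_product_topology
  by (auto simp: topspace_fibre_topology[OF fg] PiE_iff)

lemma continuous_map_fibre:
  assumes n: "n \<in> mSpec R"
  shows "continuous_map (induced_zariski R M) (fibre_topology R M n) (\<lambda>x. ideal_smult R n M +>\<^bsub>M\<^esub> x)"
proof -
  have "continuous_map (induced_zariski R M) (fibre_topology R M n)
      ((\<lambda>p. p n) \<circ> (\<lambda>x. \<lambda>n\<in>mSpec R. ideal_smult R n M +>\<^bsub>M\<^esub> x))"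
    unfolding induced_zariski_def
    by (rule continuous_map_pullback[OF continuous_map_product_projection[OF n]])
  moreover have "(\<lambda>p. p n) \<circ> (\<lambda>x. \<lambda>n\<in>mSpec R. ideal_smult R n M +>\<^bsub>M\<^esub> x)
      = (\<lambda>x. ideal_smult R n M +>\<^bsub>M\<^esub> x)"
    using n by (simp add: fun_eq_iff)
  ultimately show ?thesis by simp
qed

text \<open>
  The universal property of an initial topology and of a product.
\<close>

lemma continuous_map_into_induced_zariskiI:
  assumes g: "\<And>x. x \<in> topspace S \<Longrightarrow> g x \<in> carrier M"
    and cont: "\<And>n. n \<in> mSpec R \<Longrightarrow>
      continuous_map S (fibre_topology R M n) (\<lambda>x. ideal_smult R n M +>\<^bsub>M\<^esub> g x)"
  shows "continuous_map S (induced_zariski R M) g"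
  unfolding induced_zariski_def
proof (rule continuous_map_pullback')
  show "continuous_map S (product_topology (fibre_topology R M) (mSpec R))
      ((\<lambda>x. \<lambda>n\<in>mSpec R. ideal_smult R n M +>\<^bsub>M\<^esub> x) \<circ> g)"
    unfolding continuous_map_componentwise
    using cont by auto
  show "topspace S \<subseteq> g -` carrier M" using g by auto
qed

text \<open>
  A basic open set of a product restricts finitely many factors only.
\<close>

lemma induced_zariski_open_locality:
  assumes fg: "finitely_generated R M" and U: "openin (induced_zariski R M) U" and z: "z \<in> U"
  shows "\<exists>J. finite J \<and> J \<subseteq> mSpec R \<and>
    (\<forall>w\<in>carrier M. (\<forall>n\<in>J. ideal_smult R n M +>\<^bsub>M\<^esub> w = ideal_smult R n M +>\<^bsub>M\<^esub> z) \<longrightarrow> w \<in> U)"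
proof -
  let ?f = "\<lambda>x. \<lambda>n\<in>mSpec R. ideal_smult R n M +>\<^bsub>M\<^esub> x"
  obtain W where W: "openin (product_topology (fibre_topology R M) (mSpec R)) W"
    and U_eq: "U = ?f -` W \<inter> carrier M"
    using U unfolding induced_zariski_def openin_pullback_topology by (elim exE conjE)
  have "?f z \<in> W" using z U_eq by simp
  from product_topology_open_contains_basis[OF W this] obtain Y where
    Y: "?f z \<in> PiE (mSpec R) Y" "finite {n. Y n \<noteq> topspace (fibre_topology R M n)}"
      "PiE (mSpec R) Y \<subseteq> W" by (elim exE conjE)
  define J where "J = {n. Y n \<noteq> topspace (fibre_topology R M n)} \<inter> mSpec R"
  have "w \<in> U" if w: "w \<in> carrier M"
    and eq: "\<forall>n\<in>J. ideal_smult R n M +>\<^bsub>M\<^esub> w = ideal_smult R n M +>\<^bsub>M\<^esub> z" for w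
  proof -
    have "ideal_smult R n M +>\<^bsub>M\<^esub> w \<in> Y n" if n: "n \<in> mSpec R" for n
    proof (cases "n \<in> J")
      case True
      then show ?thesis using PiE_mem[OF Y(1) n] n eq by simp
    next
      case False
      then have "Y n = carrier (fibre R M n)"
        using n topspace_fibre_topology[OF fg n] by (simp add: J_def)
      then show ?thesis using w by simp
    qed
    then have "?f w \<in> PiE (mSpec R) Y" by auto
    from subsetD[OF Y(3) this] show ?thesis using w U_eq by simp
  qed
  then show ?thesis using Y(2) by (intro exI[of _ J]) (simp add: J_def)
qed

lemma functional_hyperplane:
  assumes fg: "finitely_generated R M" and n: "n \<in> S_set R M"
    and f: "linear_functional (R Quot n) (fibre R M n) f"
    and v: "v \<in> carrier (fibre R M n)" "f v \<noteq> \<zero>\<^bsub>R Quot n\<^esub>"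
  defines "H \<equiv> {x \<in> carrier M. f (ideal_smult R n M +>\<^bsub>M\<^esub> x) = \<zero>\<^bsub>R Quot n\<^esub>}"
  shows "Module.submodule H R M" "H \<noteq> carrier M" "closedin (induced_zariski R M) H"
proof -
  have nm: "n \<in> mSpec R" using n S_set_subset_mSpec by blast
  have I: "ideal n R" using mSpecD[OF nm] by (rule maximalideal.axioms)
  interpret V: vectorspace "R Quot n" "fibre R M n" by (rule fibre_vectorspace[OF mSpecD[OF nm]])
  interpret q: ring_hom_ring R "R Quot n" "(+>) n" by (rule ideal.rcos_ring_hom_ring[OF I])
  let ?p = "\<lambda>x. ideal_smult R n M +>\<^bsub>M\<^esub> x"
  have fc: "f (?p x) \<in> carrier (R Quot n)" if "x \<in> carrier M" for x
    using f fibre_carrierI[OF that] by (auto simp: linear_functional_def)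
  have f_add: "f (?p (x \<oplus>\<^bsub>M\<^esub> y)) = f (?p x) \<oplus>\<^bsub>R Quot n\<^esub> f (?p y)"
    if "x \<in> carrier M" "y \<in> carrier M" for x y
    using f that by (simp add: fibre_add[OF I, symmetric] linear_functional_def)
  have f_smult: "f (?p (a \<odot>\<^bsub>M\<^esub> x)) = (n +> a) \<otimes>\<^bsub>R Quot n\<^esub> f (?p x)"
    if "a \<in> carrier R" "x \<in> carrier M" for x a
    using f that q.hom_closed by (simp add: fibre_smult[OF I, symmetric] linear_functional_def)
  show "Module.submodule H R M"
  proof (rule submodule_criterion)
    show "\<zero>\<^bsub>M\<^esub> \<in> H"
      using V.linear_functional_zero[OF f] by (simp add: H_def fibre_zero_coset[OF I])
    show "a \<odot>\<^bsub>M\<^esub> x \<in> H" if "a \<in> carrier R" "x \<in> H" for a x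
      using that q.hom_closed[OF that(1)] by (simp add: H_def f_smult)
    show "x \<oplus>\<^bsub>M\<^esub> y \<in> H" if "x \<in> H" "y \<in> H" for x y
      using that by (simp add: H_def f_add)
  qed (auto simp: H_def)
  show "H \<noteq> carrier M"
  proof
    assume H: "H = carrier M"
    obtain x where "x \<in> carrier M" "v = ?p x" using v(1) by (auto simp: fibre_carrier)
    then show False using H v(2) by (auto simp: H_def)
  qed
  have "closedin (fibre_topology R M n) {v \<in> carrier (fibre R M n). \<forall>g\<in>{f}. g v = \<zero>\<^bsub>R Quot n\<^esub>}"
    unfolding fibre_topology_def if_P[OF n]
    by (rule V.closedin_zeros[OF fibre_fin_dim[OF fg mSpecD[OF nm]]])
      (simp add: regular_functions.linear[OF f])
  from closedin_continuous_map_preimage[OF continuous_map_fibre[OF nm] this]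
  have "closedin (induced_zariski R M) {x \<in> carrier M. ?p x \<in> {v \<in> carrier (fibre R M n). \<forall>g\<in>{f}. g v = \<zero>\<^bsub>R Quot n\<^esub>}}"
    by (simp add: topspace_induced_zariski[OF fg])
  also have "{x \<in> carrier M. ?p x \<in> {v \<in> carrier (fibre R M n). \<forall>g\<in>{f}. g v = \<zero>\<^bsub>R Quot n\<^esub>}} = H"
    by (auto simp: H_def)
  finally show "closedin (induced_zariski R M) H" .
qed

lemma S_set_fibre_independent_functionals:
  assumes fg: "finitely_generated R M" and n: "n \<in> S_set R M"
  shows "\<exists>f g v w. linear_functional (R Quot n) (fibre R M n) f \<and> linear_functional (R Quot n) (fibre R M n) g \<and>
    v \<in> carrier (fibre R M n) \<and> w \<in> carrier (fibre R M n) \<and>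
    f v = \<one>\<^bsub>R Quot n\<^esub> \<and> g v = \<zero>\<^bsub>R Quot n\<^esub> \<and> g w = \<one>\<^bsub>R Quot n\<^esub>"
proof -
  have nm: "n \<in> mSpec R" using n S_set_subset_mSpec by blast
  interpret V: vectorspace "R Quot n" "fibre R M n" by (rule fibre_vectorspace[OF mSpecD[OF nm]])
  obtain B where B: "finite B" "V.basis B"
    using V.finite_basis_exists[OF fibre_fin_dim[OF fg mSpecD[OF nm]]] by (elim exE conjE)
  have "card B \<ge> 2" using n V.dim_basis[OF B] by (simp add: S_set_def)
  then obtain b b' where b: "b \<in> B" "b' \<in> B" "b \<noteq> b'"
    by (metis B(1) One_nat_def card_le_Suc0_iff_eq not_less_eq_eq numeral_2_eq_2)
  have BV: "B \<subseteq> carrier (fibre R M n)" using B(2) by (simp add: V.basis_def)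
  obtain c where c: "(\<forall>v\<in>carrier (fibre R M n). c v \<in> B \<rightarrow>\<^sub>E carrier (R Quot n) \<and> V.lincomb (c v) B = v) \<and>
    (\<forall>x\<in>B \<rightarrow>\<^sub>E carrier (R Quot n). c (V.lincomb x B) = x) \<and>
    (\<forall>b\<in>B. linear_functional (R Quot n) (fibre R M n) (\<lambda>v. c v b))"
    by (rule exE[OF V.basis_coordinates[OF B]])
  \<comment> \<open>Unit vectors in coordinates; they separate two coordinate functionals.\<close>
  define e where "e b = restrict (\<lambda>d. if d = b then \<one>\<^bsub>R Quot n\<^esub> else \<zero>\<^bsub>R Quot n\<^esub>) B" for b
  have e: "e b \<in> B \<rightarrow>\<^sub>E carrier (R Quot n)" for b by (auto simp: e_def)
  then have "c (V.lincomb (e b) B) = e b" "V.lincomb (e b) B \<in> carrier (fibre R M n)" for b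
    using c BV by (auto intro!: V.lincomb_closed)
  then show ?thesis
    using b c
    by (intro exI[of _ "\<lambda>v. c v b"] exI[of _ "\<lambda>v. c v b'"] exI[of _ "V.lincomb (e b) B"]
        exI[of _ "V.lincomb (e b') B"]) (simp add: e_def)
qed

text \<open>
  If \<open>g\<close> does not vanish at a point, then \<open>f + c g\<close> does for \<open>c = - f/g\<close>.  Independence of \<open>f\<close>
  and \<open>g\<close> keeps all these hyperplanes proper.
\<close>

lemma hyperplane_cover:
  assumes fg: "finitely_generated R M" and n: "n \<in> S_set R M"
  shows "\<exists>\<F>. |\<F>| \<le>o |carrier (R Quot n)| +c cone \<and> \<Union>\<F> = carrier M \<and>
    (\<forall>H\<in>\<F>. Module.submodule H R M \<and> H \<noteq> carrier M \<and> closedin (induced_zariski R M) H)"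
proof -
  have nm: "n \<in> mSpec R" using n S_set_subset_mSpec by blast
  interpret V: vectorspace "R Quot n" "fibre R M n" by (rule fibre_vectorspace[OF mSpecD[OF nm]])
  let ?K = "R Quot n" and ?V = "fibre R M n"
  let ?p = "\<lambda>x. ideal_smult R n M +>\<^bsub>M\<^esub> x"
  obtain f g v w where f: "linear_functional ?K ?V f" and g: "linear_functional ?K ?V g"
    and v: "v \<in> carrier ?V" "f v = \<one>\<^bsub>?K\<^esub>" "g v = \<zero>\<^bsub>?K\<^esub>" and w: "w \<in> carrier ?V" "g w = \<one>\<^bsub>?K\<^esub>"
    using S_set_fibre_independent_functionals[OF fg n] by (elim exE conjE)
  have cl: "f v \<in> carrier ?K" "g v \<in> carrier ?K" if "v \<in> carrier ?V" for v
    using f g that by (auto simp: linear_functional_def)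
  define Z where "Z h = {x \<in> carrier M. h (?p x) = \<zero>\<^bsub>?K\<^esub>}" for h
  define h where "h c = (\<lambda>v. f v \<oplus>\<^bsub>?K\<^esub> c \<otimes>\<^bsub>?K\<^esub> g v)" for c
  have lin: "linear_functional ?K ?V (h c)" if "c \<in> carrier ?K" for c
    unfolding h_def by (rule V.linear_functional_add_scale[OF f g that])
  have nz: "h c v \<noteq> \<zero>\<^bsub>?K\<^esub>" if "c \<in> carrier ?K" for c
    using that v by (simp add: h_def)
  define \<F> where "\<F> = (\<lambda>c. Z (h c)) ` carrier ?K \<union> {Z g}"
  have "|\<F>| \<le>o |(\<lambda>c. Z (h c)) ` carrier ?K| +c |{Z g}|"
    unfolding \<F>_def by (rule Un_csum)
  also have "|(\<lambda>c. Z (h c)) ` carrier ?K| +c |{Z g}| \<le>o |carrier ?K| +c cone"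
    unfolding cone_def
    by (rule csum_mono[OF card_of_image]) (rule card_of_ordLeqI[of "\<lambda>_. ()"], auto)
  finally have card: "|\<F>| \<le>o |carrier ?K| +c cone" .
  have props: "Module.submodule H R M \<and> H \<noteq> carrier M \<and> closedin (induced_zariski R M) H" if "H \<in> \<F>" for H
  proof -
    consider c where "c \<in> carrier ?K" "H = Z (h c)" | "H = Z g" using \<open>H \<in> \<F>\<close> by (auto simp: \<F>_def)
    then show ?thesis
    proof cases
      case 1
      then show ?thesis
        unfolding Z_def using functional_hyperplane[OF fg n lin[OF 1(1)] v(1) nz[OF 1(1)]] by simp
    next
      case 2
      have "g w \<noteq> \<zero>\<^bsub>?K\<^esub>" using w by simp
      then show ?thesis
        unfolding 2 Z_def using functional_hyperplane[OF fg n g w(1)] by simp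
    qed
  qed
  have "x \<in> \<Union>\<F>" if x: "x \<in> carrier M" for x
  proof (cases "g (?p x) = \<zero>\<^bsub>?K\<^esub>")
    case True
    then show ?thesis using x by (auto simp: \<F>_def Z_def)
  next
    case False
    have fx: "f (?p x) \<in> carrier ?K" and gx: "g (?p x) \<in> carrier ?K" using cl x by auto
    then have "g (?p x) \<in> Units ?K" using False by (simp add: V.field_Units)
    then obtain i where i: "i \<in> carrier ?K" "i \<otimes>\<^bsub>?K\<^esub> g (?p x) = \<one>\<^bsub>?K\<^esub>"
      by (rule bexE[OF V.R.Units_l_inv_ex])
    define c where "c = \<ominus>\<^bsub>?K\<^esub> (f (?p x) \<otimes>\<^bsub>?K\<^esub> i)"
    have c: "c \<in> carrier ?K" using fx i by (simp add: c_def)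
    have "c \<otimes>\<^bsub>?K\<^esub> g (?p x) = \<ominus>\<^bsub>?K\<^esub> (f (?p x) \<otimes>\<^bsub>?K\<^esub> (i \<otimes>\<^bsub>?K\<^esub> g (?p x)))"
      using fx gx i(1) by (simp add: c_def V.R.l_minus V.R.m_assoc)
    then have "h c (?p x) = \<zero>\<^bsub>?K\<^esub>" using fx i by (simp add: h_def V.R.r_neg)
    then show ?thesis using x c by (auto simp: \<F>_def Z_def)
  qed
  moreover have "\<Union>\<F> \<subseteq> carrier M" by (auto simp: \<F>_def Z_def)
  ultimately have "\<Union>\<F> = carrier M" by blast
  with card props show ?thesis by (intro exI[of _ \<F>]) simp
qed

end

section \<open>Construction of rings and modules of fractions\<close>

lemma UN_pairs_const:
  assumes "(a, b) \<in> P" "(c, d) \<in> Q"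
    and "\<And>a b c d. (a, b) \<in> P \<Longrightarrow> (c, d) \<in> Q \<Longrightarrow> f a b c d = C"
  shows "(\<Union>(a, b)\<in>P. \<Union>(c, d)\<in>Q. f a b c d) = C"
  using assms by (auto 0 3)

locale multiplicative_set = cring R for R :: "('r, 'x) ring_scheme" (structure) +
  fixes T :: "'r set"
  assumes T_sub: "T \<subseteq> carrier R"
    and T_one [simp, intro]: "\<one> \<in> T"
    and T_mult [simp, intro]: "\<lbrakk>s \<in> T; t \<in> T\<rbrakk> \<Longrightarrow> s \<otimes> t \<in> T"
begin

lemma T_carrier [simp, intro]: "t \<in> T \<Longrightarrow> t \<in> carrier R"
  using T_sub by blast

end

locale module_fractions = module R M + multiplicative_set R T
  for R :: "('r, 'x) ring_scheme" (structure)
    and M :: "('r, 'm, 'y) module_scheme" (structure) and T :: "'r set"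
begin

abbreviation frac :: "'m \<Rightarrow> 'r \<Rightarrow> ('m \<times> 'r) set" where
  "frac \<equiv> mfrac M T"

abbreviation L :: "(('r \<times> 'r) set, ('m \<times> 'r) set) module" where
  "L \<equiv> loc_module R M T"

lemma frac_mem_iff:
  "(y, t) \<in> frac x s \<longleftrightarrow>
     y \<in> carrier M \<and> t \<in> T \<and> (\<exists>u\<in>T. (u \<otimes> s) \<odot>\<^bsub>M\<^esub> y = (u \<otimes> t) \<odot>\<^bsub>M\<^esub> x)"
  if "x \<in> carrier M" "s \<in> T"
  using that by (auto simp: mfrac_def smult_assoc1)

lemma frac_self: "x \<in> carrier M \<Longrightarrow> s \<in> T \<Longrightarrow> (x, s) \<in> frac x s"
  using T_one by (auto simp: frac_mem_iff)

text \<open>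
  The relation is transitive: if \<open>u\<close> witnesses \<open>x/s = y/t\<close> and \<open>v\<close> witnesses \<open>x/s = z/r\<close>, then \<open>u v s\<close> witnesses \<open>y/t = z/r\<close>.
\<close>

lemma frac_eqI:
  assumes x: "x \<in> carrier M" "s \<in> T" and y: "y \<in> carrier M" "t \<in> T"
    and u: "u \<in> T" "(u \<otimes> s) \<odot>\<^bsub>M\<^esub> y = (u \<otimes> t) \<odot>\<^bsub>M\<^esub> x"
  shows "frac x s = frac y t"
proof -
  have sub: "frac x s \<subseteq> frac y t"
    if x: "x \<in> carrier M" "s \<in> T" and y: "y \<in> carrier M" "t \<in> T"
      and u: "u \<in> T" "(u \<otimes> s) \<odot>\<^bsub>M\<^esub> y = (u \<otimes> t) \<odot>\<^bsub>M\<^esub> x" for x s y t u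
  proof safe
    fix z r assume "(z, r) \<in> frac x s"
    then obtain v where z: "z \<in> carrier M" "r \<in> T" and v: "v \<in> T"
      and eq: "(v \<otimes> s) \<odot>\<^bsub>M\<^esub> z = (v \<otimes> r) \<odot>\<^bsub>M\<^esub> x"
      using x by (auto simp: frac_mem_iff)
    have "(u \<otimes> v \<otimes> s \<otimes> t) \<odot>\<^bsub>M\<^esub> z = (u \<otimes> t) \<odot>\<^bsub>M\<^esub> ((v \<otimes> s) \<odot>\<^bsub>M\<^esub> z)"
      using z u v x y by (simp add: smult_assoc1[symmetric] m_ac)
    also have "\<dots> = (v \<otimes> r) \<odot>\<^bsub>M\<^esub> ((u \<otimes> t) \<odot>\<^bsub>M\<^esub> x)"
      unfolding eq using z u(1) v x y by (simp add: smult_assoc1[symmetric] m_ac)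
    also have "\<dots> = (u \<otimes> v \<otimes> s \<otimes> r) \<odot>\<^bsub>M\<^esub> y"
      unfolding u(2)[symmetric] using z u(1) v x y by (simp add: smult_assoc1[symmetric] m_ac)
    finally show "(z, r) \<in> frac y t"
      using z u v x y by (auto simp: frac_mem_iff intro!: bexI[of _ "u \<otimes> v \<otimes> s"])
  qed
  show ?thesis
    using sub[OF x y u] sub[OF y x u(1) u(2)[symmetric]] by blast
qed

lemma frac_eq_iff:
  assumes x: "x \<in> carrier M" "s \<in> T" and y: "y \<in> carrier M" "t \<in> T"
  shows "frac x s = frac y t \<longleftrightarrow>
    (\<exists>u\<in>T. (u \<otimes> s) \<odot>\<^bsub>M\<^esub> y = (u \<otimes> t) \<odot>\<^bsub>M\<^esub> x)"
  using frac_eqI[OF assms] frac_self[OF y] frac_mem_iff[OF x] by blast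

text \<open>
  Both sides of a distributive law are computed over different denominators and agree after cancellation.
\<close>

lemma frac_cancel:
  assumes "x \<in> carrier M" "s \<in> T" "t \<in> T"
  shows "frac (t \<odot>\<^bsub>M\<^esub> x) (t \<otimes> s) = frac x s"
  using assms by (intro frac_eqI[of _ _ _ _ \<one>]) (auto simp: smult_assoc1[symmetric] m_ac)

lemma carrier_loc_module: "carrier L = {frac x s | x s. x \<in> carrier M \<and> s \<in> T}"
  by (simp add: loc_module_def)

lemma frac_closed [simp, intro]: "x \<in> carrier M \<Longrightarrow> s \<in> T \<Longrightarrow> frac x s \<in> carrier L"
  by (auto simp: carrier_loc_module)

lemma zero_loc_module: "\<zero>\<^bsub>L\<^esub> = frac \<zero>\<^bsub>M\<^esub> \<one>"
  by (simp add: loc_module_def)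

lemma zero_frac: "s \<in> T \<Longrightarrow> frac \<zero>\<^bsub>M\<^esub> s = \<zero>\<^bsub>L\<^esub>"
  unfolding zero_loc_module by (rule frac_eqI[of _ _ _ _ \<one>]) auto

lemma add_frac:
  assumes x: "x \<in> carrier M" "s \<in> T" and y: "y \<in> carrier M" "t \<in> T"
  shows "frac x s \<oplus>\<^bsub>L\<^esub> frac y t = frac (t \<odot>\<^bsub>M\<^esub> x \<oplus>\<^bsub>M\<^esub> s \<odot>\<^bsub>M\<^esub> y) (s \<otimes> t)"
proof -
  have eq: "frac (t' \<odot>\<^bsub>M\<^esub> x' \<oplus>\<^bsub>M\<^esub> s' \<odot>\<^bsub>M\<^esub> y') (s' \<otimes> t')
      = frac (t \<odot>\<^bsub>M\<^esub> x \<oplus>\<^bsub>M\<^esub> s \<odot>\<^bsub>M\<^esub> y) (s \<otimes> t)"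
    if xs: "(x', s') \<in> frac x s" and yt: "(y', t') \<in> frac y t" for x' s' y' t'
  proof -
    obtain u where x': "x' \<in> carrier M" "s' \<in> T"
      and u: "u \<in> T" "(u \<otimes> s) \<odot>\<^bsub>M\<^esub> x' = (u \<otimes> s') \<odot>\<^bsub>M\<^esub> x"
      using xs x by (auto simp: frac_mem_iff)
    obtain v where y': "y' \<in> carrier M" "t' \<in> T"
      and v: "v \<in> T" "(v \<otimes> t) \<odot>\<^bsub>M\<^esub> y' = (v \<otimes> t') \<odot>\<^bsub>M\<^esub> y"
      using yt y by (auto simp: frac_mem_iff)
    have "(u \<otimes> v \<otimes> (s \<otimes> t)) \<odot>\<^bsub>M\<^esub> (t' \<odot>\<^bsub>M\<^esub> x' \<oplus>\<^bsub>M\<^esub> s' \<odot>\<^bsub>M\<^esub> y')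
        = (v \<otimes> t \<otimes> t') \<odot>\<^bsub>M\<^esub> ((u \<otimes> s) \<odot>\<^bsub>M\<^esub> x') \<oplus>\<^bsub>M\<^esub> (u \<otimes> s \<otimes> s') \<odot>\<^bsub>M\<^esub> ((v \<otimes> t) \<odot>\<^bsub>M\<^esub> y')"
      using x y x' y' u(1) v(1) by (simp add: smult_r_distr smult_assoc1[symmetric] m_ac)
    also have "\<dots> = (u \<otimes> v \<otimes> (s' \<otimes> t')) \<odot>\<^bsub>M\<^esub> (t \<odot>\<^bsub>M\<^esub> x \<oplus>\<^bsub>M\<^esub> s \<odot>\<^bsub>M\<^esub> y)"
      unfolding u(2) v(2)
      using x y x' y' u(1) v(1) by (simp add: smult_r_distr smult_assoc1[symmetric] m_ac)
    finally show ?thesis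
      using x y x' y' u(1) v(1) by (intro frac_eqI[of _ _ _ _ "u \<otimes> v"]) auto
  qed
  have "frac x s \<oplus>\<^bsub>L\<^esub> frac y t
      = (\<Union>(x, s)\<in>frac x s. \<Union>(y, t)\<in>frac y t. frac (t \<odot>\<^bsub>M\<^esub> x \<oplus>\<^bsub>M\<^esub> s \<odot>\<^bsub>M\<^esub> y) (s \<otimes> t))"
    by (simp add: loc_module_def)
  also have "\<dots> = frac (t \<odot>\<^bsub>M\<^esub> x \<oplus>\<^bsub>M\<^esub> s \<odot>\<^bsub>M\<^esub> y) (s \<otimes> t)"
    by (rule UN_pairs_const[OF frac_self[OF x] frac_self[OF y] eq])
  finally show ?thesis .
qed

lemma smult_frac:
  assumes a: "a \<in> carrier R" "s \<in> T" and y: "y \<in> carrier M" "t \<in> T"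
  shows "rfrac R T a s \<odot>\<^bsub>L\<^esub> frac y t = frac (a \<odot>\<^bsub>M\<^esub> y) (s \<otimes> t)"
proof -
  have eq: "frac (a' \<odot>\<^bsub>M\<^esub> y') (s' \<otimes> t') = frac (a \<odot>\<^bsub>M\<^esub> y) (s \<otimes> t)"
    if xs: "(a', s') \<in> rfrac R T a s" and yt: "(y', t') \<in> frac y t" for a' s' y' t'
  proof -
    obtain u where a': "a' \<in> carrier R" "s' \<in> T"
      and u: "u \<in> T" "u \<otimes> (s \<otimes> a') = u \<otimes> (s' \<otimes> a)"
      using xs by (auto simp: rfrac_def)
    obtain v where y': "y' \<in> carrier M" "t' \<in> T"
      and v: "v \<in> T" "(v \<otimes> t) \<odot>\<^bsub>M\<^esub> y' = (v \<otimes> t') \<odot>\<^bsub>M\<^esub> y"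
      using yt y by (auto simp: frac_mem_iff)
    have "(u \<otimes> v \<otimes> (s \<otimes> t)) \<odot>\<^bsub>M\<^esub> (a' \<odot>\<^bsub>M\<^esub> y')
        = (u \<otimes> (s \<otimes> a')) \<odot>\<^bsub>M\<^esub> ((v \<otimes> t) \<odot>\<^bsub>M\<^esub> y')"
      using a y a' y' u(1) v(1) by (simp add: smult_assoc1[symmetric] m_ac)
    also have "\<dots> = (u \<otimes> v \<otimes> (s' \<otimes> t')) \<odot>\<^bsub>M\<^esub> (a \<odot>\<^bsub>M\<^esub> y)"
      unfolding u(2) v(2)
      using a y a' y' u(1) v(1) by (simp add: smult_assoc1[symmetric] m_ac)
    finally show ?thesis
      using a y a' y' u(1) v(1) by (intro frac_eqI[of _ _ _ _ "u \<otimes> v"]) auto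
  qed
  have "(a, s) \<in> rfrac R T a s"
    using a T_one by (auto simp: rfrac_def)
  note UN_pairs_const[OF this frac_self[OF y] eq]
  moreover have "rfrac R T a s \<odot>\<^bsub>L\<^esub> frac y t
      = (\<Union>(a, s)\<in>rfrac R T a s. \<Union>(y, t)\<in>frac y t. frac (a \<odot>\<^bsub>M\<^esub> y) (s \<otimes> t))"
    by (simp add: loc_module_def)
  ultimately show ?thesis by simp
qed

lemma loc_module_abelian_group: "abelian_group L"
proof (rule abelian_groupI)
  fix P Q assume "P \<in> carrier L" "Q \<in> carrier L"
  then obtain x s y t where P: "P = frac x s" "x \<in> carrier M" "s \<in> T"
    and Q: "Q = frac y t" "y \<in> carrier M" "t \<in> T"
    by (auto simp: carrier_loc_module)
  then show "P \<oplus>\<^bsub>L\<^esub> Q \<in> carrier L" by (simp add: add_frac)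
  show "P \<oplus>\<^bsub>L\<^esub> Q = Q \<oplus>\<^bsub>L\<^esub> P"
    using P Q by (simp add: add_frac M.a_comm m_comm)
  fix W assume "W \<in> carrier L"
  then obtain z r where W: "W = frac z r" "z \<in> carrier M" "r \<in> T"
    by (auto simp: carrier_loc_module)
  show "P \<oplus>\<^bsub>L\<^esub> Q \<oplus>\<^bsub>L\<^esub> W = P \<oplus>\<^bsub>L\<^esub> (Q \<oplus>\<^bsub>L\<^esub> W)"
    using P Q W by (simp add: add_frac smult_r_distr smult_assoc1[symmetric] m_ac M.a_assoc)
next
  fix P assume "P \<in> carrier L"
  then obtain x s where P: "P = frac x s" "x \<in> carrier M" "s \<in> T"
    by (auto simp: carrier_loc_module)
  then show "\<zero>\<^bsub>L\<^esub> \<oplus>\<^bsub>L\<^esub> P = P" by (simp add: zero_loc_module add_frac)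
  have "frac (\<ominus>\<^bsub>M\<^esub> x) s \<oplus>\<^bsub>L\<^esub> P = \<zero>\<^bsub>L\<^esub>"
    using P by (simp add: add_frac smult_r_minus M.l_neg zero_frac)
  then show "\<exists>Q\<in>carrier L. Q \<oplus>\<^bsub>L\<^esub> P = \<zero>\<^bsub>L\<^esub>"
    using P by (meson M.a_inv_closed frac_closed)
qed (simp add: zero_loc_module)

end

text \<open>
  The ring of fractions is the module of fractions of this module, so its
  addition and the independence of its product from representatives come from the case of modules.
\<close>

definition self_module :: "('r, 'x) ring_scheme \<Rightarrow> ('r, 'r) module" where
  "self_module R = \<lparr>carrier = carrier R, monoid.mult = monoid.mult R, one = one R,
     zero = zero R, add = add R, smult = monoid.mult R\<rparr>"

lemma (in cring) module_self_module: "module R (self_module R)"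
proof (rule moduleI)
  show "abelian_group (self_module R)"
    by (rule abelian_groupI)
      (auto simp: self_module_def a_ac intro: exI[of _ "\<ominus> x" for x] l_neg)
qed (auto simp: self_module_def is_cring l_distr r_distr m_ac)

context multiplicative_set
begin

interpretation self: module_fractions R "self_module R" T
  by (intro module_fractions.intro module_self_module multiplicative_set_axioms)

abbreviation A :: "('r \<times> 'r) set ring" where "A \<equiv> loc_ring R T"

lemma rfrac_eq_mfrac: "rfrac R T = mfrac (self_module R) T"
  by (simp add: rfrac_def mfrac_def self_module_def fun_eq_iff)

lemma loc_ring_eq_loc_module:
  "carrier A = carrier self.L" "\<zero>\<^bsub>A\<^esub> = \<zero>\<^bsub>self.L\<^esub>" "add A = add self.L" "monoid.mult A = smult self.L"
  "\<one>\<^bsub>A\<^esub> = rfrac R T \<one> \<one>"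
  by (simp_all add: loc_ring_def loc_module_def rfrac_eq_mfrac) (simp_all add: self_module_def)

lemma carrier_loc_ring: "carrier A = {rfrac R T a s | a s. a \<in> carrier R \<and> s \<in> T}"
  by (simp add: loc_ring_def)

lemma rfrac_closed [simp, intro]: "a \<in> carrier R \<Longrightarrow> s \<in> T \<Longrightarrow> rfrac R T a s \<in> carrier A"
  by (auto simp: carrier_loc_ring)

lemma add_rfrac:
  "\<lbrakk>a \<in> carrier R; s \<in> T; b \<in> carrier R; t \<in> T\<rbrakk> \<Longrightarrow>
    rfrac R T a s \<oplus>\<^bsub>A\<^esub> rfrac R T b t = rfrac R T (t \<otimes> a \<oplus> s \<otimes> b) (s \<otimes> t)"
  unfolding loc_ring_eq_loc_module rfrac_eq_mfrac
  by (subst self.add_frac) (auto simp: self_module_def)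

lemma mult_rfrac:
  "\<lbrakk>a \<in> carrier R; s \<in> T; b \<in> carrier R; t \<in> T\<rbrakk> \<Longrightarrow>
    rfrac R T a s \<otimes>\<^bsub>A\<^esub> rfrac R T b t = rfrac R T (a \<otimes> b) (s \<otimes> t)"
  unfolding loc_ring_eq_loc_module rfrac_eq_mfrac
  by (subst self.smult_frac[unfolded rfrac_eq_mfrac]) (auto simp: self_module_def)

lemma rfrac_cancel:
  "\<lbrakk>a \<in> carrier R; s \<in> T; t \<in> T\<rbrakk> \<Longrightarrow> rfrac R T (t \<otimes> a) (t \<otimes> s) = rfrac R T a s"
  using self.frac_cancel[of a s t] by (simp add: rfrac_eq_mfrac self_module_def)

lemma rfrac_zero_iff:
  "a \<in> carrier R \<Longrightarrow> rfrac R T a \<one> = \<zero>\<^bsub>A\<^esub> \<longleftrightarrow> (\<exists>u\<in>T. u \<otimes> a = \<zero>)"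
  unfolding loc_ring_eq_loc_module self.zero_loc_module rfrac_eq_mfrac
  by (subst self.frac_eq_iff) (auto simp: self_module_def eq_commute)

lemma loc_ring_cring: "cring A"
proof (rule cringI)
  interpret L: abelian_group self.L by (rule self.loc_module_abelian_group)
  show "abelian_group A"
  proof (rule abelian_groupI)
    fix P assume "P \<in> carrier A"
    then show "\<exists>Q\<in>carrier A. Q \<oplus>\<^bsub>A\<^esub> P = \<zero>\<^bsub>A\<^esub>"
      unfolding loc_ring_eq_loc_module using L.l_neg L.a_inv_closed by blast
  qed (simp_all add: loc_ring_eq_loc_module L.a_ac)
  show "Group.comm_monoid A"
  proof (rule comm_monoidI)
    show "\<one>\<^bsub>A\<^esub> \<in> carrier A" by (auto simp: loc_ring_eq_loc_module(5))
  next
    fix P Q W assume "P \<in> carrier A" "Q \<in> carrier A" "W \<in> carrier A"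
    then show "P \<otimes>\<^bsub>A\<^esub> Q \<otimes>\<^bsub>A\<^esub> W = P \<otimes>\<^bsub>A\<^esub> (Q \<otimes>\<^bsub>A\<^esub> W)"
      by (auto simp: carrier_loc_ring mult_rfrac m_assoc)
  next
    fix P Q assume "P \<in> carrier A" "Q \<in> carrier A"
    then show "P \<otimes>\<^bsub>A\<^esub> Q = Q \<otimes>\<^bsub>A\<^esub> P" "P \<otimes>\<^bsub>A\<^esub> Q \<in> carrier A"
      by (auto simp: carrier_loc_ring mult_rfrac m_comm) blast
  next
    fix P assume "P \<in> carrier A"
    then show "\<one>\<^bsub>A\<^esub> \<otimes>\<^bsub>A\<^esub> P = P"
      by (auto simp: carrier_loc_ring mult_rfrac loc_ring_eq_loc_module(5))
  qed
next
  fix P Q W assume "P \<in> carrier A" "Q \<in> carrier A" "W \<in> carrier A"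
  then obtain a s b t c r where P: "P = rfrac R T a s" "a \<in> carrier R" "s \<in> T"
    and Q: "Q = rfrac R T b t" "b \<in> carrier R" "t \<in> T"
    and W: "W = rfrac R T c r" "c \<in> carrier R" "r \<in> T"
    by (auto simp: carrier_loc_ring)
  have "P \<otimes>\<^bsub>A\<^esub> W \<oplus>\<^bsub>A\<^esub> Q \<otimes>\<^bsub>A\<^esub> W = rfrac R T (r \<otimes> ((t \<otimes> a \<oplus> s \<otimes> b) \<otimes> c)) (r \<otimes> (s \<otimes> t \<otimes> r))"
    using P Q W by (simp add: mult_rfrac add_rfrac l_distr r_distr m_ac)
  also have "\<dots> = (P \<oplus>\<^bsub>A\<^esub> Q) \<otimes>\<^bsub>A\<^esub> W"
    using P Q W by (subst rfrac_cancel) (auto simp: mult_rfrac add_rfrac)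
  finally show "(P \<oplus>\<^bsub>A\<^esub> Q) \<otimes>\<^bsub>A\<^esub> W = P \<otimes>\<^bsub>A\<^esub> W \<oplus>\<^bsub>A\<^esub> Q \<otimes>\<^bsub>A\<^esub> W" ..
qed

end

context module_fractions
begin

lemma loc_module_module: "module A L"
proof (rule moduleI[OF loc_ring_cring loc_module_abelian_group])
  show "\<one>\<^bsub>A\<^esub> \<odot>\<^bsub>L\<^esub> x = x" if "x \<in> carrier L" for x
    using that by (auto simp: carrier_loc_module smult_frac loc_ring_eq_loc_module(5))
next
  fix a x assume a: "a \<in> carrier A" and x: "x \<in> carrier L"
  obtain a' s where a': "a = rfrac R T a' s" "a' \<in> carrier R" "s \<in> T"
    using a by (auto simp: carrier_loc_ring)
  obtain x' t where x': "x = frac x' t" "x' \<in> carrier M" "t \<in> T"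
    using x by (auto simp: carrier_loc_module)
  show "a \<odot>\<^bsub>L\<^esub> x \<in> carrier L"
    using a' x' by (simp add: smult_frac)
  {
    fix b assume "b \<in> carrier A"
    then obtain b' r where b': "b = rfrac R T b' r" "b' \<in> carrier R" "r \<in> T"
      by (auto simp: carrier_loc_ring)
    show "(a \<otimes>\<^bsub>A\<^esub> b) \<odot>\<^bsub>L\<^esub> x = a \<odot>\<^bsub>L\<^esub> (b \<odot>\<^bsub>L\<^esub> x)"
      using a' b' x' by (simp add: smult_frac mult_rfrac smult_assoc1 m_assoc)
    have "a \<odot>\<^bsub>L\<^esub> x \<oplus>\<^bsub>L\<^esub> b \<odot>\<^bsub>L\<^esub> x
        = frac (t \<odot>\<^bsub>M\<^esub> ((r \<otimes> a' \<oplus> s \<otimes> b') \<odot>\<^bsub>M\<^esub> x')) (t \<otimes> (s \<otimes> r \<otimes> t))"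
      using a' b' x'
      by (simp add: smult_frac add_frac smult_l_distr smult_r_distr smult_assoc1[symmetric] m_ac)
    also have "\<dots> = (a \<oplus>\<^bsub>A\<^esub> b) \<odot>\<^bsub>L\<^esub> x"
      using a' b' x' by (subst frac_cancel) (auto simp: smult_frac add_rfrac)
    finally show "(a \<oplus>\<^bsub>A\<^esub> b) \<odot>\<^bsub>L\<^esub> x = a \<odot>\<^bsub>L\<^esub> x \<oplus>\<^bsub>L\<^esub> b \<odot>\<^bsub>L\<^esub> x" ..
  }
  {
    fix y assume "y \<in> carrier L"
    then obtain y' r where y': "y = frac y' r" "y' \<in> carrier M" "r \<in> T"
      by (auto simp: carrier_loc_module)
    have "a \<odot>\<^bsub>L\<^esub> x \<oplus>\<^bsub>L\<^esub> a \<odot>\<^bsub>L\<^esub> y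
        = frac (s \<odot>\<^bsub>M\<^esub> (a' \<odot>\<^bsub>M\<^esub> (r \<odot>\<^bsub>M\<^esub> x' \<oplus>\<^bsub>M\<^esub> t \<odot>\<^bsub>M\<^esub> y'))) (s \<otimes> (s \<otimes> (t \<otimes> r)))"
      using a' y' x'
      by (simp add: smult_frac add_frac smult_l_distr smult_r_distr smult_assoc1[symmetric] m_ac)
    also have "\<dots> = a \<odot>\<^bsub>L\<^esub> (x \<oplus>\<^bsub>L\<^esub> y)"
      using a' y' x' by (subst frac_cancel) (auto simp: smult_frac add_frac)
    finally show "a \<odot>\<^bsub>L\<^esub> (x \<oplus>\<^bsub>L\<^esub> y) = a \<odot>\<^bsub>L\<^esub> x \<oplus>\<^bsub>L\<^esub> a \<odot>\<^bsub>L\<^esub> y" ..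
  }
qed

end

section \<open>Passing to the localization\<close>

text \<open>
  The properties of the maps \<open>a \<mapsto> a/1\<close> and \<open>x \<mapsto> x/1\<close> that characterize localizations.  Working from
  them keeps the classes of fractions out of the arguments below.
\<close>

locale module_localization = R: module R M + A: module A N
  for R :: "('r, 'x) ring_scheme" and M :: "('r, 'm, 'y) module_scheme"
    and A :: "('a, 'z) ring_scheme" and N :: "('a, 'n, 'w) module_scheme" +
  fixes T :: "'r set" and \<phi> :: "'r \<Rightarrow> 'a" and \<psi> :: "'m \<Rightarrow> 'n"
  assumes T_sub: "T \<subseteq> carrier R"
    and T_one: "\<one>\<^bsub>R\<^esub> \<in> T"
    and T_mult: "\<lbrakk>s \<in> T; t \<in> T\<rbrakk> \<Longrightarrow> s \<otimes>\<^bsub>R\<^esub> t \<in> T"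
    and \<phi>_hom: "\<phi> \<in> ring_hom R A"
    and \<psi>_closed [simp]: "x \<in> carrier M \<Longrightarrow> \<psi> x \<in> carrier N"
    and \<psi>_add: "\<lbrakk>x \<in> carrier M; y \<in> carrier M\<rbrakk> \<Longrightarrow> \<psi> (x \<oplus>\<^bsub>M\<^esub> y) = \<psi> x \<oplus>\<^bsub>N\<^esub> \<psi> y"
    and \<psi>_smult: "\<lbrakk>a \<in> carrier R; x \<in> carrier M\<rbrakk> \<Longrightarrow> \<psi> (a \<odot>\<^bsub>M\<^esub> x) = \<phi> a \<odot>\<^bsub>N\<^esub> \<psi> x"
    and \<phi>_unit: "t \<in> T \<Longrightarrow> \<exists>i\<in>carrier A. i \<otimes>\<^bsub>A\<^esub> \<phi> t = \<one>\<^bsub>A\<^esub>"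
    and ring_frac: "z \<in> carrier A \<Longrightarrow> \<exists>a\<in>carrier R. \<exists>s\<in>T. \<phi> s \<otimes>\<^bsub>A\<^esub> z = \<phi> a"
    and mod_frac: "y' \<in> carrier N \<Longrightarrow> \<exists>x\<in>carrier M. \<exists>s\<in>T. \<phi> s \<odot>\<^bsub>N\<^esub> y' = \<psi> x"
    and ring_ker: "\<lbrakk>a \<in> carrier R; \<phi> a = \<zero>\<^bsub>A\<^esub>\<rbrakk> \<Longrightarrow> \<exists>u\<in>T. u \<otimes>\<^bsub>R\<^esub> a = \<zero>\<^bsub>R\<^esub>"
    and mod_ker: "\<lbrakk>x \<in> carrier M; \<psi> x = \<zero>\<^bsub>N\<^esub>\<rbrakk> \<Longrightarrow> \<exists>u\<in>T. u \<odot>\<^bsub>M\<^esub> x = \<zero>\<^bsub>M\<^esub>"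
begin

lemma T_carrier [simp]: "s \<in> T \<Longrightarrow> s \<in> carrier R" using T_sub by blast

lemma \<phi>_closed [simp]: "a \<in> carrier R \<Longrightarrow> \<phi> a \<in> carrier A"
  by (rule ring_hom_closed[OF \<phi>_hom])

lemma \<phi>_ring_hom: "ring_hom_cring R A \<phi>"
  by (intro ring_hom_cring.intro ring_hom_cring_axioms.intro R.R.is_cring A.R.is_cring \<phi>_hom)

lemma \<phi>_mult: "\<lbrakk>a \<in> carrier R; b \<in> carrier R\<rbrakk> \<Longrightarrow> \<phi> (a \<otimes>\<^bsub>R\<^esub> b) = \<phi> a \<otimes>\<^bsub>A\<^esub> \<phi> b"
  by (rule ring_hom_mult[OF \<phi>_hom])

lemma \<phi>_add: "\<lbrakk>a \<in> carrier R; b \<in> carrier R\<rbrakk> \<Longrightarrow> \<phi> (a \<oplus>\<^bsub>R\<^esub> b) = \<phi> a \<oplus>\<^bsub>A\<^esub> \<phi> b"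
  by (rule ring_hom_add[OF \<phi>_hom])

lemma \<phi>_one: "\<phi> \<one>\<^bsub>R\<^esub> = \<one>\<^bsub>A\<^esub>" by (rule ring_hom_one[OF \<phi>_hom])

lemma \<phi>_zero: "\<phi> \<zero>\<^bsub>R\<^esub> = \<zero>\<^bsub>A\<^esub>"
  by (rule ring_hom_zero[OF \<phi>_hom R.R.ring_axioms A.R.ring_axioms])

lemma \<phi>_minus:
  assumes "a \<in> carrier R" "b \<in> carrier R" shows "\<phi> (a \<ominus>\<^bsub>R\<^esub> b) = \<phi> a \<ominus>\<^bsub>A\<^esub> \<phi> b"
proof -
  interpret h: ring_hom_cring R A \<phi> by (rule \<phi>_ring_hom)
  show ?thesis using assms by (simp add: a_minus_def)
qed

lemma \<psi>_zero: "\<psi> \<zero>\<^bsub>M\<^esub> = \<zero>\<^bsub>N\<^esub>"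
  using \<psi>_smult[of "\<zero>\<^bsub>R\<^esub>" "\<zero>\<^bsub>M\<^esub>"] by (simp add: \<phi>_zero)

lemma \<psi>_minus:
  assumes "x \<in> carrier M" "y \<in> carrier M" shows "\<psi> (x \<ominus>\<^bsub>M\<^esub> y) = \<psi> x \<ominus>\<^bsub>N\<^esub> \<psi> y"
proof -
  interpret h: ring_hom_cring R A \<phi> by (rule \<phi>_ring_hom)
  have "\<psi> (\<ominus>\<^bsub>M\<^esub> y) = \<psi> ((\<ominus>\<^bsub>R\<^esub> \<one>\<^bsub>R\<^esub>) \<odot>\<^bsub>M\<^esub> y)" using assms by (simp add: R.smult_l_minus)
  also have "\<dots> = \<ominus>\<^bsub>N\<^esub> \<psi> y" using assms by (subst \<psi>_smult) (simp_all add: A.smult_l_minus)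
  finally show ?thesis using assms by (simp add: a_minus_def \<psi>_add)
qed

text \<open>
  Elements of \<open>T\<close> become units, so denominators can be removed inside a submodule.
\<close>

lemma smult_unit_mem_submodule:
  assumes W: "Module.submodule W A N" and s: "s \<in> T" and z: "z \<in> carrier N" "\<phi> s \<odot>\<^bsub>N\<^esub> z \<in> W"
  shows "z \<in> W"
proof -
  obtain i where i: "i \<in> carrier A" "i \<otimes>\<^bsub>A\<^esub> \<phi> s = \<one>\<^bsub>A\<^esub>" by (rule bexE[OF \<phi>_unit[OF s]])
  have "i \<odot>\<^bsub>N\<^esub> (\<phi> s \<odot>\<^bsub>N\<^esub> z) = z" using i s z(1) by (simp add: A.smult_assoc1[symmetric])
  then show ?thesis using A.submoduleE(4)[OF W i(1) z(2)] by simp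
qed

lemma submodule_preimage:
  assumes W: "Module.submodule W A N"
  shows "Module.submodule {x \<in> carrier M. \<psi> x \<in> W} R M"
  using A.submoduleE(4,5)[OF W] A.submodule_zero[OF W]
  by (intro R.submodule_criterion) (auto simp: \<psi>_add \<psi>_smult \<psi>_zero)

lemma submodule_eq_carrierI:
  assumes W: "Module.submodule W A N" and sub: "\<And>x. x \<in> carrier M \<Longrightarrow> \<psi> x \<in> W"
  shows "W = carrier N"
proof
  show "W \<subseteq> carrier N" by (rule A.submoduleE(1)[OF W])
  show "carrier N \<subseteq> W"
  proof
    fix z assume z: "z \<in> carrier N"
    obtain x s where "x \<in> carrier M" "s \<in> T" "\<phi> s \<odot>\<^bsub>N\<^esub> z = \<psi> x"
      using mod_frac[OF z] by (elim bexE)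
    then show "z \<in> W" using smult_unit_mem_submodule[OF W _ z] sub by simp
  qed
qed

lemma finitely_generated_localization:
  assumes fg: "finitely_generated R M" shows "finitely_generated A N"
proof -
  obtain G where G: "finite G" "G \<subseteq> carrier M" "R.span G = carrier M"
    using fg unfolding finitely_generated_def by (elim exE conjE)
  have sub: "\<psi> ` G \<subseteq> carrier N" using G(2) by auto
  note W = A.span_submodule[OF sub]
  have "R.span G \<subseteq> {x \<in> carrier M. \<psi> x \<in> A.span (\<psi> ` G)}"
    by (rule R.span_least[OF _ submodule_preimage[OF W]]) (use G(2) A.in_own_span[OF sub] in auto)
  then have "A.span (\<psi> ` G) = carrier N"
    unfolding G(3) by (intro submodule_eq_carrierI[OF W]) auto
  then show ?thesis
    unfolding finitely_generated_def using G(1) sub by (intro exI[of _ "\<psi> ` G"]) simp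
qed

definition contraction :: "'a set \<Rightarrow> 'r set" where
  "contraction n = {a \<in> carrier R. \<phi> a \<in> n}"

lemma contractionI: "a \<in> carrier R \<Longrightarrow> \<phi> a \<in> n \<Longrightarrow> a \<in> contraction n"
  by (simp add: contraction_def)

lemma contractionD: "a \<in> contraction n \<Longrightarrow> \<phi> a \<in> n"
  by (simp add: contraction_def)

lemma contraction_ideal:
  assumes "ideal n A" shows "ideal (contraction n) R"
proof -
  interpret ideal n A by fact
  show ?thesis
    by (rule R.R.ideal_criterion) (auto simp: contraction_def \<phi>_add \<phi>_mult \<phi>_zero I_l_closed)
qed

definition extension :: "'r set \<Rightarrow> 'a set" where
  "extension m = {z \<in> carrier A. \<exists>s\<in>T. \<exists>a\<in>m. \<phi> s \<otimes>\<^bsub>A\<^esub> z = \<phi> a}"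

lemma extension_ideal:
  assumes "ideal m R" shows "ideal (extension m) A"
proof -
  interpret ideal m R by fact
  show ?thesis
  proof (rule A.R.ideal_criterion)
    show "extension m \<subseteq> carrier A" by (auto simp: extension_def)
    show "\<zero>\<^bsub>A\<^esub> \<in> extension m"
      unfolding extension_def using T_one
      by (intro CollectI conjI bexI[of _ "\<one>\<^bsub>R\<^esub>"] bexI[of _ "\<zero>\<^bsub>R\<^esub>"]) (auto simp: \<phi>_zero)
  next
    fix z w assume "z \<in> extension m" "w \<in> extension m"
    then obtain s a t b where z: "z \<in> carrier A" "s \<in> T" "a \<in> m" "\<phi> s \<otimes>\<^bsub>A\<^esub> z = \<phi> a"
      and w: "w \<in> carrier A" "t \<in> T" "b \<in> m" "\<phi> t \<otimes>\<^bsub>A\<^esub> w = \<phi> b"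
      unfolding extension_def by (elim CollectE conjE bexE)
    have ab: "a \<in> carrier R" "b \<in> carrier R" using z w Icarr by auto
    have "\<phi> (s \<otimes>\<^bsub>R\<^esub> t) \<otimes>\<^bsub>A\<^esub> (z \<oplus>\<^bsub>A\<^esub> w) = \<phi> t \<otimes>\<^bsub>A\<^esub> (\<phi> s \<otimes>\<^bsub>A\<^esub> z) \<oplus>\<^bsub>A\<^esub> \<phi> s \<otimes>\<^bsub>A\<^esub> (\<phi> t \<otimes>\<^bsub>A\<^esub> w)"
      using z(1,2) w(1,2) by (simp add: \<phi>_mult A.R.r_distr A.R.m_ac)
    also have "\<dots> = \<phi> (t \<otimes>\<^bsub>R\<^esub> a \<oplus>\<^bsub>R\<^esub> s \<otimes>\<^bsub>R\<^esub> b)"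
      using z w ab by (simp add: \<phi>_mult \<phi>_add)
    finally show "z \<oplus>\<^bsub>A\<^esub> w \<in> extension m"
      unfolding extension_def using z w T_mult I_l_closed
      by (intro CollectI conjI bexI[of _ "s \<otimes>\<^bsub>R\<^esub> t"] bexI[of _ "t \<otimes>\<^bsub>R\<^esub> a \<oplus>\<^bsub>R\<^esub> s \<otimes>\<^bsub>R\<^esub> b"]) auto
  next
    fix z w assume "z \<in> extension m" and w: "w \<in> carrier A"
    then obtain s a where z: "z \<in> carrier A" "s \<in> T" "a \<in> m" "\<phi> s \<otimes>\<^bsub>A\<^esub> z = \<phi> a"
      unfolding extension_def by (elim CollectE conjE bexE)
    obtain b t where b: "b \<in> carrier R" "t \<in> T" "\<phi> t \<otimes>\<^bsub>A\<^esub> w = \<phi> b"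
      using ring_frac[OF w] by (elim bexE)
    have a: "a \<in> carrier R" using z Icarr by auto
    have "\<phi> (s \<otimes>\<^bsub>R\<^esub> t) \<otimes>\<^bsub>A\<^esub> (w \<otimes>\<^bsub>A\<^esub> z) = (\<phi> t \<otimes>\<^bsub>A\<^esub> w) \<otimes>\<^bsub>A\<^esub> (\<phi> s \<otimes>\<^bsub>A\<^esub> z)"
      using z(1,2) w b(1,2) by (simp add: \<phi>_mult A.R.m_ac)
    also have "\<dots> = \<phi> (b \<otimes>\<^bsub>R\<^esub> a)" using z b a by (simp add: \<phi>_mult)
    finally show "w \<otimes>\<^bsub>A\<^esub> z \<in> extension m"
      unfolding extension_def using z b w T_mult I_l_closed
      by (intro CollectI conjI bexI[of _ "s \<otimes>\<^bsub>R\<^esub> t"] bexI[of _ "b \<otimes>\<^bsub>R\<^esub> a"]) auto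
  qed
qed

lemma in_extensionI: "ideal m R \<Longrightarrow> a \<in> m \<Longrightarrow> \<phi> a \<in> extension m"
  unfolding extension_def using T_one ideal.Icarr[of m R a]
  by (intro CollectI conjI bexI[of _ "\<one>\<^bsub>R\<^esub>"] bexI[of _ a]) (auto simp: \<phi>_one)

lemma subset_extension_contraction:
  assumes "ideal n A" "contraction n \<subseteq> m" shows "n \<subseteq> extension m"
proof
  interpret ideal n A by fact
  fix z assume z: "z \<in> n"
  obtain a s where a: "a \<in> carrier R" "s \<in> T" "\<phi> s \<otimes>\<^bsub>A\<^esub> z = \<phi> a"
    using ring_frac[OF Icarr[OF z]] by (elim bexE)
  then have "\<phi> a \<in> n" using I_l_closed[OF z \<phi>_closed[OF T_carrier[OF a(2)]]] by simp
  then have "a \<in> m" using a(1) assms(2) by (auto simp: contraction_def)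
  then show "z \<in> extension m"
    unfolding extension_def using a Icarr[OF z] by (intro CollectI conjI bexI[of _ s] bexI[of _ a])
qed

text \<open>
  If \<open>1\<close> were a fraction \<open>a/s\<close> with \<open>a \<in> m\<close>, then \<open>u (s - a) = 0\<close> for some \<open>u \<in> T\<close>, and
  \<open>s \<in> m\<close> as \<open>m\<close> is prime.
\<close>

lemma extension_proper:
  assumes m: "primeideal m R" and disj: "T \<inter> m = {}"
  shows "\<one>\<^bsub>A\<^esub> \<notin> extension m"
proof
  interpret primeideal m R by fact
  assume "\<one>\<^bsub>A\<^esub> \<in> extension m"
  then obtain s a where s: "s \<in> T" "a \<in> m" "\<phi> s \<otimes>\<^bsub>A\<^esub> \<one>\<^bsub>A\<^esub> = \<phi> a"
    unfolding extension_def by (elim CollectE conjE bexE)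
  have a: "a \<in> carrier R" using s Icarr by auto
  have "\<phi> (s \<ominus>\<^bsub>R\<^esub> a) = \<zero>\<^bsub>A\<^esub>"
    using s a by (subst \<phi>_minus) (simp_all add: a_minus_def A.R.r_neg)
  then obtain u where u: "u \<in> T" "u \<otimes>\<^bsub>R\<^esub> (s \<ominus>\<^bsub>R\<^esub> a) = \<zero>\<^bsub>R\<^esub>"
    using ring_ker[of "s \<ominus>\<^bsub>R\<^esub> a"] s a by auto
  have "s \<ominus>\<^bsub>R\<^esub> a \<in> m"
    using I_prime[of u "s \<ominus>\<^bsub>R\<^esub> a"] u s a disj by auto
  then have "(s \<ominus>\<^bsub>R\<^esub> a) \<oplus>\<^bsub>R\<^esub> a \<in> m" using s(2) by (rule a_closed)
  also have "(s \<ominus>\<^bsub>R\<^esub> a) \<oplus>\<^bsub>R\<^esub> a = s"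
    using s a by (simp add: a_minus_def R.R.a_assoc R.R.l_neg)
  finally show False using s(1) disj by blast
qed

lemma ideal_contraction_disjoint:
  assumes n: "ideal n A" "\<one>\<^bsub>A\<^esub> \<notin> n" shows "T \<inter> contraction n = {}"
proof -
  interpret ideal n A by fact
  have False if "t \<in> T" "\<phi> t \<in> n" for t
  proof -
    obtain i where i: "i \<in> carrier A" "i \<otimes>\<^bsub>A\<^esub> \<phi> t = \<one>\<^bsub>A\<^esub>" by (rule bexE[OF \<phi>_unit[OF \<open>t \<in> T\<close>]])
    then show False using I_l_closed[OF that(2) i(1)] n(2) by simp
  qed
  then show ?thesis by (auto simp: contraction_def)
qed

end

locale support_localization = module_localization R M A N T \<phi> \<psi>
  for R :: "('r, 'x) ring_scheme" and M :: "('r, 'm, 'y) module_scheme"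
    and A :: "('a, 'z) ring_scheme" and N :: "('a, 'n, 'w) module_scheme"
    and T :: "'r set" and \<phi> :: "'r \<Rightarrow> 'a" and \<psi> :: "'m \<Rightarrow> 'n" +
  assumes fg: "finitely_generated R M"
    and T_eq: "T = carrier R - \<Union>(S_set R M)"
begin

lemma S_set_memD:
  assumes "m \<in> S_set R M" shows "maximalideal m R" "ideal m R" "primeideal m R" "T \<inter> m = {}"
proof -
  show max: "maximalideal m R" using assms by (simp add: S_set_def mSpec_def)
  show "ideal m R" using max by (rule maximalideal.axioms)
  show "primeideal m R" using max by (rule R.R.maximalideal_prime)
  show "T \<inter> m = {}" using assms T_eq by blast
qed

lemma mSpec_memD:
  assumes "n \<in> mSpec A" shows "maximalideal n A" "ideal n A" "\<one>\<^bsub>A\<^esub> \<notin> n"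
proof -
  show max: "maximalideal n A" using assms by (simp add: mSpec_def)
  show I: "ideal n A" using max by (rule maximalideal.axioms)
  show "\<one>\<^bsub>A\<^esub> \<notin> n" using maximalideal.I_notcarr[OF max] ideal.one_imp_carrier[OF I] by blast
qed

text \<open>
  Elements of \<open>T\<close> become units, so the contraction is covered by the members of \<open>S\<close> and hence lies in
  one of them, say \<open>m\<close>.  Maximality of \<open>n\<close> forces \<open>n\<close> to be the extension of \<open>m\<close>.
\<close>

lemma contraction_in_S_set:
  assumes n: "n \<in> mSpec A" shows "contraction n \<in> S_set R M"
proof -
  note nD = mSpec_memD[OF n]
  have sub: "contraction n \<subseteq> \<Union>(S_set R M)"
    using ideal_contraction_disjoint[OF nD(2,3)] by (auto simp: T_eq contraction_def)
  obtain m where m: "m \<in> S_set R M" "contraction n \<subseteq> m"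
    by (rule bexE[OF R.ideal_avoiding_imp_subset_S_set_member[OF fg contraction_ideal[OF nD(2)] sub]])
  note mD = S_set_memD[OF m(1)]
  have "extension m \<noteq> carrier A" using extension_proper[OF mD(3,4)] by auto
  then have "extension m = n"
    using maximalideal.I_maximal[OF nD(1) extension_ideal[OF mD(2)]
        subset_extension_contraction[OF nD(2) m(2)]] ideal.Icarr[OF extension_ideal[OF mD(2)]] by blast
  then have "m \<subseteq> contraction n"
    using in_extensionI[OF mD(2)] ideal.Icarr[OF mD(2)] by (auto simp: contraction_def)
  with m show ?thesis by (simp add: subset_antisym)
qed

lemma S_set_member_is_contraction:
  assumes m: "m \<in> S_set R M" shows "\<exists>n\<in>mSpec A. contraction n = m"
proof -
  note mD = S_set_memD[OF m]
  obtain n where n: "maximalideal n A" "extension m \<subseteq> n"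
    using A.R.proper_ideal_imp_maximalideal[OF extension_ideal[OF mD(2)] extension_proper[OF mD(3,4)]]
    by (elim exE conjE)
  then have nm: "n \<in> mSpec A" by (simp add: mSpec_def)
  have cD: "maximalideal (contraction n) R" "ideal (contraction n) R"
    using S_set_memD[OF contraction_in_S_set[OF nm]] by simp_all
  have "m \<subseteq> contraction n"
    using in_extensionI[OF mD(2)] ideal.Icarr[OF mD(2)] n(2) by (auto simp: contraction_def)
  then have "contraction n = m"
    using maximalideal.I_maximal[OF mD(1) cD(2)] ideal.Icarr[OF cD(2)] maximalideal.I_notcarr[OF cD(1)]
    by blast
  with nm show ?thesis by (rule bexI[rotated])
qed

lemma contraction_inverse:
  assumes n: "n \<in> mSpec A" and s: "s \<in> carrier R" "s \<notin> contraction n"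
  shows "\<exists>b\<in>carrier R. \<one>\<^bsub>A\<^esub> \<ominus>\<^bsub>A\<^esub> \<phi> b \<otimes>\<^bsub>A\<^esub> \<phi> s \<in> n \<and> \<one>\<^bsub>R\<^esub> \<ominus>\<^bsub>R\<^esub> b \<otimes>\<^bsub>R\<^esub> s \<in> contraction n"
proof -
  obtain b where b: "b \<in> carrier R" "\<one>\<^bsub>R\<^esub> \<ominus>\<^bsub>R\<^esub> b \<otimes>\<^bsub>R\<^esub> s \<in> contraction n"
    using R.R.maximalideal_inverse[OF S_set_memD(1)[OF contraction_in_S_set[OF n]] s] by (elim bexE)
  moreover have "\<phi> (\<one>\<^bsub>R\<^esub> \<ominus>\<^bsub>R\<^esub> b \<otimes>\<^bsub>R\<^esub> s) = \<one>\<^bsub>A\<^esub> \<ominus>\<^bsub>A\<^esub> \<phi> b \<otimes>\<^bsub>A\<^esub> \<phi> s"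
    using b(1) s(1) by (simp add: \<phi>_minus \<phi>_mult \<phi>_one)
  ultimately show ?thesis by (intro bexI[of _ b]) (auto simp: contraction_def)
qed

lemma T_notin_contraction: "n \<in> mSpec A \<Longrightarrow> s \<in> T \<Longrightarrow> s \<notin> contraction n"
  using S_set_memD(4)[OF contraction_in_S_set] by blast

text \<open>
  A fraction \<open>a/s\<close> agrees modulo \<open>n\<close> with \<open>b a\<close> for any inverse \<open>b\<close> of \<open>s\<close> modulo the
  contraction of \<open>n\<close>.
\<close>

lemma residue_representative:
  assumes n: "n \<in> mSpec A" and z: "z \<in> carrier A"
  shows "\<exists>c\<in>carrier R. z \<ominus>\<^bsub>A\<^esub> \<phi> c \<in> n"
proof -
  interpret n: ideal n A by (rule mSpec_memD[OF n])
  obtain a s where a: "a \<in> carrier R" "s \<in> T" "\<phi> s \<otimes>\<^bsub>A\<^esub> z = \<phi> a"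
    using ring_frac[OF z] by (elim bexE)
  obtain b where b: "b \<in> carrier R" "\<one>\<^bsub>A\<^esub> \<ominus>\<^bsub>A\<^esub> \<phi> b \<otimes>\<^bsub>A\<^esub> \<phi> s \<in> n"
    using contraction_inverse[OF n T_carrier[OF a(2)] T_notin_contraction[OF n a(2)]] by (elim bexE conjE)
  have "z \<ominus>\<^bsub>A\<^esub> \<phi> (b \<otimes>\<^bsub>R\<^esub> a) = z \<ominus>\<^bsub>A\<^esub> \<phi> b \<otimes>\<^bsub>A\<^esub> (\<phi> s \<otimes>\<^bsub>A\<^esub> z)"
    using a b(1) by (simp add: \<phi>_mult)
  also have "\<dots> = (\<one>\<^bsub>A\<^esub> \<ominus>\<^bsub>A\<^esub> \<phi> b \<otimes>\<^bsub>A\<^esub> \<phi> s) \<otimes>\<^bsub>A\<^esub> z"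
    using a(1,2) b(1) z by (simp add: a_minus_def A.R.l_distr A.R.l_minus A.R.m_assoc)
  also have "\<dots> \<in> n" by (rule n.I_r_closed[OF b(2) z])
  finally show ?thesis using a(1) b(1) by (intro bexI[of _ "b \<otimes>\<^bsub>R\<^esub> a"]) simp_all
qed

definition residue_map :: "'a set \<Rightarrow> 'r set \<Rightarrow> 'a set" where
  "residue_map n P = the_elem ((\<lambda>a. n +>\<^bsub>A\<^esub> \<phi> a) ` P)"

lemma residue_map:
  assumes n: "n \<in> mSpec A"
  shows residue_map_iso: "residue_map n \<in> ring_iso (R Quot contraction n) (A Quot n)"
    and residue_map_coset: "a \<in> carrier R \<Longrightarrow> residue_map n (contraction n +>\<^bsub>R\<^esub> a) = n +>\<^bsub>A\<^esub> \<phi> a"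
proof -
  interpret n: ideal n A by (rule mSpec_memD[OF n])
  interpret m: ideal "contraction n" R by (rule contraction_ideal) (rule n.ideal_axioms)
  let ?h = "\<lambda>a. n +>\<^bsub>A\<^esub> \<phi> a"
  have h: "?h \<in> ring_hom R (A Quot n)"
    using ring_hom_trans[OF \<phi>_hom n.rcos_ring_hom] by (simp add: comp_def)
  have hr: "ring_hom_ring R (A Quot n) ?h"
    by (rule ring_hom_ringI2[OF R.R.ring_axioms n.quotient_is_ring h])
  have ker: "a_kernel R (A Quot n) ?h = contraction n"
  proof -
    have coset: "n +>\<^bsub>A\<^esub> z = n \<longleftrightarrow> z \<in> n" if z: "z \<in> carrier A" for z
    proof
      assume eq: "n +>\<^bsub>A\<^esub> z = n"
      show "z \<in> n" using n.a_rcos_self[OF z] unfolding eq .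
    qed (rule n.a_rcos_const)
    have "\<zero>\<^bsub>A Quot n\<^esub> = n" by (simp add: FactRing_def)
    then show ?thesis
      unfolding a_kernel_def' contraction_def using coset[OF \<phi>_closed] by (simp cong: conj_cong)
  qed
  have eq: "?h a = ?h b \<longleftrightarrow> \<phi> a \<ominus>\<^bsub>A\<^esub> \<phi> b \<in> n" if "a \<in> carrier R" "b \<in> carrier R" for a b
    using A.R.quotient_eq_iff_same_a_r_cos[OF n.ideal_axioms] that by simp
  have "?h ` carrier R = carrier (A Quot n)"
  proof
    show "?h ` carrier R \<subseteq> carrier (A Quot n)" by (auto simp: carrier_FactRing)
    show "carrier (A Quot n) \<subseteq> ?h ` carrier R"
    proof
      fix Z assume "Z \<in> carrier (A Quot n)"
      then obtain z where z: "z \<in> carrier A" "Z = n +>\<^bsub>A\<^esub> z"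
        unfolding carrier_FactRing by (elim CollectE exE conjE)
      obtain c where c: "c \<in> carrier R" "z \<ominus>\<^bsub>A\<^esub> \<phi> c \<in> n" by (rule bexE[OF residue_representative[OF n z(1)]])
      have "Z = ?h c"
        unfolding z(2) using A.R.quotient_eq_iff_same_a_r_cos[OF n.ideal_axioms z(1) \<phi>_closed[OF c(1)]] c(2) by simp
      with c(1) show "Z \<in> ?h ` carrier R" by (rule image_eqI[rotated])
    qed
  qed
  from ring_hom_ring.FactRing_iso_set[OF hr this]
  show "residue_map n \<in> ring_iso (R Quot contraction n) (A Quot n)"
    unfolding ker residue_map_def[abs_def] .
  assume a: "a \<in> carrier R"
  have "?h x = ?h a" if "x \<in> contraction n +>\<^bsub>R\<^esub> a" for x
  proof -
    have x: "x \<in> carrier R" using that a m.a_subset R.R.a_r_coset_subset_G by blast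
    have "x \<ominus>\<^bsub>R\<^esub> a \<in> contraction n"
      unfolding a_minus_def using that by (rule iffD1[OF m.a_rcos_module[OF a x]])
    then have "\<phi> (x \<ominus>\<^bsub>R\<^esub> a) \<in> n" by (rule contractionD)
    then show ?thesis unfolding \<phi>_minus[OF x a] by (rule iffD2[OF eq[OF x a]])
  qed
  moreover have "a \<in> contraction n +>\<^bsub>R\<^esub> a" by (rule m.a_rcos_self[OF a])
  ultimately have "?h ` (contraction n +>\<^bsub>R\<^esub> a) = {?h a}" by blast
  then show "residue_map n (contraction n +>\<^bsub>R\<^esub> a) = ?h a" by (simp add: residue_map_def)
qed

lemma card_residue:
  assumes n: "n \<in> mSpec A"
  shows "|carrier (R Quot contraction n)| =o |carrier (A Quot n)|"
  using card_of_ordIsoI[OF ring_iso_memE(5)[OF residue_map_iso[OF n]]] .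

lemma \<psi>_ideal_smult:
  assumes n: "n \<in> mSpec A" and x: "x \<in> ideal_smult R (contraction n) M"
  shows "\<psi> x \<in> ideal_smult A n N"
proof -
  note I = mSpec_memD(2)[OF n]
  have "ideal_smult R (contraction n) M \<subseteq> {x \<in> carrier M. \<psi> x \<in> ideal_smult A n N}"
    by (rule R.ideal_smult_least[OF submodule_preimage[OF A.ideal_smult_submodule[OF I]]])
      (auto simp: contraction_def \<psi>_smult intro!: A.ideal_smultI[OF I])
  then show ?thesis using x by blast
qed

text \<open>
  Let \<open>m\<close> be the contraction of \<open>n\<close>.  The elements \<open>w/s\<close> with \<open>w \<in> m M\<close> form a submodule of \<open>N\<close> that contains \<open>n N\<close>.  So \<open>x = w/s\<close>, that
  is, \<open>u s x = u w\<close>, and \<open>u s\<close> is invertible modulo \<open>m\<close>.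
\<close>

lemma \<psi>_ideal_smult_reflect:
  assumes n: "n \<in> mSpec A" and x: "x \<in> carrier M" and \<psi>x: "\<psi> x \<in> ideal_smult A n N"
  shows "x \<in> ideal_smult R (contraction n) M"
proof -
  interpret n: ideal n A by (rule mSpec_memD[OF n])
  note mI = S_set_memD(2,3)[OF contraction_in_S_set[OF n]]
  interpret m: primeideal "contraction n" R by (rule mI(2))
  let ?H = "ideal_smult R (contraction n) M"
  note H = R.ideal_smult_submodule[OF mI(1)]
  note Hc = R.submoduleE(1,4,5)[OF H]
  define W where "W = {y \<in> carrier N. \<exists>s\<in>T. \<exists>w\<in>?H. \<phi> s \<odot>\<^bsub>N\<^esub> y = \<psi> w}"
  have WI: "y \<in> W" if "y \<in> carrier N" "s \<in> T" "w \<in> ?H" "\<phi> s \<odot>\<^bsub>N\<^esub> y = \<psi> w" for y s w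
    unfolding W_def using that by (intro CollectI conjI bexI[of _ s] bexI[of _ w])
  have WE: "\<exists>s w. y \<in> carrier N \<and> s \<in> T \<and> w \<in> ?H \<and> w \<in> carrier M \<and> \<phi> s \<odot>\<^bsub>N\<^esub> y = \<psi> w" if "y \<in> W" for y
    using that Hc(1) unfolding W_def by (elim CollectE conjE bexE) (intro exI conjI, auto)
  have "Module.submodule W A N"
  proof (rule A.submodule_criterion)
    show "W \<subseteq> carrier N" by (auto simp: W_def)
    show "\<zero>\<^bsub>N\<^esub> \<in> W"
      by (rule WI[of _ "\<one>\<^bsub>R\<^esub>" "\<zero>\<^bsub>M\<^esub>"]) (use R.submodule_zero[OF H] T_one in \<open>auto simp: \<psi>_zero\<close>)
  next
    fix y y' assume yW: "y \<in> W" "y' \<in> W"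
    obtain s w s' w' where y: "y \<in> carrier N" "s \<in> T" "w \<in> ?H" "w \<in> carrier M" "\<phi> s \<odot>\<^bsub>N\<^esub> y = \<psi> w"
      and y': "y' \<in> carrier N" "s' \<in> T" "w' \<in> ?H" "w' \<in> carrier M" "\<phi> s' \<odot>\<^bsub>N\<^esub> y' = \<psi> w'"
      using WE[OF yW(1)] WE[OF yW(2)] by (elim exE conjE)
    have "\<phi> (s \<otimes>\<^bsub>R\<^esub> s') \<odot>\<^bsub>N\<^esub> (y \<oplus>\<^bsub>N\<^esub> y')
        = \<phi> s' \<odot>\<^bsub>N\<^esub> (\<phi> s \<odot>\<^bsub>N\<^esub> y) \<oplus>\<^bsub>N\<^esub> \<phi> s \<odot>\<^bsub>N\<^esub> (\<phi> s' \<odot>\<^bsub>N\<^esub> y')"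
      using y(1,2) y'(1,2) by (simp add: \<phi>_mult A.smult_r_distr A.smult_assoc1[symmetric] A.R.m_comm)
    also have "\<dots> = \<psi> (s' \<odot>\<^bsub>M\<^esub> w \<oplus>\<^bsub>M\<^esub> s \<odot>\<^bsub>M\<^esub> w')"
      using y y' by (simp add: \<psi>_add \<psi>_smult)
    finally show "y \<oplus>\<^bsub>N\<^esub> y' \<in> W"
      using y y' T_mult Hc by (intro WI[of _ "s \<otimes>\<^bsub>R\<^esub> s'" "s' \<odot>\<^bsub>M\<^esub> w \<oplus>\<^bsub>M\<^esub> s \<odot>\<^bsub>M\<^esub> w'"]) simp_all
  next
    fix z y assume z: "z \<in> carrier A" and yW: "y \<in> W"
    obtain s w where y: "y \<in> carrier N" "s \<in> T" "w \<in> ?H" "w \<in> carrier M" "\<phi> s \<odot>\<^bsub>N\<^esub> y = \<psi> w"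
      using WE[OF yW] by (elim exE conjE)
    obtain a t where a: "a \<in> carrier R" "t \<in> T" "\<phi> t \<otimes>\<^bsub>A\<^esub> z = \<phi> a"
      using ring_frac[OF z] by (elim bexE)
    have "\<phi> (s \<otimes>\<^bsub>R\<^esub> t) \<odot>\<^bsub>N\<^esub> (z \<odot>\<^bsub>N\<^esub> y) = (\<phi> t \<otimes>\<^bsub>A\<^esub> z) \<odot>\<^bsub>N\<^esub> (\<phi> s \<odot>\<^bsub>N\<^esub> y)"
      using y(1,2) a(1,2) z by (simp add: \<phi>_mult A.smult_assoc1[symmetric] A.R.m_ac)
    also have "\<dots> = \<psi> (a \<odot>\<^bsub>M\<^esub> w)" using y a by (simp add: \<psi>_smult)
    finally show "z \<odot>\<^bsub>N\<^esub> y \<in> W"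
      using y a z T_mult Hc by (intro WI[of _ "s \<otimes>\<^bsub>R\<^esub> t" "a \<odot>\<^bsub>M\<^esub> w"]) simp_all
  qed
  then have sub: "ideal_smult A n N \<subseteq> W"
  proof (rule A.ideal_smult_least)
    fix z y assume z: "z \<in> n" and y: "y \<in> carrier N"
    obtain a s where a: "a \<in> carrier R" "s \<in> T" "\<phi> s \<otimes>\<^bsub>A\<^esub> z = \<phi> a"
      using ring_frac[OF n.Icarr[OF z]] by (elim bexE)
    have "\<phi> a \<in> n" using n.I_l_closed[OF z \<phi>_closed[OF T_carrier[OF a(2)]]] unfolding a(3) .
    then have am: "a \<in> contraction n" by (rule contractionI[OF a(1)])
    obtain x t where x: "x \<in> carrier M" "t \<in> T" "\<phi> t \<odot>\<^bsub>N\<^esub> y = \<psi> x"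
      using mod_frac[OF y] by (elim bexE)
    have "\<phi> (s \<otimes>\<^bsub>R\<^esub> t) \<odot>\<^bsub>N\<^esub> (z \<odot>\<^bsub>N\<^esub> y) = (\<phi> s \<otimes>\<^bsub>A\<^esub> z) \<odot>\<^bsub>N\<^esub> (\<phi> t \<odot>\<^bsub>N\<^esub> y)"
      using y x(1,2) a(1,2) n.Icarr[OF z] by (simp add: \<phi>_mult A.smult_assoc1[symmetric] A.R.m_ac)
    also have "\<dots> = \<psi> (a \<odot>\<^bsub>M\<^esub> x)" using x a by (simp add: \<psi>_smult)
    finally show "z \<odot>\<^bsub>N\<^esub> y \<in> W"
      using y a x n.Icarr[OF z] T_mult R.ideal_smultI[OF mI(1) am x(1)]
      by (intro WI[of _ "s \<otimes>\<^bsub>R\<^esub> t" "a \<odot>\<^bsub>M\<^esub> x"]) simp_all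
  qed
  obtain s w where s: "s \<in> T" and w: "w \<in> ?H" "w \<in> carrier M" and "\<phi> s \<odot>\<^bsub>N\<^esub> \<psi> x = \<psi> w"
    using WE[OF subsetD[OF sub \<psi>x]] by (elim exE conjE)
  then have \<psi>0: "\<psi> (s \<odot>\<^bsub>M\<^esub> x \<ominus>\<^bsub>M\<^esub> w) = \<zero>\<^bsub>N\<^esub>"
    using x by (subst \<psi>_minus) (simp_all add: \<psi>_smult a_minus_def A.M.r_neg)
  have "s \<odot>\<^bsub>M\<^esub> x \<ominus>\<^bsub>M\<^esub> w \<in> carrier M" using s w x by simp
  from mod_ker[OF this \<psi>0] obtain u
    where u: "u \<in> T" "u \<odot>\<^bsub>M\<^esub> (s \<odot>\<^bsub>M\<^esub> x \<ominus>\<^bsub>M\<^esub> w) = \<zero>\<^bsub>M\<^esub>" by (elim bexE)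
  have us: "u \<otimes>\<^bsub>R\<^esub> s \<in> T" using T_mult u s by blast
  have usx: "(u \<otimes>\<^bsub>R\<^esub> s) \<odot>\<^bsub>M\<^esub> x = u \<odot>\<^bsub>M\<^esub> w"
  proof -
    have "(u \<otimes>\<^bsub>R\<^esub> s) \<odot>\<^bsub>M\<^esub> x \<ominus>\<^bsub>M\<^esub> u \<odot>\<^bsub>M\<^esub> w = \<zero>\<^bsub>M\<^esub>"
      using u s w x by (simp add: R.smult_minus_distr R.smult_assoc1)
    then show ?thesis by (rule R.eq_if_minus_zero[rotated 2]) (use u s w x in simp_all)
  qed
  obtain b where b: "b \<in> carrier R" "\<one>\<^bsub>R\<^esub> \<ominus>\<^bsub>R\<^esub> b \<otimes>\<^bsub>R\<^esub> (u \<otimes>\<^bsub>R\<^esub> s) \<in> contraction n"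
    using contraction_inverse[OF n T_carrier[OF us] T_notin_contraction[OF n us]] by (elim bexE conjE)
  have "(\<one>\<^bsub>R\<^esub> \<ominus>\<^bsub>R\<^esub> b \<otimes>\<^bsub>R\<^esub> (u \<otimes>\<^bsub>R\<^esub> s)) \<odot>\<^bsub>M\<^esub> x \<oplus>\<^bsub>M\<^esub> b \<odot>\<^bsub>M\<^esub> (u \<odot>\<^bsub>M\<^esub> w) \<in> ?H"
    using Hc(2,3) R.ideal_smultI[OF mI(1) b(2) x] b(1) u(1) w(1) by simp
  also have "(\<one>\<^bsub>R\<^esub> \<ominus>\<^bsub>R\<^esub> b \<otimes>\<^bsub>R\<^esub> (u \<otimes>\<^bsub>R\<^esub> s)) \<odot>\<^bsub>M\<^esub> x \<oplus>\<^bsub>M\<^esub> b \<odot>\<^bsub>M\<^esub> (u \<odot>\<^bsub>M\<^esub> w) = x"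
    unfolding usx[symmetric] using b(1) u(1) s x
    by (simp add: R.minus_smult_distr R.smult_assoc1 R.minus_add_cancel)
  finally show ?thesis .
qed

text \<open>
  A generator of the fibre of \<open>N\<close> at \<open>n\<close> can be taken from the image of \<open>M\<close> and coefficients can be
  taken from \<open>R\<close>; by reflection it generates the fibre of \<open>M\<close> at the contraction, whose
  dimension is at least two.
\<close>

lemma mSpec_subset_S_set:
  assumes n: "n \<in> mSpec A" shows "n \<in> S_set A N"
proof (rule ccontr)
  note fgN = finitely_generated_localization[OF fg]
  note I = mSpec_memD(1,2)[OF n]
  interpret n: ideal n A by (rule I)
  note H = A.ideal_smult_submodule[OF I(2)]
  note mS = contraction_in_S_set[OF n]
  assume "n \<notin> S_set A N"
  then have "\<exists>y\<in>carrier N. \<forall>x\<in>carrier N. \<exists>r\<in>carrier A. x \<ominus>\<^bsub>N\<^esub> r \<odot>\<^bsub>N\<^esub> y \<in> ideal_smult A n N"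
    using A.mem_S_set_iff[OF fgN I(1)] by (rule_tac ccontr) simp
  then obtain y where y: "y \<in> carrier N"
    and gen: "\<forall>x\<in>carrier N. \<exists>r\<in>carrier A. x \<ominus>\<^bsub>N\<^esub> r \<odot>\<^bsub>N\<^esub> y \<in> ideal_smult A n N" by (elim bexE)
  obtain y0 t where y0: "y0 \<in> carrier M" "t \<in> T" "\<phi> t \<odot>\<^bsub>N\<^esub> y = \<psi> y0"
    using mod_frac[OF y] by (elim bexE)
  obtain i where i: "i \<in> carrier A" "i \<otimes>\<^bsub>A\<^esub> \<phi> t = \<one>\<^bsub>A\<^esub>" by (rule bexE[OF \<phi>_unit[OF y0(2)]])
  have y_eq: "y = i \<odot>\<^bsub>N\<^esub> \<psi> y0"
    using i y y0(2) by (simp add: y0(3)[symmetric] A.smult_assoc1[symmetric])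
  have "\<exists>r\<in>carrier R. x \<ominus>\<^bsub>M\<^esub> r \<odot>\<^bsub>M\<^esub> y0 \<in> ideal_smult R (contraction n) M" if x: "x \<in> carrier M" for x
  proof -
    obtain r where r: "r \<in> carrier A" "\<psi> x \<ominus>\<^bsub>N\<^esub> r \<odot>\<^bsub>N\<^esub> y \<in> ideal_smult A n N"
      by (rule bexE[OF bspec[OF gen \<psi>_closed[OF x]]])
    obtain c where c: "c \<in> carrier R" "r \<otimes>\<^bsub>A\<^esub> i \<ominus>\<^bsub>A\<^esub> \<phi> c \<in> n"
      by (rule bexE[OF residue_representative[OF n A.R.m_closed[OF r(1) i(1)]]])
    have "(\<psi> x \<ominus>\<^bsub>N\<^esub> (r \<otimes>\<^bsub>A\<^esub> i) \<odot>\<^bsub>N\<^esub> \<psi> y0) \<oplus>\<^bsub>N\<^esub> (r \<otimes>\<^bsub>A\<^esub> i \<ominus>\<^bsub>A\<^esub> \<phi> c) \<odot>\<^bsub>N\<^esub> \<psi> y0 \<in> ideal_smult A n N"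
      using A.submoduleE(5)[OF H r(2) A.ideal_smultI[OF I(2) c(2) \<psi>_closed[OF y0(1)]]] r(1) i(1) y0(1)
      by (simp add: y_eq A.smult_assoc1)
    also have "(\<psi> x \<ominus>\<^bsub>N\<^esub> (r \<otimes>\<^bsub>A\<^esub> i) \<odot>\<^bsub>N\<^esub> \<psi> y0) \<oplus>\<^bsub>N\<^esub> (r \<otimes>\<^bsub>A\<^esub> i \<ominus>\<^bsub>A\<^esub> \<phi> c) \<odot>\<^bsub>N\<^esub> \<psi> y0
        = \<psi> (x \<ominus>\<^bsub>M\<^esub> c \<odot>\<^bsub>M\<^esub> y0)"
      using x y0(1) r(1) i(1) c(1)
      by (simp add: A.minus_smult_distr A.minus_add_minus \<psi>_minus \<psi>_smult)
    finally have "x \<ominus>\<^bsub>M\<^esub> c \<odot>\<^bsub>M\<^esub> y0 \<in> ideal_smult R (contraction n) M"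
      using x y0(1) c(1) by (intro \<psi>_ideal_smult_reflect[OF n]) simp_all
    with c(1) show ?thesis by (rule bexI[rotated])
  qed
  then have "\<exists>y\<in>carrier M. \<forall>x\<in>carrier M. \<exists>r\<in>carrier R. x \<ominus>\<^bsub>M\<^esub> r \<odot>\<^bsub>M\<^esub> y \<in> ideal_smult R (contraction n) M"
    by (intro bexI[OF _ y0(1)] ballI)
  with iffD1[OF R.mem_S_set_iff[OF fg S_set_memD(1)[OF mS]] mS] show False by (rule notE)
qed

text \<open>
  The fibre of \<open>M\<close> at the contraction maps semilinearly to the fibre of \<open>N\<close>, over the isomorphism
  of residue fields.  Composing a linear functional with this map and with the inverse
  isomorphism gives a linear functional; constants, sums and products are immediate.
\<close>

lemma regular_function_pullback:
  assumes n: "n \<in> mSpec A" and g: "g \<in> regular_functions (A Quot n) (fibre A N n)"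
  shows "\<exists>g'\<in>regular_functions (R Quot contraction n) (fibre R M (contraction n)).
    \<forall>x\<in>carrier M. residue_map n (g' (ideal_smult R (contraction n) M +>\<^bsub>M\<^esub> x))
      = g (ideal_smult A n N +>\<^bsub>N\<^esub> \<psi> x)"
proof -
  let ?m = "contraction n"
  let ?K = "R Quot ?m" and ?V = "fibre R M ?m" and ?K' = "A Quot n" and ?V' = "fibre A N n"
  let ?p = "\<lambda>x. ideal_smult R ?m M +>\<^bsub>M\<^esub> x" and ?p' = "\<lambda>x. ideal_smult A n N +>\<^bsub>N\<^esub> x"
  note I = mSpec_memD(1,2)[OF n] and mI = S_set_memD(1,2)[OF contraction_in_S_set[OF n]]
  interpret V: vectorspace ?K ?V by (rule R.fibre_vectorspace[OF mI(1)])
  interpret V': vectorspace ?K' ?V' by (rule A.fibre_vectorspace[OF I(1)])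
  note \<theta> = ring_iso_memE[OF residue_map_iso[OF n]]
  have inj: "inj_on (residue_map n) (carrier ?K)" and surj: "residue_map n ` carrier ?K = carrier ?K'"
    using \<theta>(5) by (auto simp: bij_betw_def)
  let ?\<theta>' = "inv_into (carrier ?K) (residue_map n)"
  have \<theta>': "?\<theta>' c \<in> carrier ?K" "residue_map n (?\<theta>' c) = c" if "c \<in> carrier ?K'" for c
    using that unfolding surj[symmetric] by (simp_all add: inv_into_into f_inv_into_f)
  have \<theta>'_eq: "?\<theta>' c = d" if "d \<in> carrier ?K" "residue_map n d = c" for c d
    using inv_into_f_eq[OF inj that] .
  have gc: "g' (?p x) \<in> carrier ?K" if "g' \<in> regular_functions ?K ?V" "x \<in> carrier M" for g' x
    using V.regular_function_closed[OF that(1) R.fibre_carrierI[OF that(2)]] .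
  show ?thesis
    using g
  proof induction
    case (const c)
    show ?case
      by (rule bexI[OF _ regular_functions.const[OF \<theta>'(1)[OF const]]]) (simp add: \<theta>'(2)[OF const])
  next
    case (add g h)
    then obtain g' h' where gh: "g' \<in> regular_functions ?K ?V" "h' \<in> regular_functions ?K ?V"
      "\<forall>x\<in>carrier M. residue_map n (g' (?p x)) = g (?p' (\<psi> x))"
      "\<forall>x\<in>carrier M. residue_map n (h' (?p x)) = h (?p' (\<psi> x))" by (elim bexE)
    then show ?case
      by (intro bexI[OF _ regular_functions.add[OF gh(1,2)]]) (simp add: \<theta>(3) gc)
  next
    case (mult g h)
    then obtain g' h' where gh: "g' \<in> regular_functions ?K ?V" "h' \<in> regular_functions ?K ?V"
      "\<forall>x\<in>carrier M. residue_map n (g' (?p x)) = g (?p' (\<psi> x))"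
      "\<forall>x\<in>carrier M. residue_map n (h' (?p x)) = h (?p' (\<psi> x))" by (elim bexE)
    then show ?case
      by (intro bexI[OF _ regular_functions.mult[OF gh(1,2)]]) (simp add: \<theta>(2) gc)
  next
    case (linear f)
    define rep where "rep v = (SOME x. x \<in> carrier M \<and> ?p x = v)" for v
    \<comment> \<open>The functional read on an arbitrary representative in \<open>M\<close>.\<close>
  define g' where "g' v = ?\<theta>' (f (?p' (\<psi> (rep v))))" for v
    have rep: "rep v \<in> carrier M" "?p (rep v) = v" if "v \<in> carrier ?V" for v
    proof -
      have "\<exists>x. x \<in> carrier M \<and> ?p x = v" using that by (auto simp: R.fibre_carrier)
      from someI_ex[OF this] show "rep v \<in> carrier M" "?p (rep v) = v" by (simp_all add: rep_def)
    qed
    have p'_eq: "?p' (\<psi> (rep (?p x))) = ?p' (\<psi> x)" if x: "x \<in> carrier M" for x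
    proof -
      note r = rep[OF R.fibre_carrierI[OF x]]
      have "rep (?p x) \<ominus>\<^bsub>M\<^esub> x \<in> ideal_smult R ?m M"
        using R.fibre_coset_eq_iff[OF mI(2) r(1) x] r(2) by simp
      from \<psi>_ideal_smult[OF n this] show ?thesis
        using A.fibre_coset_eq_iff[OF I(2), of "\<psi> (rep (?p x))" "\<psi> x"] r(1) x by (simp add: \<psi>_minus)
    qed
    have fc: "f (?p' (\<psi> x)) \<in> carrier ?K'" if "x \<in> carrier M" for x
      using linear A.fibre_carrierI[OF \<psi>_closed[OF that]] by (auto simp: linear_functional_def)
    have g': "g' (?p x) \<in> carrier ?K" "residue_map n (g' (?p x)) = f (?p' (\<psi> x))" if "x \<in> carrier M" for x
      using \<theta>'[OF fc[OF that]] by (simp_all add: g'_def p'_eq[OF that])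
    have eqI: "g' (?p x) = d" if "x \<in> carrier M" "d \<in> carrier ?K" "residue_map n d = f (?p' (\<psi> x))" for x d
      using \<theta>'_eq[OF that(2,3)] by (simp add: g'_def p'_eq[OF that(1)])
    have f_add: "f (v \<oplus>\<^bsub>?V'\<^esub> w) = f v \<oplus>\<^bsub>?K'\<^esub> f w" if "v \<in> carrier ?V'" "w \<in> carrier ?V'" for v w
      using linear that by (simp add: linear_functional_def)
    have f_smult: "f (a \<odot>\<^bsub>?V'\<^esub> v) = a \<otimes>\<^bsub>?K'\<^esub> f v" if "a \<in> carrier ?K'" "v \<in> carrier ?V'" for a v
      using linear that by (simp add: linear_functional_def)
    have "linear_functional ?K ?V g'"
      unfolding linear_functional_def
    proof (intro conjI ballI)
      show "g' \<in> carrier ?V \<rightarrow> carrier ?K" using g'(1) by (auto simp: R.fibre_carrier)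
    next
      fix v w assume "v \<in> carrier ?V" "w \<in> carrier ?V"
      then obtain x y where x: "x \<in> carrier M" "v = ?p x" and y: "y \<in> carrier M" "w = ?p y"
        unfolding R.fibre_carrier by (elim CollectE exE conjE)
      have "g' (?p (x \<oplus>\<^bsub>M\<^esub> y)) = g' (?p x) \<oplus>\<^bsub>?K\<^esub> g' (?p y)"
      proof (rule eqI)
        show "residue_map n (g' (?p x) \<oplus>\<^bsub>?K\<^esub> g' (?p y)) = f (?p' (\<psi> (x \<oplus>\<^bsub>M\<^esub> y)))"
          using x(1) y(1) by (simp add: \<theta>(3) g' \<psi>_add A.fibre_add[OF I(2), symmetric] f_add)
      qed (use x y g'(1) in auto)
      then show "g' (v \<oplus>\<^bsub>?V\<^esub> w) = g' v \<oplus>\<^bsub>?K\<^esub> g' w"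
        using x y by (simp add: R.fibre_add[OF mI(2)])
    next
      fix a v assume "a \<in> carrier ?K" "v \<in> carrier ?V"
      then obtain b x where a: "b \<in> carrier R" "a = ?m +>\<^bsub>R\<^esub> b" and x: "x \<in> carrier M" "v = ?p x"
        unfolding R.fibre_carrier carrier_FactRing by (elim CollectE exE conjE)
      have ac: "a \<in> carrier ?K" using a unfolding carrier_FactRing by blast
      have bc: "n +>\<^bsub>A\<^esub> \<phi> b \<in> carrier ?K'" using a(1) \<phi>_closed unfolding carrier_FactRing by blast
      have "g' (?p (b \<odot>\<^bsub>M\<^esub> x)) = a \<otimes>\<^bsub>?K\<^esub> g' (?p x)"
      proof (rule eqI)
        have "residue_map n (a \<otimes>\<^bsub>?K\<^esub> g' (?p x)) = (n +>\<^bsub>A\<^esub> \<phi> b) \<otimes>\<^bsub>?K'\<^esub> f (?p' (\<psi> x))"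
          using x(1) ac a by (simp add: \<theta>(2) g' residue_map_coset[OF n])
        also have "\<dots> = f (?p' (\<psi> (b \<odot>\<^bsub>M\<^esub> x)))"
          using x(1) a(1) bc by (simp add: f_smult[symmetric] \<psi>_smult A.fibre_smult[OF I(2)])
        finally show "residue_map n (a \<otimes>\<^bsub>?K\<^esub> g' (?p x)) = f (?p' (\<psi> (b \<odot>\<^bsub>M\<^esub> x)))" .
      qed (use x a ac g'(1) in auto)
      then show "g' (a \<odot>\<^bsub>?V\<^esub> v) = a \<otimes>\<^bsub>?K\<^esub> g' v"
        using x a by (simp add: R.fibre_smult[OF mI(2)])
    qed
    then show ?case
      using g'(2) by (intro bexI[OF _ regular_functions.linear]) auto
  qed
qed

lemma \<psi>_continuous: "continuous_map (induced_zariski R M) (induced_zariski A N) \<psi>"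
proof (rule A.continuous_map_into_induced_zariskiI)
  show "\<psi> x \<in> carrier N" if "x \<in> topspace (induced_zariski R M)" for x
    using that by (simp add: R.topspace_induced_zariski[OF fg])
  fix n assume n: "n \<in> mSpec A"
  let ?m = "contraction n"
  let ?K = "R Quot ?m" and ?V = "fibre R M ?m" and ?K' = "A Quot n" and ?V' = "fibre A N n"
  let ?p = "\<lambda>x. ideal_smult R ?m M +>\<^bsub>M\<^esub> x" and ?p' = "\<lambda>x. ideal_smult A n N +>\<^bsub>N\<^esub> x"
  note I = mSpec_memD(1,2)[OF n] and mS = contraction_in_S_set[OF n]
  note mI = S_set_memD(1,2)[OF mS] and fgN = finitely_generated_localization[OF fg]
  interpret V: vectorspace ?K ?V by (rule R.fibre_vectorspace[OF mI(1)])
  interpret V': vectorspace ?K' ?V' by (rule A.fibre_vectorspace[OF I(1)])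
  interpret \<theta>: ring_hom_ring ?K ?K' "residue_map n"
    using residue_map_iso[OF n] by (intro ring_hom_ringI2 V.R.ring_axioms V'.R.ring_axioms) (simp add: ring_iso_def)
  have inj: "inj_on (residue_map n) (carrier ?K)"
    using ring_iso_memE(5)[OF residue_map_iso[OF n]] by (simp add: bij_betw_def)
  have mM: "?m \<in> mSpec R" using mS S_set_subset_mSpec by blast
  show "continuous_map (induced_zariski R M) (fibre_topology A N n) (\<lambda>x. ?p' (\<psi> x))"
    unfolding continuous_map_closedin
  proof (intro conjI allI impI)
    show "(\<lambda>x. ?p' (\<psi> x)) \<in> topspace (induced_zariski R M) \<rightarrow> topspace (fibre_topology A N n)"
      by (auto simp: R.topspace_induced_zariski[OF fg] A.topspace_fibre_topology[OF fgN n])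
    fix C assume "closedin (fibre_topology A N n) C"
    then have "closedin (zariski_topology ?K' ?V') C"
      unfolding fibre_topology_def if_P[OF mSpec_subset_S_set[OF n]] .
    then obtain F where F: "F \<subseteq> regular_functions ?K' ?V'"
      and C: "C = {v \<in> carrier ?V'. \<forall>f\<in>F. f v = \<zero>\<^bsub>?K'\<^esub>}"
      unfolding V'.closedin_zariski[OF A.fibre_fin_dim[OF fgN I(1)]] by (elim exE conjE)
    define F' where "F' = {g' \<in> regular_functions ?K ?V. \<exists>g\<in>F. \<forall>x\<in>carrier M. residue_map n (g' (?p x)) = g (?p' (\<psi> x))}"
    have cl: "closedin (fibre_topology R M ?m) {v \<in> carrier ?V. \<forall>f\<in>F'. f v = \<zero>\<^bsub>?K\<^esub>}"
      unfolding fibre_topology_def if_P[OF mS]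
      by (rule V.closedin_zeros[OF R.fibre_fin_dim[OF fg mI(1)]]) (auto simp: F'_def)
    have zero_iff: "g' (?p x) = \<zero>\<^bsub>?K\<^esub> \<longleftrightarrow> residue_map n (g' (?p x)) = \<zero>\<^bsub>?K'\<^esub>"
      if "g' \<in> regular_functions ?K ?V" "x \<in> carrier M" for g' x
      using inj_onD[OF inj, of "g' (?p x)" "\<zero>\<^bsub>?K\<^esub>"] V.regular_function_closed[OF that(1) R.fibre_carrierI[OF that(2)]]
      by auto
    have "{x \<in> carrier M. ?p x \<in> {v \<in> carrier ?V. \<forall>f\<in>F'. f v = \<zero>\<^bsub>?K\<^esub>}}
        = {x \<in> carrier M. ?p' (\<psi> x) \<in> C}"
    proof (intro Collect_cong conj_cong refl)
      fix x assume x: "x \<in> carrier M"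
      have "(\<forall>f\<in>F'. f (?p x) = \<zero>\<^bsub>?K\<^esub>) \<longleftrightarrow> (\<forall>f\<in>F. f (?p' (\<psi> x)) = \<zero>\<^bsub>?K'\<^esub>)"
      proof (intro iffI ballI)
        fix g assume F'0: "\<forall>f\<in>F'. f (?p x) = \<zero>\<^bsub>?K\<^esub>" and g: "g \<in> F"
        obtain g' where g': "g' \<in> regular_functions ?K ?V"
          "\<forall>x\<in>carrier M. residue_map n (g' (?p x)) = g (?p' (\<psi> x))"
          by (rule bexE[OF regular_function_pullback[OF n subsetD[OF F g]]])
        then have "g' \<in> F'" unfolding F'_def using g by (intro CollectI conjI bexI[of _ g])
        with F'0 have "g' (?p x) = \<zero>\<^bsub>?K\<^esub>" by (rule bspec)
        then show "g (?p' (\<psi> x)) = \<zero>\<^bsub>?K'\<^esub>" using g'(2) x zero_iff[OF g'(1) x] by simp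
      next
        fix g' assume F0: "\<forall>f\<in>F. f (?p' (\<psi> x)) = \<zero>\<^bsub>?K'\<^esub>" and "g' \<in> F'"
        then obtain g where g: "g' \<in> regular_functions ?K ?V" "g \<in> F"
          "\<forall>x\<in>carrier M. residue_map n (g' (?p x)) = g (?p' (\<psi> x))"
          unfolding F'_def by (elim CollectE conjE bexE)
        then show "g' (?p x) = \<zero>\<^bsub>?K\<^esub>" using zero_iff[OF g(1) x] F0 x by simp
      qed
      then show "?p x \<in> {v \<in> carrier ?V. \<forall>f\<in>F'. f v = \<zero>\<^bsub>?K\<^esub>} \<longleftrightarrow> ?p' (\<psi> x) \<in> C"
        using x by (simp add: C)
    qed
    with closedin_continuous_map_preimage[OF R.continuous_map_fibre[OF mM] cl]
    show "closedin (induced_zariski R M) {x \<in> topspace (induced_zariski R M). ?p' (\<psi> x) \<in> C}"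
      by (simp add: R.topspace_induced_zariski[OF fg])
  qed
qed

text \<open>
  If \<open>b\<close> and \<open>c\<close> invert \<open>s\<close> modulo \<open>J\<close> and modulo \<open>n\<close>, then \<open>d = b + c - b c s\<close> does both, since
  \<open>1 - d s = (1 - b s) (1 - c s)\<close>.
\<close>

lemma simultaneous_inverse:
  assumes "finite J" "J \<subseteq> mSpec A" and s: "s \<in> T"
  shows "\<exists>b\<in>carrier R. \<forall>n\<in>J. \<one>\<^bsub>R\<^esub> \<ominus>\<^bsub>R\<^esub> b \<otimes>\<^bsub>R\<^esub> s \<in> contraction n"
  using assms(1,2)
proof induction
  case empty
  then show ?case using R.R.zero_closed by blast
next
  case (insert n J)
  then obtain b where b: "b \<in> carrier R" "\<forall>n\<in>J. \<one>\<^bsub>R\<^esub> \<ominus>\<^bsub>R\<^esub> b \<otimes>\<^bsub>R\<^esub> s \<in> contraction n" by auto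
  have n: "n \<in> mSpec A" using insert.prems by simp
  have sc: "s \<in> carrier R" using s by simp
  obtain c where c: "c \<in> carrier R" "\<one>\<^bsub>R\<^esub> \<ominus>\<^bsub>R\<^esub> c \<otimes>\<^bsub>R\<^esub> s \<in> contraction n"
    using contraction_inverse[OF n sc T_notin_contraction[OF n s]] by (elim bexE conjE)
  define d where "d = b \<oplus>\<^bsub>R\<^esub> c \<ominus>\<^bsub>R\<^esub> b \<otimes>\<^bsub>R\<^esub> c \<otimes>\<^bsub>R\<^esub> s"
  have d: "d \<in> carrier R" using b c sc by (simp add: d_def)
  have eq: "\<one>\<^bsub>R\<^esub> \<ominus>\<^bsub>R\<^esub> d \<otimes>\<^bsub>R\<^esub> s = (\<one>\<^bsub>R\<^esub> \<ominus>\<^bsub>R\<^esub> b \<otimes>\<^bsub>R\<^esub> s) \<otimes>\<^bsub>R\<^esub> (\<one>\<^bsub>R\<^esub> \<ominus>\<^bsub>R\<^esub> c \<otimes>\<^bsub>R\<^esub> s)"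
    using b(1) c(1) sc unfolding d_def by algebra
  have "\<one>\<^bsub>R\<^esub> \<ominus>\<^bsub>R\<^esub> d \<otimes>\<^bsub>R\<^esub> s \<in> contraction k" if k: "k \<in> insert n J" for k
  proof -
    have "k \<in> mSpec A" using k insert.prems by blast
    then have "ideal (contraction k) R" by (rule contraction_ideal[OF mSpec_memD(2)])
    then interpret k: ideal "contraction k" R .
    show ?thesis
    proof (cases "k = n")
      case True
      then show ?thesis unfolding eq using c b(1) sc by (intro k.I_l_closed) auto
    next
      case False
      then show ?thesis unfolding eq using c(1) b k sc by (intro k.I_r_closed) auto
    qed
  qed
  then show ?case by (intro bexI[OF _ d] ballI)
qed

text \<open>
  A point \<open>z = x/s\<close> outside \<open>C\<close> has a neighbourhood that avoids \<open>C\<close> and restricts only the fibres at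
  a finite set \<open>J\<close>.  With \<open>b s = 1\<close> modulo all members of \<open>J\<close>, the image of \<open>b x\<close> has the same classes
  as \<open>z\<close> there.
\<close>

lemma \<psi>_dense:
  assumes C: "closedin (induced_zariski A N) C" and sub: "\<And>x. x \<in> carrier M \<Longrightarrow> \<psi> x \<in> C"
  shows "C = carrier N"
proof (rule ccontr)
  note fgN = finitely_generated_localization[OF fg]
  note top = A.topspace_induced_zariski[OF fgN]
  assume "C \<noteq> carrier N"
  then obtain z where z: "z \<in> carrier N" "z \<notin> C" using closedin_subset[OF C] top by auto
  have U: "openin (induced_zariski A N) (carrier N - C)" using C top by (simp add: closedin_def)
  obtain J where J: "finite J" "J \<subseteq> mSpec A"
    "\<forall>w\<in>carrier N. (\<forall>n\<in>J. ideal_smult A n N +>\<^bsub>N\<^esub> w = ideal_smult A n N +>\<^bsub>N\<^esub> z) \<longrightarrow> w \<in> carrier N - C"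
    using A.induced_zariski_open_locality[OF fgN U DiffI[OF z]] by (elim exE conjE)
  obtain x s where x: "x \<in> carrier M" "s \<in> T" "\<phi> s \<odot>\<^bsub>N\<^esub> z = \<psi> x"
    using mod_frac[OF z(1)] by (elim bexE)
  obtain b where b: "b \<in> carrier R" "\<forall>n\<in>J. \<one>\<^bsub>R\<^esub> \<ominus>\<^bsub>R\<^esub> b \<otimes>\<^bsub>R\<^esub> s \<in> contraction n"
    by (rule bexE[OF simultaneous_inverse[OF J(1,2) x(2)]])
  have "ideal_smult A n N +>\<^bsub>N\<^esub> \<psi> (b \<odot>\<^bsub>M\<^esub> x) = ideal_smult A n N +>\<^bsub>N\<^esub> z" if n: "n \<in> J" for n
  proof -
    have I: "ideal n A" using n J(2) mSpec_memD(2) by blast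
    have "\<phi> (\<one>\<^bsub>R\<^esub> \<ominus>\<^bsub>R\<^esub> b \<otimes>\<^bsub>R\<^esub> s) \<in> n" using b(2) n by (blast intro: contractionD)
    from A.ideal_smultI[OF I this z(1)]
    have "z \<ominus>\<^bsub>N\<^esub> \<phi> b \<odot>\<^bsub>N\<^esub> (\<phi> s \<odot>\<^bsub>N\<^esub> z) \<in> ideal_smult A n N"
      using b(1) x(2) z(1) by (simp add: \<phi>_minus \<phi>_mult \<phi>_one A.minus_smult_distr A.smult_assoc1)
    then have "z \<ominus>\<^bsub>N\<^esub> \<psi> (b \<odot>\<^bsub>M\<^esub> x) \<in> ideal_smult A n N"
      using b(1) x by (simp add: \<psi>_smult)
    then show ?thesis using A.fibre_coset_eq_iff[OF I z(1), of "\<psi> (b \<odot>\<^bsub>M\<^esub> x)"] b(1) x(1) by simp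
  qed
  moreover have "\<psi> (b \<odot>\<^bsub>M\<^esub> x) \<in> carrier N" using b(1) x(1) by simp
  ultimately have "\<psi> (b \<odot>\<^bsub>M\<^esub> x) \<in> carrier N - C" using J(3) by blast
  then show False using sub[of "b \<odot>\<^bsub>M\<^esub> x"] b(1) x(1) by simp
qed

lemma sigma_tau_lower_bound:
  assumes \<kappa>: "is_sigma_tau R M \<kappa>"
    and F: "\<forall>C\<in>\<F>. closedin (induced_zariski A N) C \<and> C \<noteq> carrier N" "\<Union>\<F> = carrier N"
  shows "\<kappa> \<le>o |\<F>|"
proof -
  let ?pre = "\<lambda>C. {x \<in> carrier M. \<psi> x \<in> C}"
  have "closedin (induced_zariski R M) (?pre C) \<and> ?pre C \<noteq> carrier M" if "C \<in> \<F>" for C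
  proof
    show "closedin (induced_zariski R M) (?pre C)"
      using closedin_continuous_map_preimage[OF \<psi>_continuous, of C] F(1) that
      by (simp add: R.topspace_induced_zariski[OF fg])
    show "?pre C \<noteq> carrier M" using \<psi>_dense[of C] F(1) that by blast
  qed
  moreover have "\<Union>(?pre ` \<F>) = carrier M" using F(2) \<psi>_closed by blast
  ultimately have "\<kappa> \<le>o |?pre ` \<F>|"
    using \<kappa> unfolding is_sigma_tau_def is_min_card_def by auto
  then show ?thesis using card_of_image by (rule ordLeq_transitive)
qed

lemma sigma_lower_bound:
  assumes \<kappa>: "is_sigma R M \<kappa>"
    and F: "\<forall>H\<in>\<F>. Module.submodule H A N \<and> H \<noteq> carrier N" "\<Union>\<F> = carrier N"
  shows "\<kappa> \<le>o |\<F>|"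
proof -
  let ?pre = "\<lambda>C. {x \<in> carrier M. \<psi> x \<in> C}"
  have "Module.submodule (?pre H) R M \<and> ?pre H \<noteq> carrier M" if "H \<in> \<F>" for H
  proof
    show "Module.submodule (?pre H) R M" using submodule_preimage F(1) that by blast
    show "?pre H \<noteq> carrier M" using submodule_eq_carrierI[of H] F(1) that by blast
  qed
  moreover have "\<Union>(?pre ` \<F>) = carrier M" using F(2) \<psi>_closed by blast
  ultimately have "\<kappa> \<le>o |?pre ` \<F>|"
    using \<kappa> unfolding is_sigma_def is_min_card_def by auto
  then show ?thesis using card_of_image by (rule ordLeq_transitive)
qed

text \<open>
  The lower bounds are transported from \<open>M\<close>, and one hyperplane cover, at a maximal ideal over a member
  of \<open>S\<close> with the least residue field, attains both of them.
\<close>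

theorem covering_numbers:
  assumes res: "is_min_residue_card R (S_set R M) \<kappa>"
    and st: "is_sigma_tau R M (\<kappa> +c cone)" and s: "is_sigma R M (\<kappa> +c cone)"
  shows "\<exists>\<kappa>' :: 'a set rel.
    is_min_residue_card A (mSpec A) \<kappa>' \<and> is_sigma_tau A N (\<kappa>' +c cone) \<and>
    is_sigma A N (\<kappa>' +c cone) \<and> \<kappa>' +c cone =o \<kappa> +c cone"
proof -
  obtain m where m: "m \<in> S_set R M" "|carrier (R Quot m)| =o \<kappa>"
    and min: "\<And>m'. m' \<in> S_set R M \<Longrightarrow> \<kappa> \<le>o |carrier (R Quot m')|"
    using res unfolding is_min_residue_card_def is_min_card_def by auto
  obtain n where n: "n \<in> mSpec A" "contraction n = m"
    by (rule bexE[OF S_set_member_is_contraction[OF m(1)]])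
  define \<kappa>' where "\<kappa>' = |carrier (A Quot n)|"
  have iso: "\<kappa>' =o \<kappa>"
    using ordIso_transitive[OF ordIso_symmetric[OF card_residue[OF n(1)]]] m(2) n(2) by (simp add: \<kappa>'_def)
  have iso1: "\<kappa>' +c cone =o \<kappa> +c cone" by (rule csum_cong1[OF iso])
  have "is_min_residue_card A (mSpec A) \<kappa>'"
    unfolding is_min_residue_card_def is_min_card_def
  proof (intro conjI ballI)
    show "\<exists>B\<in>{carrier (A Quot \<nn>) | \<nn>. \<nn> \<in> mSpec A}. |B| =o \<kappa>'"
      using n(1) by (intro bexI[of _ "carrier (A Quot n)"]) (auto simp: \<kappa>'_def card_of_refl)
    fix B assume "B \<in> {carrier (A Quot \<nn>) | \<nn>. \<nn> \<in> mSpec A}"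
    then obtain k where k: "k \<in> mSpec A" "B = carrier (A Quot k)" by (elim CollectE exE conjE)
    have "\<kappa>' \<le>o |carrier (R Quot contraction k)|"
      by (rule ordIso_ordLeq_trans[OF iso min[OF contraction_in_S_set[OF k(1)]]])
    then show "\<kappa>' \<le>o |B|" unfolding k(2) using card_residue[OF k(1)] by (rule ordLeq_ordIso_trans)
  qed
  moreover obtain \<F> where \<F>: "|\<F>| \<le>o \<kappa>' +c cone" "\<Union>\<F> = carrier N"
    "\<forall>H\<in>\<F>. Module.submodule H A N \<and> H \<noteq> carrier N \<and> closedin (induced_zariski A N) H"
    using A.hyperplane_cover[OF finitely_generated_localization[OF fg] mSpec_subset_S_set[OF n(1)]]
    unfolding \<kappa>'_def by (elim exE conjE)
  have lower: "\<kappa>' +c cone \<le>o |\<G>|" if "\<kappa> +c cone \<le>o |\<G>|" for \<G> :: "'n set set"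
    by (rule ordIso_ordLeq_trans[OF iso1 that])
  have "is_sigma_tau A N (\<kappa>' +c cone)"
    unfolding is_sigma_tau_def is_min_card_def
  proof (intro conjI ballI)
    have "\<kappa>' +c cone \<le>o |\<F>|" by (rule lower, rule sigma_tau_lower_bound[OF st]) (use \<F> in auto)
    then show "\<exists>\<G>\<in>{\<F>. (\<forall>C\<in>\<F>. closedin (induced_zariski A N) C \<and> C \<noteq> carrier N) \<and> \<Union>\<F> = carrier N}.
        |\<G>| =o \<kappa>' +c cone"
      using \<F> by (intro bexI[of _ \<F>]) (auto simp: ordIso_iff_ordLeq)
    fix \<G> assume "\<G> \<in> {\<F>. (\<forall>C\<in>\<F>. closedin (induced_zariski A N) C \<and> C \<noteq> carrier N) \<and> \<Union>\<F> = carrier N}"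
    then show "\<kappa>' +c cone \<le>o |\<G>|" by (intro lower sigma_tau_lower_bound[OF st]) simp_all
  qed
  moreover have "is_sigma A N (\<kappa>' +c cone)"
    unfolding is_sigma_def is_min_card_def
  proof (intro conjI ballI)
    have "\<kappa>' +c cone \<le>o |\<F>|" by (rule lower, rule sigma_lower_bound[OF s]) (use \<F> in auto)
    then show "\<exists>\<G>\<in>{\<F>. (\<forall>H\<in>\<F>. Module.submodule H A N \<and> H \<noteq> carrier N) \<and> \<Union>\<F> = carrier N}.
        |\<G>| =o \<kappa>' +c cone"
      using \<F> by (intro bexI[of _ \<F>]) (auto simp: ordIso_iff_ordLeq)
    fix \<G> assume "\<G> \<in> {\<F>. (\<forall>H\<in>\<F>. Module.submodule H A N \<and> H \<noteq> carrier N) \<and> \<Union>\<F> = carrier N}"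
    then show "\<kappa>' +c cone \<le>o |\<G>|" by (intro lower sigma_lower_bound[OF s]) simp_all
  qed
  ultimately show ?thesis using iso1 by (intro exI[of _ \<kappa>'] conjI)
qed

end

lemma support_localization_loc_module:
  assumes R: "cring R" and M: "Module.module R M" and fg: "finitely_generated R M"
    and T: "T = carrier R - \<Union>(S_set R M)"
  shows "support_localization R M (loc_ring R T) (loc_module R M T) T
    (\<lambda>a. rfrac R T a \<one>\<^bsub>R\<^esub>) (\<lambda>x. mfrac M T x \<one>\<^bsub>R\<^esub>)"
proof -
  interpret module R M by (rule M)
  have prime: "primeideal m R" if "m \<in> S_set R M" for m
    using that by (auto simp: S_set_def mSpec_def intro: maximalideal_prime)
  interpret module_fractions R M T
  proof
    show "T \<subseteq> carrier R" by (auto simp: T)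
    have "\<one>\<^bsub>R\<^esub> \<notin> m" if "m \<in> S_set R M" for m
      using primeideal.I_notcarr[OF prime[OF that]] ideal.one_imp_carrier[OF primeideal.axioms(1)[OF prime[OF that]]] by blast
    then show "\<one>\<^bsub>R\<^esub> \<in> T" by (auto simp: T)
    show "s \<otimes>\<^bsub>R\<^esub> t \<in> T" if "s \<in> T" "t \<in> T" for s t
    proof -
      have "s \<otimes>\<^bsub>R\<^esub> t \<notin> m" if m: "m \<in> S_set R M" for m
        using primeideal.I_prime[OF prime[OF m], of s t] \<open>s \<in> T\<close> \<open>t \<in> T\<close> m by (auto simp: T)
      then show ?thesis using that by (auto simp: T)
    qed
  qed
  show ?thesis
  proof (intro support_localization.intro module_localization.intro M loc_module_module
      support_localization_axioms.intro module_localization_axioms.intro fg T T_sub T_one T_mult)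
    show "(\<lambda>a. rfrac R T a \<one>\<^bsub>R\<^esub>) \<in> ring_hom R A"
      by (rule ring_hom_memI) (simp_all add: add_rfrac mult_rfrac loc_ring_eq_loc_module(5))
    show "frac x \<one>\<^bsub>R\<^esub> \<in> carrier L" if "x \<in> carrier M" for x using that by simp
    show "frac (x \<oplus>\<^bsub>M\<^esub> y) \<one>\<^bsub>R\<^esub> = frac x \<one>\<^bsub>R\<^esub> \<oplus>\<^bsub>L\<^esub> frac y \<one>\<^bsub>R\<^esub>"
      if "x \<in> carrier M" "y \<in> carrier M" for x y using that by (simp add: add_frac)
    show "frac (a \<odot>\<^bsub>M\<^esub> x) \<one>\<^bsub>R\<^esub> = rfrac R T a \<one>\<^bsub>R\<^esub> \<odot>\<^bsub>L\<^esub> frac x \<one>\<^bsub>R\<^esub>"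
      if "a \<in> carrier R" "x \<in> carrier M" for a x using that by (simp add: smult_frac)
    show "\<exists>i\<in>carrier A. i \<otimes>\<^bsub>A\<^esub> rfrac R T t \<one>\<^bsub>R\<^esub> = \<one>\<^bsub>A\<^esub>" if t: "t \<in> T" for t
    proof
      show "rfrac R T \<one>\<^bsub>R\<^esub> t \<otimes>\<^bsub>A\<^esub> rfrac R T t \<one>\<^bsub>R\<^esub> = \<one>\<^bsub>A\<^esub>"
        using t rfrac_cancel[of "\<one>\<^bsub>R\<^esub>" "\<one>\<^bsub>R\<^esub>" t] by (simp add: mult_rfrac loc_ring_eq_loc_module(5))
    qed (use t in simp)
    show "\<exists>a\<in>carrier R. \<exists>s\<in>T. rfrac R T s \<one>\<^bsub>R\<^esub> \<otimes>\<^bsub>A\<^esub> z = rfrac R T a \<one>\<^bsub>R\<^esub>" if zA: "z \<in> carrier A" for z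
    proof -
      obtain a s where z: "z = rfrac R T a s" "a \<in> carrier R" "s \<in> T"
        using zA by (auto simp: carrier_loc_ring)
      have "rfrac R T s \<one>\<^bsub>R\<^esub> \<otimes>\<^bsub>A\<^esub> z = rfrac R T a \<one>\<^bsub>R\<^esub>"
        using z rfrac_cancel[of a "\<one>\<^bsub>R\<^esub>" s] by (simp add: mult_rfrac)
      then show ?thesis using z by blast
    qed
    show "\<exists>x\<in>carrier M. \<exists>s\<in>T. rfrac R T s \<one>\<^bsub>R\<^esub> \<odot>\<^bsub>L\<^esub> z = frac x \<one>\<^bsub>R\<^esub>" if zL: "z \<in> carrier L" for z
    proof -
      obtain x s where z: "z = frac x s" "x \<in> carrier M" "s \<in> T"
        using zL by (auto simp: carrier_loc_module)
      have "rfrac R T s \<one>\<^bsub>R\<^esub> \<odot>\<^bsub>L\<^esub> z = frac x \<one>\<^bsub>R\<^esub>"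
        using z frac_cancel[of x "\<one>\<^bsub>R\<^esub>" s] by (simp add: smult_frac)
      then show ?thesis using z by blast
    qed
    show "\<exists>u\<in>T. u \<otimes>\<^bsub>R\<^esub> a = \<zero>\<^bsub>R\<^esub>" if "a \<in> carrier R" "rfrac R T a \<one>\<^bsub>R\<^esub> = \<zero>\<^bsub>A\<^esub>" for a
      using that rfrac_zero_iff by simp
    show "\<exists>u\<in>T. u \<odot>\<^bsub>M\<^esub> x = \<zero>\<^bsub>M\<^esub>" if x: "x \<in> carrier M" "frac x \<one>\<^bsub>R\<^esub> = \<zero>\<^bsub>L\<^esub>" for x
    proof -
      obtain u where u: "u \<in> T" "(u \<otimes>\<^bsub>R\<^esub> \<one>\<^bsub>R\<^esub>) \<odot>\<^bsub>M\<^esub> \<zero>\<^bsub>M\<^esub> = (u \<otimes>\<^bsub>R\<^esub> \<one>\<^bsub>R\<^esub>) \<odot>\<^bsub>M\<^esub> x"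
        using x by (auto simp: zero_loc_module frac_eq_iff)
      then show ?thesis by (intro bexI[of _ u]) simp_all
    qed
  qed
qed

theorem corollary3p10:
  fixes R :: "('r, 'x) ring_scheme"
    and M :: "('r, 'm, 'y) module_scheme"
    and T :: "'r set"
    and \<kappa> :: "'k rel"
  assumes "cring R"
    and "Module.module R M"
    and "finitely_generated R M"
    and "\<forall>\<mm>\<in>S_set R M. infinite (carrier (R Quot \<mm>))"
    and "is_min_residue_card R (S_set R M) \<kappa>"
    and "is_sigma_tau R M (\<kappa> +c cone)"
    and "is_sigma R M (\<kappa> +c cone)"
    and "T = carrier R - \<Union>(S_set R M)"
  shows "\<exists>\<kappa>' :: ('r \<times> 'r) set set rel.
           is_min_residue_card (loc_ring R T) (mSpec (loc_ring R T)) \<kappa>' \<and>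
           is_sigma_tau (loc_ring R T) (loc_module R M T) (\<kappa>' +c cone) \<and>
           is_sigma (loc_ring R T) (loc_module R M T) (\<kappa>' +c cone) \<and>
           \<kappa>' +c cone =o \<kappa> +c cone"
  by (rule support_localization.covering_numbers[OF support_localization_loc_module[OF assms(1,2,3,8)] assms(5,6,7)])

end
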